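(* Let $n\ge4$, $2<p<\frac{2n}{n-2}$, $s_0=\frac{(p-2)n}{2p}$ and $0<s\le s_0$. Suppose $\inf_{x\in\mathbb{R}^n}V(x)>0$ and $V\in L^\infty_{loc}(\mathbb{R}^n)$. Then the infimum $$S_V(n,s)=\inf_{u\in H^s(\mathbb{R}^n)\setminus\{0\}}\frac{\int_{\mathbb{R}^n}|(-\Delta)^{s/2}u|^2\,dx+\int_{\mathbb{R}^n}Vu^2\,dx}{\left(\int_{\mathbb{R}^n}|u|^p\,dx\right)^{2/p}}$$ is not achieved.
   Context: $(-\Delta)^{s/2}$ is the Fourier multiplier operator with symbol $(2\pi|\xi|)^{s}$, for the Fourier transform $\mathcal F(u)(\xi)=\int_{\mathbb{R}^n}e^{-2\pi i x\cdot\xi}u(x)\,dx$. The infimum is taken over (and "achieved" refers to) those nonzero $u\in H^s(\mathbb{R}^n)$ for which the quotient is meaningful, i.e. $\int|u|^p\,dx<\infty$ and $\int Vu^2\,dx<\infty$. *)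

theory Defs
  imports "HOL-Analysis.Analysis"
begin

definition square_integrable :: "('a::euclidean_space \<Rightarrow> complex) \<Rightarrow> bool" where
  "square_integrable f \<longleftrightarrow>
     f \<in> borel_measurable lebesgue \<and> integrable lebesgue (\<lambda>x. (cmod (f x))\<^sup>2)"

definition fourier_integral ::
  "('a::euclidean_space \<Rightarrow> complex) \<Rightarrow> 'a \<Rightarrow> complex" where
  "fourier_integral f \<xi> =
     (LINT x|lebesgue. exp (- 2 * complex_of_real pi * \<i> * complex_of_real (x \<bullet> \<xi>)) * f x)"

text \<open>
  The Fourier transform on \<open>L\<^sup>2\<close> is the limit in \<open>L\<^sup>2\<close> of the Fourier integrals of the
  truncations to balls, which are integrable. By Plancherel's theorem the limit exists for every
  square integrable function, and it is unique almost everywhere; \<open>fourier_transform\<close> picks a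
  representative.
\<close>

definition has_fourier_transform ::
  "('a::euclidean_space \<Rightarrow> complex) \<Rightarrow> ('a \<Rightarrow> complex) \<Rightarrow> bool" where
  "has_fourier_transform f g \<longleftrightarrow>
     square_integrable f \<and> square_integrable g \<and>
     ((\<lambda>R::real. \<integral>\<^sup>+\<xi>. ennreal ((cmod
          (fourier_integral (\<lambda>x. indicator (cball 0 R) x * f x) \<xi> - g \<xi>))\<^sup>2) \<partial>lebesgue)
        \<longlongrightarrow> 0) at_top"

definition fourier_transform ::
  "('a::euclidean_space \<Rightarrow> complex) \<Rightarrow> 'a \<Rightarrow> complex" where
  "fourier_transform f = (SOME g. has_fourier_transform f g)"

text \<open>The kernel of the inverse transform is \<open>exp (2 \<pi> i x \<bullet> \<xi>)\<close>, whence the reflection.\<close>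

definition inverse_fourier_transform ::
  "('a::euclidean_space \<Rightarrow> complex) \<Rightarrow> 'a \<Rightarrow> complex" where
  "inverse_fourier_transform g x = fourier_transform g (- x)"

definition fourier_multiplier ::
  "('a::euclidean_space \<Rightarrow> complex) \<Rightarrow> ('a \<Rightarrow> complex) \<Rightarrow> 'a \<Rightarrow> complex" where
  "fourier_multiplier m f = inverse_fourier_transform (\<lambda>\<xi>. m \<xi> * fourier_transform f \<xi>)"

text \<open>\<open>half_laplacian s\<close> is the operator \<open>(- \<Delta>)\<close> raised to the power \<open>s / 2\<close>, of order \<open>s\<close>.\<close>

definition half_laplacian ::
  "real \<Rightarrow> ('a::euclidean_space \<Rightarrow> complex) \<Rightarrow> 'a \<Rightarrow> complex" where
  "half_laplacian s = fourier_multiplier (\<lambda>\<xi>. complex_of_real ((2 * pi * norm \<xi>) powr s))"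

definition sobolev_space :: "real \<Rightarrow> ('a::euclidean_space \<Rightarrow> complex) set" where
  "sobolev_space s =
     {f. square_integrable f \<and>
         square_integrable
           (\<lambda>\<xi>. complex_of_real ((1 + (norm \<xi>)\<^sup>2) powr (s / 2)) * fourier_transform f \<xi>)}"

definition locally_essentially_bounded :: "('a::euclidean_space \<Rightarrow> real) \<Rightarrow> bool" where
  "locally_essentially_bounded V \<longleftrightarrow>
     V \<in> borel_measurable lebesgue \<and>
     (\<forall>K. compact K \<longrightarrow> (\<exists>C. AE x in lebesgue. x \<in> K \<longrightarrow> \<bar>V x\<bar> \<le> C))"

text \<open>
  The competitors are real-valued. Functions represent classes modulo null sets, so being nonzero
  means not vanishing almost everywhere.
\<close>

definition admissible ::
  "('a::euclidean_space \<Rightarrow> real) \<Rightarrow> real \<Rightarrow> real \<Rightarrow> ('a \<Rightarrow> real) set" where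
  "admissible V p s =
     {u. (\<lambda>x. complex_of_real (u x)) \<in> sobolev_space s \<and>
         \<not> (AE x in lebesgue. u x = 0) \<and>
         integrable lebesgue (\<lambda>x. \<bar>u x\<bar> powr p) \<and>
         integrable lebesgue (\<lambda>x. V x * (u x)\<^sup>2)}"

definition sobolev_quotient ::
  "('a::euclidean_space \<Rightarrow> real) \<Rightarrow> real \<Rightarrow> real \<Rightarrow> ('a \<Rightarrow> real) \<Rightarrow> real" where
  "sobolev_quotient V p s u =
     ((LINT x|lebesgue. (cmod (half_laplacian s (\<lambda>y. complex_of_real (u y)) x))\<^sup>2) +
      (LINT x|lebesgue. V x * (u x)\<^sup>2)) /
     (LINT x|lebesgue. \<bar>u x\<bar> powr p) powr (2 / p)"

text \<open>For nonnegative \<open>V\<close> the quotients are bounded below by 0, so the real infimum is genuine.\<close>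

definition sobolev_infimum ::
  "('a::euclidean_space \<Rightarrow> real) \<Rightarrow> real \<Rightarrow> real \<Rightarrow> real" where
  "sobolev_infimum V p s = (INF u\<in>admissible V p s. sobolev_quotient V p s u)"

end

theory Submission
  imports Defs "HOL-Probability.Characteristic_Functions"
begin

text \<open>
  Since \<open>0 < s \<le> s\<^sub>0 < 1\<close>, the numerator without potential is a Dirichlet form: subordinating
  \<open>\<bar>\<xi>\<bar>\<close> to the power \<open>2 s\<close> to the heat semigroup writes it as a constant times the integral over
  \<open>t > 0\<close> of \<open>t\<close> to the power \<open>- 1 - s\<close> times the heat energy, that is, the double integral of
  the heat kernel at \<open>x - y\<close> against \<open>\<bar>f x - f y\<bar>\<^sup>2\<close>. In this form it scales explicitly, and
  multiplication by a Lipschitz cutoff at radius \<open>R\<close> increases it by a factor tending to 1 and a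
  summand tending to 0 as \<open>R\<close> grows.

  For a compactly supported competitor \<open>w\<close>, replace \<open>w x\<close> by \<open>w (l x)\<close> and let \<open>l\<close> tend to
  infinity. As \<open>V\<close> is bounded near the origin, the potential term of the quotient disappears, while
  \<open>s \<le> s\<^sub>0\<close> keeps the energy term from growing. Hence the infimum is at most the potential-free
  quotient of \<open>w\<close> and, by cutting off, of every competitor. A minimizer would contradict this
  because \<open>V > 0\<close>.
\<close>

text \<open>A Fourier multiplier gives no pointwise hold on a product, whereas the heat form splits
  a cutoff by a discrete product rule; this is why the energy is moved away from the frequency side.
  The same form also yields Plancherel's theorem: with a Gaussian weight on the frequency side,
  Fubini identifies the defect of the isometry with the heat energy, and that energy vanishes as t
  tends to 0. The norm of \<open>half_laplacian\<close> then reduces to the isometry of the forward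
  transform, because the inverse transform is defined as a forward transform followed by a
  reflection.

  Cutting off has to precede dilating: V is bounded on compact sets only, so dilating a competitor
  of unbounded support may make its potential term infinite. The upper bound on p says exactly that
  \<open>s\<^sub>0\<close> is less than 1; hence s < 1, which makes the subordination integral
  converge at t = 0.\<close>

subsection \<open>The heat kernel\<close>

text \<open>The usual heat kernel at time t / (4 pi). With this normalization it is the Fourier
  transform, in the convention of \<open>fourier_integral\<close>, of the Gaussian exp (- pi t
  |x|^2).\<close>

definition heat_kernel :: "real \<Rightarrow> 'a::euclidean_space \<Rightarrow> real" where
  "heat_kernel t z = t powr (- real DIM('a) / 2) * exp (- pi * (norm z)\<^sup>2 / t)"

lemma heat_kernel_nonneg [simp]: "0 \<le> heat_kernel t z"
  by (simp add: heat_kernel_def)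

lemma heat_kernel_minus_commute: "heat_kernel t (x - y) = heat_kernel t (y - x)"
  by (simp add: heat_kernel_def norm_minus_commute)

lemma heat_kernel_measurable [measurable]:
  "case_prod heat_kernel \<in> borel_measurable (borel \<Otimes>\<^sub>M (borel :: 'a::euclidean_space measure))"
  unfolding heat_kernel_def[abs_def] by measurable

text \<open>Substituting c x with c^2 = 2 pi e turns the standard normal density into a multiple of
  exp (- pi e x^2), so the integral is the characteristic function of the standard normal law at - 2
  pi z / c.\<close>

lemma integral_gaussian_real:
  fixes e z :: real
  assumes e: "0 < e"
  shows "integrable lborel (\<lambda>x. complex_of_real (exp (- pi * e * x\<^sup>2)) * iexp (- 2 * pi * z * x))"
    and "(LINT x|lborel. complex_of_real (exp (- pi * e * x\<^sup>2)) * iexp (- 2 * pi * z * x)) =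
      complex_of_real (e powr (-1/2) * exp (- pi * z\<^sup>2 / e))"
proof -
  define c where "c = sqrt (2 * pi * e)"
  have c: "c > 0" and c2: "c\<^sup>2 = 2 * pi * e" using e by (auto simp: c_def)
  define t where "t = - 2 * pi * z / c"
  let ?h = "\<lambda>x. std_normal_density x *\<^sub>R iexp (t * x)"
  have int: "integrable lborel ?h"
    by (rule Bochner_Integration.integrable_bound[OF integrable_normal_density[of 1 0]]) auto
  have "(LINT x|lborel. ?h x) = char std_normal_distribution t"
    unfolding char_def by (subst integral_density) auto
  also have "\<dots> = exp (- (t^2) / 2)"
    by (simp add: char_std_normal_distribution)
  finally have A: "(LINT x|lborel. ?h x) = exp (- (t^2) / 2)" .
  have "t * c = - 2 * pi * z" using c by (simp add: t_def)
  hence tcx: "t * (c * x) = - 2 * pi * z * x" for x by (simp add: mult.assoc[symmetric])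
  have eq: "?h (c * x) = complex_of_real (1 / sqrt (2 * pi)) * (complex_of_real (exp (- pi * e * x\<^sup>2)) * iexp (- 2 * pi * z * x))" for x
    by (simp only: tcx) (simp add: normal_density_def power_mult_distrib c2 scaleR_conv_of_real)
  have B: "integrable lborel (\<lambda>x. ?h (0 + c * x))"
    using int c by (intro lborel_integrable_real_affine) auto
  show "integrable lborel (\<lambda>x. complex_of_real (exp (- pi * e * x\<^sup>2)) * iexp (- 2 * pi * z * x))"
    using integrable_mult_right[OF B, of "complex_of_real (sqrt (2 * pi))"] unfolding add_0 eq by simp
  have "(LINT x|lborel. ?h x) = c *\<^sub>R (LINT x|lborel. ?h (0 + c * x))"
    using c by (subst lborel_integral_real_affine[where c=c and t=0]) auto
  also have "\<dots> = complex_of_real (c / sqrt (2 * pi)) * (LINT x|lborel. complex_of_real (exp (- pi * e * x\<^sup>2)) * iexp (- 2 * pi * z * x))"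
    unfolding add_0 eq by (simp only: integral_mult_right_zero scaleR_conv_of_real) (simp add: mult.assoc)
  also have "c / sqrt (2 * pi) = sqrt e" by (simp add: c_def real_sqrt_mult)
  finally have C: "complex_of_real (sqrt e) * (LINT x|lborel. complex_of_real (exp (- pi * e * x\<^sup>2)) * iexp (- 2 * pi * z * x)) = exp (- (t^2) / 2)"
    using A by simp
  have "t\<^sup>2 / 2 = pi * z\<^sup>2 / e"
    using c2 e by (simp add: t_def power_divide power_mult_distrib field_simps power2_eq_square)
  hence t2: "- (t\<^sup>2) / 2 = - pi * z\<^sup>2 / e" by simp
  have p: "e powr (-1/2) = 1 / sqrt e" using e by (simp add: powr_minus_divide powr_half_sqrt)
  from e have "complex_of_real (sqrt e) \<noteq> 0" by simp
  hence "(LINT x|lborel. complex_of_real (exp (- pi * e * x\<^sup>2)) * iexp (- 2 * pi * z * x)) = exp (- (t^2) / 2) / complex_of_real (sqrt e)"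
    unfolding nonzero_eq_divide_eq[OF \<open>complex_of_real (sqrt e) \<noteq> 0\<close>] using C by (simp only: mult.commute)
  thus "(LINT x|lborel. complex_of_real (exp (- pi * e * x\<^sup>2)) * iexp (- 2 * pi * z * x)) =
      complex_of_real (e powr (-1/2) * exp (- pi * z\<^sup>2 / e))"
    unfolding p t2 by simp
qed

text \<open>Both the Gaussian and the exponential are products over the coordinates, and
  \<open>lborel\<close> is the image of a product measure, so the integral is a product of
  one-dimensional ones.\<close>

lemma integral_gaussian:
  fixes z :: "'a::euclidean_space"
  assumes e: "0 < e"
  shows "integrable lborel (\<lambda>x::'a. complex_of_real (exp (- pi * e * (norm x)\<^sup>2)) * iexp (- 2 * pi * (z \<bullet> x)))" (is ?I)
    and "(LINT x|lborel. complex_of_real (exp (- pi * e * (norm x)\<^sup>2)) * iexp (- 2 * pi * (z \<bullet> x))) =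
      complex_of_real (heat_kernel e z)" (is ?E)
proof -
  interpret product_sigma_finite "\<lambda>_::'a. lborel :: real measure" by standard
  define F where "F b x = complex_of_real (exp (- pi * e * x\<^sup>2)) * iexp (- 2 * pi * (z \<bullet> b) * x)" for b :: 'a and x :: real
  have F: "integrable lborel (F b)" "integral\<^sup>L lborel (F b) = complex_of_real (e powr (-1/2) * exp (- pi * (z \<bullet> b)\<^sup>2 / e))" for b
    unfolding F_def using integral_gaussian_real[OF e] by auto
  have nrm: "(norm y)\<^sup>2 = (\<Sum>b\<in>Basis. (y \<bullet> b)\<^sup>2)" for y :: 'a
    by (simp add: norm_eq_sqrt_inner euclidean_inner[of y y] power2_eq_square sum_nonneg)
  have prod: "complex_of_real (exp (- pi * e * (norm x)\<^sup>2)) * iexp (- 2 * pi * (z \<bullet> x)) = (\<Prod>b\<in>Basis. F b (x \<bullet> b))" for x :: 'a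
    unfolding F_def prod.distrib nrm euclidean_inner[of z x]
    by (simp add: exp_sum sum_distrib_left mult_ac of_real_prod[symmetric] sum_negf[symmetric] flip: exp_of_real)
  let ?T = "\<lambda>f. \<Sum>b\<in>Basis. f b *\<^sub>R b :: 'a"
  have T[measurable]: "?T \<in> (\<Pi>\<^sub>M b\<in>Basis. lborel) \<rightarrow>\<^sub>M borel" by measurable
  have Fm[measurable]: "(\<lambda>x::'a. (\<Prod>b\<in>Basis. F b (x \<bullet> b))) \<in> borel_measurable borel"
    unfolding F_def by measurable
  have TF: "(\<Prod>b\<in>Basis. F b (?T f \<bullet> b)) = (\<Prod>b\<in>Basis. F b (f b))" for f
    by (intro prod.cong refl) simp
  show ?I
    unfolding prod lborel_eq[where 'a='a]
    by (subst integrable_distr_eq, simp, simp, subst TF) (auto intro!: product_integrable_prod F)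
  have "(LINT x|lborel. (\<Prod>b\<in>Basis. F b (x \<bullet> b))) = (\<Prod>b\<in>(Basis::'a set). integral\<^sup>L lborel (F b))"
    unfolding lborel_eq[where 'a='a]
    by (subst integral_distr, simp, simp, subst TF) (auto intro!: product_integral_prod F)
  also have "\<dots> = complex_of_real (heat_kernel e z)"
    unfolding F heat_kernel_def nrm using e
    by (simp add: prod.distrib of_real_prod[symmetric] exp_sum[symmetric] sum_distrib_left sum_divide_distrib sum_negf powr_power flip: of_real_power)
  finally show ?E unfolding prod .
qed

lemma nn_integral_lborel_affine:
  fixes f :: "'a::euclidean_space \<Rightarrow> ennreal"
  assumes [measurable]: "f \<in> borel_measurable borel" and c: "c \<noteq> 0"
  shows "(\<integral>\<^sup>+x. f x \<partial>lborel) = ennreal (\<bar>c\<bar> ^ DIM('a)) * (\<integral>\<^sup>+x. f (t + c *\<^sub>R x) \<partial>lborel)"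
  by (subst lborel_affine[OF c, of t]) (simp add: nn_integral_density nn_integral_distr nn_integral_cmult ennreal_power)

text \<open>As a function of z the kernel is a multiple of the Gaussian with parameter 1 / t, whose
  integral is its Fourier transform at frequency 0.\<close>

lemma nn_integral_heat_kernel:
  assumes t: "0 < t"
  shows "(\<integral>\<^sup>+z. heat_kernel t (z::'a::euclidean_space) \<partial>lborel) = 1"
proof -
  let ?g = "\<lambda>x::'a. exp (- pi * (1 / t) * (norm x)\<^sup>2)"
  have e: "0 < 1 / t" using t by simp
  have i: "complex_integrable lborel (\<lambda>x. complex_of_real (?g x))"
    using integral_gaussian(1)[OF e, of "0::'a"] by simp
  have "(LINT x|lborel. complex_of_real (?g x)) = complex_of_real (heat_kernel (1 / t) (0::'a))"
    using integral_gaussian(2)[OF e, of "0::'a"] by simp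
  hence "(LINT x|lborel. ?g x) = heat_kernel (1 / t) (0::'a)"
    by (simp only: integral_complex_of_real of_real_eq_iff)
  hence I: "(LINT x|lborel. heat_kernel t (x::'a)) = 1"
    using t by (simp add: heat_kernel_def powr_divide powr_minus)
  have i': "integrable lborel (\<lambda>x::'a. heat_kernel t x)"
    using i unfolding complex_of_real_integrable_eq by (simp add: heat_kernel_def)
  show ?thesis
    using nn_integral_eq_integral[OF i'] I by simp
qed

lemma nn_integral_heat_kernel_diff:
  fixes x :: "'a::euclidean_space"
  assumes t: "0 < t"
  shows "(\<integral>\<^sup>+y. heat_kernel t (x - y) \<partial>lborel) = 1" "(\<integral>\<^sup>+y. heat_kernel t (y - x) \<partial>lborel) = 1"
proof -
  have "(\<integral>\<^sup>+z. heat_kernel t (z::'a) \<partial>lborel) = (\<integral>\<^sup>+y. heat_kernel t (x - y) \<partial>lborel)"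
    by (subst nn_integral_lborel_affine[where c="-1" and t=x]) auto
  thus "(\<integral>\<^sup>+y. heat_kernel t (x - y) \<partial>lborel) = 1"
    using nn_integral_heat_kernel[OF t] by metis
  thus "(\<integral>\<^sup>+y. heat_kernel t (y - x) \<partial>lborel) = 1"
    by (simp add: heat_kernel_minus_commute)
qed

text \<open>For square integrable f this is twice the inner product of f - P f with f, where P is
  convolution with the kernel. As a double integral in \<open>ennreal\<close> it makes sense before
  any integrability is known, and Tonelli's theorem applies freely.\<close>

definition heat_energy :: "real \<Rightarrow> ('a::euclidean_space \<Rightarrow> complex) \<Rightarrow> ennreal" where
  "heat_energy t f =
     (\<integral>\<^sup>+x. \<integral>\<^sup>+y. ennreal (heat_kernel t (x - y) * (cmod (f x - f y))\<^sup>2) \<partial>lborel \<partial>lborel)"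

lemma heat_energy_measurable [measurable]:
  fixes f :: "'a::euclidean_space \<Rightarrow> complex"
  assumes [measurable]: "f \<in> borel_measurable borel"
  shows "(\<lambda>t. heat_energy t f) \<in> borel_measurable borel"
  unfolding heat_energy_def heat_kernel_def by measurable

text \<open>The cross term is split by 2 |a| |b| \<le> d |a|^2 + |b|^2 / d. A small d keeps the
  factor of the main term near 1 and puts the cost on the perturbation b.\<close>

lemma cmod_add_sq_le_weighted:
  assumes d: "0 < (d::real)"
  shows "(cmod (a + b))\<^sup>2 \<le> (1 + d) * (cmod a)\<^sup>2 + (1 + 1 / d) * (cmod b)\<^sup>2"
proof -
  have "(cmod (a + b))\<^sup>2 \<le> (cmod a + cmod b)\<^sup>2"
    by (intro power_mono norm_triangle_ineq) simp
  also have "\<dots> \<le> (1 + d) * (cmod a)\<^sup>2 + (1 + 1 / d) * (cmod b)\<^sup>2"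
  proof -
    have "0 \<le> (d * cmod a - cmod b)\<^sup>2 / d" using d by simp
    also have "\<dots> = d * (cmod a)\<^sup>2 + (cmod b)\<^sup>2 / d - 2 * cmod a * cmod b"
      using d by (simp add: power2_eq_square field_simps)
    finally show ?thesis by (simp add: power2_sum algebra_simps)
  qed
  finally show ?thesis .
qed

lemma cmod_diff_sq_le: "(cmod (a - b))\<^sup>2 \<le> 2 * (cmod a)\<^sup>2 + 2 * (cmod b)\<^sup>2"
  using cmod_add_sq_le_weighted[of 1 a "- b"] by simp

text \<open>The kernel has mass 1 in each variable. The bound is uniform in t, so the heat energy is
  continuous in square mean uniformly in time.\<close>

lemma heat_energy_le:
  fixes f :: "'a::euclidean_space \<Rightarrow> complex"
  assumes [measurable]: "f \<in> borel_measurable borel" and t: "0 < t"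
  shows "heat_energy t f \<le> 4 * (\<integral>\<^sup>+x. ennreal ((cmod (f x))\<^sup>2) \<partial>lborel)"
proof -
  let ?k = "\<lambda>x y. ennreal (heat_kernel t (x - y :: 'a))" and ?F = "\<lambda>x. ennreal ((cmod (f x))\<^sup>2)"
  have "heat_energy t f \<le> (\<integral>\<^sup>+x. \<integral>\<^sup>+y. 2 * (?k x y * ?F x) + 2 * (?k x y * ?F y) \<partial>lborel \<partial>lborel)"
    unfolding heat_energy_def
  proof (intro nn_integral_mono)
    fix x y :: 'a
    have "heat_kernel t (x - y) * (cmod (f x - f y))\<^sup>2 \<le> heat_kernel t (x - y) * (2 * (cmod (f x))\<^sup>2 + 2 * (cmod (f y))\<^sup>2)"
      by (intro mult_left_mono cmod_diff_sq_le) simp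
    hence "ennreal (heat_kernel t (x - y) * (cmod (f x - f y))\<^sup>2) \<le> ennreal (heat_kernel t (x - y) * (2 * (cmod (f x))\<^sup>2 + 2 * (cmod (f y))\<^sup>2))"
      by (rule ennreal_leI)
    also have "\<dots> = 2 * (?k x y * ?F x) + 2 * (?k x y * ?F y)"
      by (simp add: ennreal_mult[symmetric] ennreal_plus[symmetric] ennreal_numeral[symmetric] algebra_simps
          del: ennreal_plus ennreal_numeral)
    finally show "ennreal (heat_kernel t (x - y) * (cmod (f x - f y))\<^sup>2) \<le> 2 * (?k x y * ?F x) + 2 * (?k x y * ?F y)" .
  qed
  also have "\<dots> = 2 * (\<integral>\<^sup>+x. (\<integral>\<^sup>+y. ?k x y * ?F x \<partial>lborel) \<partial>lborel) + 2 * (\<integral>\<^sup>+x. \<integral>\<^sup>+y. ?k x y * ?F y \<partial>lborel \<partial>lborel)"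
    by (simp add: nn_integral_add nn_integral_cmult)
  also have "(\<integral>\<^sup>+x. (\<integral>\<^sup>+y. ?k x y * ?F x \<partial>lborel) \<partial>lborel) = (\<integral>\<^sup>+x. ?F x \<partial>lborel)"
    by (simp add: nn_integral_multc nn_integral_heat_kernel_diff[OF t])
  also have "(\<integral>\<^sup>+x. \<integral>\<^sup>+y. ?k x y * ?F y \<partial>lborel \<partial>lborel) = (\<integral>\<^sup>+y. \<integral>\<^sup>+x. ?k x y * ?F y \<partial>lborel \<partial>lborel)"
    by (rule lborel_pair.Fubini'[symmetric]) measurable
  also have "\<dots> = (\<integral>\<^sup>+x. ?F x \<partial>lborel)"
    by (simp add: nn_integral_multc nn_integral_heat_kernel_diff[OF t])
  finally show ?thesis
    by (metis distrib_right numeral_Bit0)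
qed

lemma heat_energy_add_le_weighted:
  fixes f g :: "'a::euclidean_space \<Rightarrow> complex"
  assumes [measurable]: "f \<in> borel_measurable borel" "g \<in> borel_measurable borel" and d: "0 < (d::real)"
  shows "heat_energy t (\<lambda>x. f x + g x) \<le> ennreal (1 + d) * heat_energy t f + ennreal (1 + 1 / d) * heat_energy t g"
proof -
  have "heat_energy t (\<lambda>x. f x + g x) \<le> (\<integral>\<^sup>+x. \<integral>\<^sup>+y. ennreal (1 + d) * ennreal (heat_kernel t (x - y) * (cmod (f x - f y))\<^sup>2)
      + ennreal (1 + 1 / d) * ennreal (heat_kernel t (x - y) * (cmod (g x - g y))\<^sup>2) \<partial>lborel \<partial>lborel)"
    unfolding heat_energy_def
  proof (intro nn_integral_mono)
    fix x y :: 'a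
    have "(cmod (f x + g x - (f y + g y)))\<^sup>2 \<le> (1 + d) * (cmod (f x - f y))\<^sup>2 + (1 + 1 / d) * (cmod (g x - g y))\<^sup>2"
      using cmod_add_sq_le_weighted[OF d, of "f x - f y" "g x - g y"] by (simp only: add_diff_add)
    hence "heat_kernel t (x - y) * (cmod (f x + g x - (f y + g y)))\<^sup>2 \<le> heat_kernel t (x - y) * ((1 + d) * (cmod (f x - f y))\<^sup>2 + (1 + 1 / d) * (cmod (g x - g y))\<^sup>2)"
      by (rule mult_left_mono) simp
    also have "\<dots> = (1 + d) * (heat_kernel t (x - y) * (cmod (f x - f y))\<^sup>2) + (1 + 1 / d) * (heat_kernel t (x - y) * (cmod (g x - g y))\<^sup>2)"
      by (simp only: distrib_left mult.left_commute)
    finally have "ennreal (heat_kernel t (x - y) * (cmod (f x + g x - (f y + g y)))\<^sup>2) \<le> ennreal \<dots>"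
      by (rule ennreal_leI)
    also have "\<dots> = ennreal (1 + d) * ennreal (heat_kernel t (x - y) * (cmod (f x - f y))\<^sup>2)
      + ennreal (1 + 1 / d) * ennreal (heat_kernel t (x - y) * (cmod (g x - g y))\<^sup>2)"
      using d by (subst ennreal_plus) (simp_all add: ennreal_mult')
    finally show "ennreal (heat_kernel t (x - y) * (cmod (f x + g x - (f y + g y)))\<^sup>2) \<le> \<dots>" .
  qed
  also have "\<dots> = ennreal (1 + d) * heat_energy t f + ennreal (1 + 1 / d) * heat_energy t g"
    by (simp add: heat_energy_def nn_integral_add nn_integral_cmult)
  finally show ?thesis .
qed

lemma heat_energy_add_le:
  fixes f g :: "'a::euclidean_space \<Rightarrow> complex"
  assumes "f \<in> borel_measurable borel" "g \<in> borel_measurable borel"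
  shows "heat_energy t (\<lambda>x. f x + g x) \<le> 2 * heat_energy t f + 2 * heat_energy t g"
  using heat_energy_add_le_weighted[OF assms, of 1 t] by simp

section \<open>Fourier integrals against a Gaussian weight\<close>

lemma fourier_integral_eq_lborel:
  assumes [measurable]: "f \<in> borel_measurable borel"
  shows "fourier_integral f \<xi> = (LINT x|lborel. iexp (- 2 * pi * (x \<bullet> \<xi>)) * f x)"
  unfolding fourier_integral_def
  by (subst integral_completion) (auto intro!: Bochner_Integration.integral_cong simp: mult_ac)

lemma fourier_integral_measurable:
  assumes [measurable]: "f \<in> borel_measurable borel"
  shows "fourier_integral f \<in> borel_measurable borel"
  unfolding fourier_integral_eq_lborel[OF assms, abs_def] by measurable

lemma integrable_lborel_product:
  fixes f :: "'a::euclidean_space \<Rightarrow> complex" and g :: "'b::euclidean_space \<Rightarrow> complex"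
  assumes f: "integrable lborel f" and g: "integrable lborel g"
  shows "integrable (lborel \<Otimes>\<^sub>M lborel) (\<lambda>(x, y). f x * g y)"
proof -
  have [measurable]: "f \<in> borel_measurable borel" "g \<in> borel_measurable borel" using f g by auto
  show ?thesis
  proof (rule lborel_pair.Fubini_integrable)
    show "integrable lborel (\<lambda>x. \<integral>y. norm (case (x, y) of (x, y) \<Rightarrow> f x * g y) \<partial>lborel)"
      using f by (simp add: norm_mult)
    show "AE x in lborel. integrable lborel (\<lambda>y. case (x, y) of (x, y) \<Rightarrow> f x * g y)"
      using g by simp
  qed measurable
qed

text \<open>The Gaussian weight makes Fubini's theorem applicable; letting \<open>t\<close> tend to 0 removes it.\<close>

lemma heat_weighted_plancherel:
  fixes f :: "'a::euclidean_space \<Rightarrow> complex"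
  assumes f: "integrable lborel f" and f2: "integrable lborel (\<lambda>x. (cmod (f x))\<^sup>2)" and t: "0 < t"
  shows "2 * (\<integral>\<^sup>+\<xi>. ennreal (exp (- pi * t * (norm \<xi>)\<^sup>2) * (cmod (fourier_integral f \<xi>))\<^sup>2) \<partial>lborel)
      + heat_energy t f = 2 * (\<integral>\<^sup>+x. ennreal ((cmod (f x))\<^sup>2) \<partial>lborel)"
proof -
  have fm[measurable]: "f \<in> borel_measurable borel" using f by auto
  define F where "F = fourier_integral f"
  have [measurable]: "F \<in> borel_measurable borel"
    unfolding F_def by (rule fourier_integral_measurable) measurable
  define k where "k = (\<lambda>p::'a \<times> 'a. heat_kernel t (fst p - snd p))"
  have km[measurable]: "k \<in> borel_measurable (borel \<Otimes>\<^sub>M borel)"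
    unfolding k_def by measurable
  have [measurable]: "k \<in> borel_measurable borel"
    using km unfolding borel_prod .
  define W where "W = (\<lambda>\<xi>::'a. complex_of_real (exp (- pi * t * (norm \<xi>)\<^sup>2)))"
  define g where "g = (\<lambda>p::'a \<times> 'a. f (fst p) * cnj (f (snd p)))"
  define ph where "ph = (\<lambda>\<xi> (p::'a \<times> 'a). iexp (- 2 * pi * ((fst p - snd p) \<bullet> \<xi>)))"
  \<comment> \<open>Integrating H over the frequency first produces the heat kernel times
    \<open>g\<close>; integrating over the pair p first produces the weighted squared modulus of F.
    Equating the two orders is the heart of the proof.\<close>
  define H where "H = (\<lambda>\<xi> p. W \<xi> * g p * ph \<xi> p)"
  have W: "integrable lborel W"
    unfolding W_def using integral_gaussian(1)[OF t, of "0::'a"] by simp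
  have g: "integrable lborel g"
    using integrable_lborel_product[OF f integrable_cnj[OF f]]
    unfolding lborel_prod g_def by (simp add: case_prod_beta')
  have [measurable]: "W \<in> borel_measurable borel" "g \<in> borel_measurable borel" using W g by auto
  have [measurable]: "cnj \<in> borel_measurable borel"
    by (intro borel_measurable_continuous_onI continuous_intros)
  have "case_prod H \<in> borel_measurable (borel \<Otimes>\<^sub>M (borel \<Otimes>\<^sub>M borel))"
    unfolding H_def ph_def g_def W_def by measurable
  hence Hm: "case_prod H \<in> borel_measurable (lborel \<Otimes>\<^sub>M lborel)"
    unfolding borel_prod[where 'a='a and 'b='a]
    by (subst measurable_cong_sets[OF sets_pair_measure_cong[OF sets_lborel sets_lborel] refl])
  have H: "integrable (lborel \<Otimes>\<^sub>M lborel) (case_prod H)"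
    by (rule Bochner_Integration.integrable_bound[OF integrable_lborel_product[OF W g] Hm])
       (auto simp: H_def ph_def norm_mult)
  have inner_xi: "(LINT \<xi>|lborel. H \<xi> p) = complex_of_real (k p) * g p" for p
  proof -
    have "(LINT \<xi>|lborel. H \<xi> p) = (LINT \<xi>|lborel. g p * (W \<xi> * iexp (- 2 * pi * ((fst p - snd p) \<bullet> \<xi>))))"
      by (simp add: H_def ph_def mult_ac)
    also have "\<dots> = g p * complex_of_real (k p)"
      unfolding W_def k_def integral_mult_right_zero integral_gaussian(2)[OF t] ..
    finally show ?thesis by simp
  qed
  have inner_p: "(LINT p|lborel. H \<xi> p) = complex_of_real (exp (- pi * t * (norm \<xi>)\<^sup>2) * (cmod (F \<xi>))\<^sup>2)" for \<xi>
  proof -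
    define a where "a = (\<lambda>x. iexp (- 2 * pi * (x \<bullet> \<xi>)) * f x)"
    have a: "integrable lborel a"
      unfolding a_def by (rule Bochner_Integration.integrable_bound[OF f]) (auto simp: norm_mult)
    have aF: "(LINT x|lborel. a x) = F \<xi>" unfolding F_def a_def by (simp add: fourier_integral_eq_lborel)
    have c: "cnj (iexp r) = iexp (- r)" for r by (simp add: exp_cnj)
    have ag: "g p * ph \<xi> p = a (fst p) * cnj (a (snd p))" for p
      by (simp add: g_def ph_def a_def c inner_diff_left algebra_simps exp_diff exp_add del: complex_cnj_mult flip: exp_cnj)
         (simp add: exp_minus exp_cnj field_simps)
    have "(LINT p|lborel. a (fst p) * cnj (a (snd p))) = (LINT p|(lborel \<Otimes>\<^sub>M lborel). a (fst p) * cnj (a (snd p)))"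
      by (simp only: lborel_prod)
    also have "\<dots> = (LINT x|lborel. LINT y|lborel. a x * cnj (a y))"
      using integrable_lborel_product[OF a integrable_cnj[OF a]]
      by (subst lborel_pair.integral_fst'[symmetric]) (auto simp: case_prod_beta')
    also have "\<dots> = F \<xi> * cnj (F \<xi>)"
      using aF by simp
    finally have "(LINT p|lborel. g p * ph \<xi> p) = complex_of_real ((cmod (F \<xi>))\<^sup>2)"
      unfolding ag by (simp only: complex_norm_square)
    thus ?thesis unfolding H_def mult.assoc integral_mult_right_zero W_def by simp
  qed
  define A where "A = (LINT \<xi>|lborel. exp (- pi * t * (norm \<xi>)\<^sup>2) * (cmod (F \<xi>))\<^sup>2)"
  have iA: "integrable lborel (\<lambda>\<xi>. exp (- pi * t * (norm \<xi>)\<^sup>2) * (cmod (F \<xi>))\<^sup>2)"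
    using lborel_pair.integrable_fst[OF H] unfolding inner_p complex_of_real_integrable_eq .
  have ig: "integrable lborel (\<lambda>p. complex_of_real (k p) * g p)"
    using lborel_pair.integrable_snd[OF H] unfolding inner_xi .
  have "complex_of_real A = (LINT \<xi>|lborel. LINT p|lborel. H \<xi> p)"
    unfolding inner_p A_def by (simp only: integral_complex_of_real)
  also have "\<dots> = (LINT p|lborel. complex_of_real (k p) * g p)"
    unfolding lborel_pair.Fubini_integral[OF H, symmetric] inner_xi ..
  \<comment> \<open>A is real, so the kernel side may be replaced by its real part, which is the
    cross term of the polarization identity \<open>sq\<close> below.\<close>
  finally have A: "A = (LINT p|lborel. Re (complex_of_real (k p) * g p))"
    using integral_Re[OF ig] by (metis Re_complex_of_real)
  define N where "N = (LINT x|lborel. (cmod (f x))\<^sup>2)"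
  have N: "(\<integral>\<^sup>+x. ennreal ((cmod (f x))\<^sup>2) \<partial>lborel) = ennreal N"
    unfolding N_def by (rule nn_integral_eq_integral[OF f2]) simp
  have N0: "0 \<le> N" unfolding N_def by simp
  have e1: "(\<integral>\<^sup>+p. ennreal (k p * (cmod (f (fst p)))\<^sup>2) \<partial>lborel) = ennreal N"
  proof -
    have "(\<integral>\<^sup>+p. ennreal (k p * (cmod (f (fst p)))\<^sup>2) \<partial>lborel) = (\<integral>\<^sup>+x. \<integral>\<^sup>+y. ennreal (k (x, y) * (cmod (f x))\<^sup>2) \<partial>lborel \<partial>lborel)"
      unfolding lborel_prod[symmetric] by (subst lborel.nn_integral_fst[symmetric]) (auto simp: k_def)
    also have "\<dots> = (\<integral>\<^sup>+x. ennreal ((cmod (f x))\<^sup>2) \<partial>lborel)"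
      by (simp add: k_def ennreal_mult nn_integral_multc nn_integral_heat_kernel_diff[OF t])
    finally show ?thesis by (simp add: N)
  qed
  have e2: "(\<integral>\<^sup>+p. ennreal (k p * (cmod (f (snd p)))\<^sup>2) \<partial>lborel) = ennreal N"
  proof -
    have "(\<integral>\<^sup>+p. ennreal (k p * (cmod (f (snd p)))\<^sup>2) \<partial>lborel) = (\<integral>\<^sup>+y. \<integral>\<^sup>+x. ennreal (k (x, y) * (cmod (f y))\<^sup>2) \<partial>lborel \<partial>lborel)"
      unfolding lborel_prod[symmetric] by (subst lborel_pair.nn_integral_snd[symmetric]) (auto simp: k_def)
    also have "\<dots> = (\<integral>\<^sup>+x. ennreal ((cmod (f x))\<^sup>2) \<partial>lborel)"
      by (simp add: k_def ennreal_mult nn_integral_multc nn_integral_heat_kernel_diff[OF t])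
    finally show ?thesis by (simp add: N)
  qed
  have [simp]: "0 \<le> k p" for p by (simp add: k_def)
  have [measurable]: "(\<lambda>p. f (fst p)) \<in> borel_measurable borel" "(\<lambda>p. f (snd p)) \<in> borel_measurable borel"
    by (rule measurable_compose[OF _ fm], intro borel_measurable_continuous_onI continuous_intros)+
  have h1: "has_bochner_integral lborel (\<lambda>p. k p * (cmod (f (fst p)))\<^sup>2) N"
    by (rule has_bochner_integral_nn_integral[OF _ _ N0 e1]) auto
  have h2: "has_bochner_integral lborel (\<lambda>p. k p * (cmod (f (snd p)))\<^sup>2) N"
    by (rule has_bochner_integral_nn_integral[OF _ _ N0 e2]) auto
  have h3: "has_bochner_integral lborel (\<lambda>p. Re (complex_of_real (k p) * g p)) A"
    unfolding A has_bochner_integral_iff using integrable_Re[OF ig] by auto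
  \<comment> \<open>Polarization turns the heat energy into N + N - 2 A: each square term has
    integral N since the kernel has mass 1 in either variable.\<close>
  have sq: "(cmod (a - b))\<^sup>2 = (cmod a)\<^sup>2 + (cmod b)\<^sup>2 - 2 * Re (a * cnj b)" for a b
    unfolding cmod_power2 by (simp add: power2_eq_square algebra_simps)
  have h4: "has_bochner_integral lborel (\<lambda>p. k p * (cmod (f (fst p) - f (snd p)))\<^sup>2) (N + N - 2 * A)"
    using has_bochner_integral_diff[OF has_bochner_integral_add[OF h1 h2] has_bochner_integral_mult_right[OF h3, of 2]]
    unfolding sq g_def by (simp add: algebra_simps)
  have "heat_energy t f = (\<integral>\<^sup>+p. ennreal (k p * (cmod (f (fst p) - f (snd p)))\<^sup>2) \<partial>lborel)"
    unfolding lborel_prod[symmetric] heat_energy_def by (subst lborel.nn_integral_fst[symmetric]) (auto simp: k_def)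
  also have "\<dots> = ennreal (N + N - 2 * A)"
    using h4 unfolding has_bochner_integral_iff by (subst nn_integral_eq_integral) auto
  finally have E: "heat_energy t f = ennreal (N + N - 2 * A)" .
  have NA: "0 \<le> N + N - 2 * A"
    using h4 unfolding has_bochner_integral_iff by (metis (no_types, lifting) integral_nonneg_AE AE_I2 mult_nonneg_nonneg \<open>\<And>p. 0 \<le> k p\<close> zero_le_power2)
  have A0: "0 \<le> A" unfolding A_def by simp
  have "(\<integral>\<^sup>+\<xi>. ennreal (exp (- pi * t * (norm \<xi>)\<^sup>2) * (cmod (F \<xi>))\<^sup>2) \<partial>lborel) = ennreal A"
    unfolding A_def by (rule nn_integral_eq_integral[OF iA]) simp
  thus ?thesis unfolding E N F_def[symmetric] using NA A0 N0
    by (simp add: ennreal_mult[symmetric] ennreal_plus[symmetric] ennreal_numeral[symmetric]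
          del: ennreal_plus ennreal_numeral)
qed

subsection \<open>Plancherel's theorem for integrable functions\<close>

lemma ennreal_tendsto_0_I:
  fixes h :: "'a \<Rightarrow> ennreal"
  assumes "\<And>e::real. 0 < e \<Longrightarrow> \<forall>\<^sub>F n in G. h n \<le> ennreal e"
  shows "(h \<longlongrightarrow> 0) G"
proof (rule order_tendstoI)
  fix a :: ennreal assume a: "0 < a"
  then obtain b where b: "0 < b" "b < a" using dense by blast
  then obtain e where e: "b = ennreal e" "0 < e" by (cases b) auto
  show "\<forall>\<^sub>F n in G. h n < a"
    using assms[OF e(2)] by eventually_elim (use b e in auto)
qed auto

lemma ennreal_tendsto_0_bound:
  fixes f g :: "'a \<Rightarrow> ennreal"
  assumes "\<And>n. f n \<le> g n" "(g \<longlongrightarrow> 0) G"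
  shows "(f \<longlongrightarrow> 0) G"
  by (rule tendsto_sandwich[of "\<lambda>_. 0" f G g]) (use assms in auto)

text \<open>With w = pi |z|^2 / (2 t), the inequality w \<le> exp w absorbs the factor |z|^2 into
  half of the exponent. What remains is a constant times the kernel at time 2 t, again of mass 1.
  The constant is not sharp; the linear dependence on t is the point.\<close>

lemma heat_kernel_second_moment:
  fixes x :: "'a::euclidean_space"
  assumes t: "0 < t"
  shows "(\<integral>\<^sup>+y. ennreal (heat_kernel t (x - y) * (norm (x - y))\<^sup>2) \<partial>lborel)
    \<le> ennreal (2 * 2 powr (real DIM('a) / 2) / pi * t)"
proof -
  let ?c = "2 * 2 powr (real DIM('a) / 2) / pi * t"
  have le: "heat_kernel t z * (norm z)\<^sup>2 \<le> ?c * heat_kernel (2 * t) z" for z :: 'a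
  proof -
    define w where "w = pi * (norm z)\<^sup>2 / (2 * t)"
    have "w \<le> exp w" using exp_ge_add_one_self[of w] by linarith
    hence "(norm z)\<^sup>2 \<le> 2 * t / pi * exp w" using t by (simp add: w_def field_simps)
    hence "heat_kernel t z * (norm z)\<^sup>2 \<le> heat_kernel t z * (2 * t / pi * exp w)"
      by (rule mult_left_mono) simp
    also have "\<dots> = 2 * t / pi * t powr (- real DIM('a) / 2) * (exp (- pi * (norm z)\<^sup>2 / t) * exp w)"
      by (simp add: heat_kernel_def)
    also have "exp (- pi * (norm z)\<^sup>2 / t) * exp w = exp (- pi * (norm z)\<^sup>2 / (2 * t))"
      unfolding exp_add[symmetric] using t by (simp add: w_def field_simps)
    also have "t powr (- real DIM('a) / 2) = 2 powr (real DIM('a) / 2) * (2 * t) powr (- real DIM('a) / 2)"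
      using t by (simp add: powr_mult powr_minus_divide)
    finally show ?thesis by (simp add: heat_kernel_def mult_ac)
  qed
  have "(\<integral>\<^sup>+y. ennreal (heat_kernel t (x - y) * (norm (x - y))\<^sup>2) \<partial>lborel)
      \<le> (\<integral>\<^sup>+y. ennreal ?c * ennreal (heat_kernel (2 * t) (x - y)) \<partial>lborel)"
    using le t by (intro nn_integral_mono) (simp add: ennreal_mult[symmetric] ennreal_leI)
  also have "\<dots> = ennreal ?c"
    using t by (simp add: nn_integral_cmult nn_integral_heat_kernel_diff)
  finally show ?thesis .
qed

lemma heat_energy_cmult:
  fixes f :: "'a::euclidean_space \<Rightarrow> complex"
  assumes [measurable]: "f \<in> borel_measurable borel"
  shows "heat_energy t (\<lambda>x. c * f x) = ennreal ((cmod c)\<^sup>2) * heat_energy t f"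
proof -
  have "ennreal (heat_kernel t (x - y) * (cmod (c * f x - c * f y))\<^sup>2) =
      ennreal ((cmod c)\<^sup>2) * ennreal (heat_kernel t (x - y) * (cmod (f x - f y))\<^sup>2)" for x y :: 'a
    unfolding right_diff_distrib[symmetric] norm_mult power_mult_distrib
    by (simp add: ennreal_mult[symmetric] mult_ac)
  thus ?thesis unfolding heat_energy_def by (simp add: nn_integral_cmult)
qed

text \<open>Continuity of the heat semigroup at time 0, tested along 1 / (n + 1) so that the
  convergence theorems for sequences of integrals apply. The property is stable under sums,
  multiples and limits in square mean, which reduces it to indicators of open sets.\<close>

definition heat_vanishing :: "('a::euclidean_space \<Rightarrow> complex) \<Rightarrow> bool" where
  "heat_vanishing f \<longleftrightarrow> (\<lambda>n. heat_energy (1 / real (Suc n)) f) \<longlonglongrightarrow> 0"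

lemma heat_vanishing_add:
  fixes f g :: "'a::euclidean_space \<Rightarrow> complex"
  assumes "f \<in> borel_measurable borel" "g \<in> borel_measurable borel"
    and "heat_vanishing f" "heat_vanishing g"
  shows "heat_vanishing (\<lambda>x. f x + g x)"
proof -
  have "(\<lambda>n. 2 * heat_energy (1 / real (Suc n)) f + 2 * heat_energy (1 / real (Suc n)) g) \<longlonglongrightarrow> 2 * 0 + 2 * 0"
    using assms(3,4) unfolding heat_vanishing_def by (intro tendsto_add ennreal_tendsto_cmult) auto
  hence "(\<lambda>n. 2 * heat_energy (1 / real (Suc n)) f + 2 * heat_energy (1 / real (Suc n)) g) \<longlonglongrightarrow> 0"
    by simp
  thus ?thesis unfolding heat_vanishing_def
    by (rule ennreal_tendsto_0_bound[OF heat_energy_add_le[OF assms(1,2)]])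
qed

lemma heat_vanishing_cmult:
  fixes f :: "'a::euclidean_space \<Rightarrow> complex"
  assumes "f \<in> borel_measurable borel" "heat_vanishing f"
  shows "heat_vanishing (\<lambda>x. c * f x)"
  using ennreal_tendsto_cmult[OF _ assms(2)[unfolded heat_vanishing_def], of "ennreal ((cmod c)\<^sup>2)"]
  unfolding heat_vanishing_def heat_energy_cmult[OF assms(1)] by simp

lemma heat_vanishing_approx:
  fixes f :: "'a::euclidean_space \<Rightarrow> complex"
  assumes f: "f \<in> borel_measurable borel"
    and ap: "\<And>e::real. 0 < e \<Longrightarrow> \<exists>g\<in>borel_measurable borel. heat_vanishing g \<and>
       (\<integral>\<^sup>+x. ennreal ((cmod (f x - g x))\<^sup>2) \<partial>lborel) \<le> ennreal e"
  shows "heat_vanishing f"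
  unfolding heat_vanishing_def
proof (rule ennreal_tendsto_0_I)
  fix e :: real assume e: "0 < e"
  \<comment> \<open>The share e / 16 becomes e / 4 by the factor 4 of \<open>heat_energy_le\<close>;
    \<open>heat_energy_add_le\<close> then doubles both contributions of e / 4, giving e.\<close>
  then obtain g where g: "g \<in> borel_measurable borel" "heat_vanishing g"
    and d: "(\<integral>\<^sup>+x. ennreal ((cmod (f x - g x))\<^sup>2) \<partial>lborel) \<le> ennreal (e / 16)"
    using ap[of "e / 16"] by auto
  have "\<forall>\<^sub>F n in sequentially. heat_energy (1 / real (Suc n)) g < ennreal (e / 4)"
    using g(2) e unfolding heat_vanishing_def by (intro order_tendstoD) auto
  thus "\<forall>\<^sub>F n in sequentially. heat_energy (1 / real (Suc n)) f \<le> ennreal e"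
  proof eventually_elim
    case (elim n)
    have m: "(\<lambda>x. f x - g x) \<in> borel_measurable borel" using f g by measurable
    have "heat_energy (1 / real (Suc n)) (\<lambda>x. f x - g x) \<le> 4 * (\<integral>\<^sup>+x. ennreal ((cmod (f x - g x))\<^sup>2) \<partial>lborel)"
      by (rule heat_energy_le[OF m]) simp
    also have "\<dots> \<le> 4 * ennreal (e / 16)" by (intro mult_left_mono d) simp
    also have "\<dots> = ennreal (e / 4)" using e by (simp add: ennreal_mult[symmetric] flip: ennreal_numeral)
    finally have h: "heat_energy (1 / real (Suc n)) (\<lambda>x. f x - g x) \<le> ennreal (e / 4)" .
    have "heat_energy (1 / real (Suc n)) f = heat_energy (1 / real (Suc n)) (\<lambda>x. g x + (f x - g x))" by simp
    also have "\<dots> \<le> 2 * heat_energy (1 / real (Suc n)) g + 2 * heat_energy (1 / real (Suc n)) (\<lambda>x. f x - g x)"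
      by (rule heat_energy_add_le[OF g(1) m])
    also have "\<dots> \<le> 2 * ennreal (e / 4) + 2 * ennreal (e / 4)"
      using elim h by (intro add_mono mult_left_mono) auto
    also have "\<dots> = ennreal e" using e by (simp add: ennreal_mult[symmetric] ennreal_plus[symmetric] del: ennreal_plus flip: ennreal_numeral)
    finally show ?case .
  qed
qed

text \<open>Only the heat passing from U to its complement counts. A point of an open set has
  positive distance r from the complement, so by Chebyshev's inequality with the second moment the
  heat leaving from it is of order t / r^2. This is pointwise in x; the finite measure of U gives
  dominated convergence.\<close>

lemma heat_vanishing_indicator_open:
  fixes U :: "'a::euclidean_space set"
  assumes U: "open U" and fin: "emeasure lborel U < \<infinity>"
  shows "heat_vanishing (\<lambda>x. complex_of_real (indicator U x))"
proof -
  have [measurable]: "U \<in> sets borel" using U by simp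
  define C where "C = 2 * 2 powr (real DIM('a) / 2) / pi"
  have C: "0 < C" by (simp add: C_def)
  define \<phi> where "\<phi> n x = (\<integral>\<^sup>+y. ennreal (heat_kernel (1 / real (Suc n)) (x - y)) * indicator (- U) y \<partial>lborel)" for n and x :: 'a
  have [measurable]: "\<phi> n \<in> borel_measurable borel" for n unfolding \<phi>_def by measurable
  have \<phi>1: "\<phi> n x \<le> 1" for n x
  proof -
    have "\<phi> n x \<le> (\<integral>\<^sup>+y. ennreal (heat_kernel (1 / real (Suc n)) (x - y)) \<partial>lborel)"
      unfolding \<phi>_def by (intro nn_integral_mono) (auto simp: indicator_def)
    thus ?thesis by (simp add: nn_integral_heat_kernel_diff)
  qed
  have \<phi>0: "(\<lambda>n. \<phi> n x) \<longlonglongrightarrow> 0" if x: "x \<in> U" for x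
  proof -
    obtain r where r: "0 < r" "ball x r \<subseteq> U" using U x open_contains_ball by blast
    have le: "\<phi> n x \<le> ennreal (C / r\<^sup>2 * (1 / real (Suc n)))" for n
    proof -
      have "\<phi> n x \<le> (\<integral>\<^sup>+y. ennreal (1 / r\<^sup>2) * ennreal (heat_kernel (1 / real (Suc n)) (x - y) * (norm (x - y))\<^sup>2) \<partial>lborel)"
        unfolding \<phi>_def
      proof (intro nn_integral_mono)
        fix y
        show "ennreal (heat_kernel (1 / real (Suc n)) (x - y)) * indicator (- U) y
          \<le> ennreal (1 / r\<^sup>2) * ennreal (heat_kernel (1 / real (Suc n)) (x - y) * (norm (x - y))\<^sup>2)"
        proof (cases "y \<in> U")
          case False
          hence "r \<le> norm (x - y)" using r by (auto simp: dist_norm subset_iff not_less[symmetric])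
          hence "r\<^sup>2 \<le> (norm (x - y))\<^sup>2" using r by (intro power_mono) auto
          hence "1 \<le> (norm (x - y))\<^sup>2 / r\<^sup>2" using r by simp
          hence "heat_kernel (1 / real (Suc n)) (x - y) * 1 \<le> heat_kernel (1 / real (Suc n)) (x - y) * ((norm (x - y))\<^sup>2 / r\<^sup>2)"
            by (rule mult_left_mono) simp
          thus ?thesis using False by (simp add: ennreal_mult[symmetric] ennreal_leI)
        qed auto
      qed
      also have "\<dots> = ennreal (1 / r\<^sup>2) * (\<integral>\<^sup>+y. ennreal (heat_kernel (1 / real (Suc n)) (x - y) * (norm (x - y))\<^sup>2) \<partial>lborel)"
        by (rule nn_integral_cmult) measurable
      also have "\<dots> \<le> ennreal (1 / r\<^sup>2) * ennreal (C * (1 / real (Suc n)))"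
        unfolding C_def by (intro mult_left_mono heat_kernel_second_moment) simp_all
      also have "\<dots> = ennreal (C / r\<^sup>2 * (1 / real (Suc n)))" using C by (simp add: ennreal_mult[symmetric])
      finally show ?thesis .
    qed
    have "(\<lambda>n. C / r\<^sup>2 * (1 / real (Suc n))) \<longlonglongrightarrow> C / r\<^sup>2 * 0"
      by (intro tendsto_mult tendsto_const LIMSEQ_Suc lim_1_over_n)
    hence "(\<lambda>n. ennreal (C / r\<^sup>2 * (1 / real (Suc n)))) \<longlonglongrightarrow> ennreal 0" by (intro tendsto_ennrealI) simp
    hence "(\<lambda>n. ennreal (C / r\<^sup>2 * (1 / real (Suc n)))) \<longlonglongrightarrow> 0" by simp
    thus ?thesis by (rule ennreal_tendsto_0_bound[OF le])
  qed
  have "(\<lambda>n. \<integral>\<^sup>+x. indicator U x * \<phi> n x \<partial>lborel) \<longlonglongrightarrow> (\<integral>\<^sup>+x. 0 \<partial>(lborel :: 'a measure))"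
  proof (rule nn_integral_dominated_convergence[where w="indicator U"])
    show "AE x in lborel. (\<lambda>n. indicator U x * \<phi> n x) \<longlonglongrightarrow> 0"
      using \<phi>0 by (intro AE_I2) (auto simp: indicator_def)
    show "AE x in lborel. indicator U x * \<phi> n x \<le> indicator U x" for n
      using \<phi>1 by (intro AE_I2) (auto simp: indicator_def)
  qed (use fin in auto)
  hence "(\<lambda>n. 2 * (\<integral>\<^sup>+x. indicator U x * \<phi> n x \<partial>lborel)) \<longlonglongrightarrow> 2 * 0"
    by (intro ennreal_tendsto_cmult) auto
  \<comment> \<open>The integrand is the kernel exactly when one of x and y lies in U and the other
    does not. The two cases contribute equally, by symmetry of the kernel.\<close>
  moreover have "heat_energy (1 / real (Suc n)) (\<lambda>x. complex_of_real (indicator U x)) = 2 * (\<integral>\<^sup>+x. indicator U x * \<phi> n x \<partial>lborel)" for n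
  proof -
    let ?k = "\<lambda>x y::'a. ennreal (heat_kernel (1 / real (Suc n)) (x - y))"
    have "heat_energy (1 / real (Suc n)) (\<lambda>x. complex_of_real (indicator U x)) =
        (\<integral>\<^sup>+x. \<integral>\<^sup>+y. indicator U x * (?k x y * indicator (- U) y) + indicator U y * (?k x y * indicator (- U) x) \<partial>lborel \<partial>lborel)"
      unfolding heat_energy_def by (intro nn_integral_cong) (auto simp: indicator_def)
    also have "\<dots> = (\<integral>\<^sup>+x. \<integral>\<^sup>+y. indicator U x * (?k x y * indicator (- U) y) \<partial>lborel \<partial>lborel) +
       (\<integral>\<^sup>+x. \<integral>\<^sup>+y. indicator U y * (?k x y * indicator (- U) x) \<partial>lborel \<partial>lborel)"
      by (simp add: nn_integral_add)
    also have "(\<integral>\<^sup>+x. \<integral>\<^sup>+y. indicator U y * (?k x y * indicator (- U) x) \<partial>lborel \<partial>lborel) =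
      (\<integral>\<^sup>+y. \<integral>\<^sup>+x. indicator U y * (?k x y * indicator (- U) x) \<partial>lborel \<partial>lborel)"
      by (rule lborel_pair.Fubini'[symmetric]) measurable
    also have "\<dots> = (\<integral>\<^sup>+y. \<integral>\<^sup>+x. indicator U y * (?k y x * indicator (- U) x) \<partial>lborel \<partial>lborel)"
      by (simp add: heat_kernel_minus_commute)
    also have "(\<integral>\<^sup>+x. \<integral>\<^sup>+y. indicator U x * (?k x y * indicator (- U) y) \<partial>lborel \<partial>lborel) = (\<integral>\<^sup>+x. indicator U x * \<phi> n x \<partial>lborel)"
      unfolding \<phi>_def by (simp add: nn_integral_cmult)
    finally show ?thesis by (simp add: mult_2)
  qed
  ultimately show ?thesis unfolding heat_vanishing_def by simp
qed

text \<open>By outer regularity A lies in an open U with U - A of small measure, and that measure is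
  the squared distance of the two indicators in square mean.\<close>

lemma heat_vanishing_indicator:
  fixes A :: "'a::euclidean_space set"
  assumes A[measurable]: "A \<in> sets borel" and fin: "emeasure lborel A < \<infinity>"
  shows "heat_vanishing (\<lambda>x. complex_of_real (indicator A x))"
proof (rule heat_vanishing_approx)
  fix e :: real assume e: "0 < e"
  obtain U where U: "open U" "A \<subseteq> U" "emeasure lborel (U - A) < ennreal e"
    using outer_regular_lborel[of A e] A e by auto
  have [measurable]: "U \<in> sets borel" using U by simp
  have "emeasure lborel U \<le> emeasure lborel A + emeasure lborel (U - A)"
    using emeasure_subadditive[of A lborel "U - A"] U(2) by (simp add: Un_absorb1)
  also have "\<dots> < \<infinity>" using fin U(3) by (auto simp: less_top[symmetric] top_unique)
  finally have "heat_vanishing (\<lambda>x. complex_of_real (indicator U x))"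
    by (rule heat_vanishing_indicator_open[OF U(1)])
  moreover have "(\<integral>\<^sup>+x. ennreal ((cmod (complex_of_real (indicator A x) - complex_of_real (indicator U x)))\<^sup>2) \<partial>lborel)
      = (\<integral>\<^sup>+x. indicator (U - A) x \<partial>lborel)"
    using U(2) by (intro nn_integral_cong) (auto simp: indicator_def)
  ultimately show "\<exists>g\<in>borel_measurable borel. heat_vanishing g \<and>
       (\<integral>\<^sup>+x. ennreal ((cmod (complex_of_real (indicator A x) - g x))\<^sup>2) \<partial>lborel) \<le> ennreal e"
    using U(3) by (intro bexI[of _ "\<lambda>x. complex_of_real (indicator U x)"]) auto
qed measurable

text \<open>Each induction step is one of the closure properties. In the limit step (u - U i)^2 is
  dominated by u^2, so pointwise convergence upgrades to convergence in square mean.\<close>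

lemma heat_vanishing_nonneg:
  fixes u :: "'a::euclidean_space \<Rightarrow> real"
  assumes um: "u \<in> borel_measurable borel" and "\<And>x. 0 \<le> u x"
    and "(\<integral>\<^sup>+x. ennreal ((u x)\<^sup>2) \<partial>lborel) < \<infinity>"
  shows "heat_vanishing (\<lambda>x. complex_of_real (u x))"
  using assms
proof (induction u rule: borel_measurable_induct_real)
  case (set A)
  have "(\<integral>\<^sup>+x. ennreal ((indicator A x)\<^sup>2) \<partial>(lborel::'a measure)) = (\<integral>\<^sup>+x. indicator A x \<partial>lborel)"
    by (intro nn_integral_cong) (auto simp: indicator_def)
  thus ?case using set by (intro heat_vanishing_indicator) auto
next
  case (mult u c)
  note [measurable] = mult(2)
  show ?case
  \<comment> \<open>For c = 0 the square integrability of c u says nothing about u, so the induction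
    hypothesis cannot be invoked; the heat energy of 0 is 0 anyway.\<close>
  proof (cases "c = 0")
    case True
    thus ?thesis by (simp add: heat_vanishing_def heat_energy_def)
  next
    case False
    have "(\<integral>\<^sup>+x. ennreal ((c * u x)\<^sup>2) \<partial>lborel) = ennreal (c\<^sup>2) * (\<integral>\<^sup>+x. ennreal ((u x)\<^sup>2) \<partial>lborel)"
      by (simp add: power_mult_distrib ennreal_mult nn_integral_cmult)
    hence "(\<integral>\<^sup>+x. ennreal ((u x)\<^sup>2) \<partial>lborel) < \<infinity>"
      using mult.prems False by (auto simp: ennreal_mult_less_top)
    hence "heat_vanishing (\<lambda>x. complex_of_real (u x))" by (rule mult.IH)
    thus ?thesis using heat_vanishing_cmult[of "\<lambda>x. complex_of_real (u x)" "complex_of_real c"] by simp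
  qed
next
  case (add u v)
  note [measurable] = add.hyps(1,3)
  have "(\<integral>\<^sup>+x. ennreal ((u x)\<^sup>2) \<partial>lborel) \<le> (\<integral>\<^sup>+x. ennreal ((v x + u x)\<^sup>2) \<partial>lborel)"
    using add by (intro nn_integral_mono ennreal_leI power_mono) auto
  moreover have "(\<integral>\<^sup>+x. ennreal ((v x)\<^sup>2) \<partial>lborel) \<le> (\<integral>\<^sup>+x. ennreal ((v x + u x)\<^sup>2) \<partial>lborel)"
    using add by (intro nn_integral_mono ennreal_leI power_mono) auto
  ultimately have "heat_vanishing (\<lambda>x. complex_of_real (u x))" "heat_vanishing (\<lambda>x. complex_of_real (v x))"
    using add by auto
  moreover have "(\<lambda>x. complex_of_real (v x)) \<in> borel_measurable borel" "(\<lambda>x. complex_of_real (u x)) \<in> borel_measurable borel"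
    by measurable
  ultimately show ?case using heat_vanishing_add[of "\<lambda>x. complex_of_real (v x)" "\<lambda>x. complex_of_real (u x)"] by simp
next
  case (seq U)
  note [measurable] = seq(1) um
  have le: "U i x \<le> u x" for i x
    using seq.hyps(3,4) by (intro incseq_le[of "\<lambda>i. U i x"]) (auto simp: mono_def le_fun_def)
  have fin: "(\<integral>\<^sup>+x. ennreal ((u x)\<^sup>2) \<partial>lborel) < \<infinity>" by (rule seq.prems)
  have U: "heat_vanishing (\<lambda>x. complex_of_real (U i x))" for i
  proof (rule seq.IH)
    have "(\<integral>\<^sup>+x. ennreal ((U i x)\<^sup>2) \<partial>lborel) \<le> (\<integral>\<^sup>+x. ennreal ((u x)\<^sup>2) \<partial>lborel)"
      using le seq(2) by (intro nn_integral_mono ennreal_leI power_mono) auto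
    thus "(\<integral>\<^sup>+x. ennreal ((U i x)\<^sup>2) \<partial>lborel) < \<infinity>" using fin by simp
  qed
  have lim: "(\<lambda>i. \<integral>\<^sup>+x. ennreal ((u x - U i x)\<^sup>2) \<partial>lborel) \<longlonglongrightarrow> (\<integral>\<^sup>+x. 0 \<partial>(lborel::'a measure))"
  proof (rule nn_integral_dominated_convergence[where w="\<lambda>x. ennreal ((u x)\<^sup>2)"])
    show "AE x in lborel. ennreal ((u x - U i x)\<^sup>2) \<le> ennreal ((u x)\<^sup>2)" for i
      using le seq(2) by (intro AE_I2 ennreal_leI power_mono) auto
    show "AE x in lborel. (\<lambda>i. ennreal ((u x - U i x)\<^sup>2)) \<longlonglongrightarrow> 0"
    proof (intro AE_I2)
      fix x :: 'a
      have "(\<lambda>i. (u x - U i x)\<^sup>2) \<longlonglongrightarrow> (u x - u x)\<^sup>2"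
        using seq.hyps(4)[of x] by (intro tendsto_intros) auto
      from tendsto_ennrealI[OF this] show "(\<lambda>i. ennreal ((u x - U i x)\<^sup>2)) \<longlonglongrightarrow> 0" by simp
    qed
  qed (use fin in measurable)
  show ?case
  proof (rule heat_vanishing_approx)
    fix e :: real assume e: "0 < e"
    have "\<forall>\<^sub>F i in sequentially. (\<integral>\<^sup>+x. ennreal ((u x - U i x)\<^sup>2) \<partial>lborel) < ennreal e"
      using lim e by (intro order_tendstoD) auto
    then obtain i where i: "(\<integral>\<^sup>+x. ennreal ((u x - U i x)\<^sup>2) \<partial>lborel) < ennreal e"
      by (auto simp: eventually_sequentially)
    show "\<exists>g\<in>borel_measurable borel. heat_vanishing g \<and>
       (\<integral>\<^sup>+x. ennreal ((cmod (complex_of_real (u x) - g x))\<^sup>2) \<partial>lborel) \<le> ennreal e"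
      using U i by (intro bexI[of _ "\<lambda>x. complex_of_real (U i x)"]) (auto simp flip: of_real_diff)
  qed measurable
qed

text \<open>The positive and negative parts of the real and imaginary parts are nonnegative and
  dominated by |f|, and f is a linear combination of them.\<close>

lemma heat_energy_tendsto_0:
  fixes f :: "'a::euclidean_space \<Rightarrow> complex"
  assumes [measurable]: "f \<in> borel_measurable borel"
    and fin: "(\<integral>\<^sup>+x. ennreal ((cmod (f x))\<^sup>2) \<partial>lborel) < \<infinity>"
  shows "(\<lambda>n. heat_energy (1 / real (Suc n)) f) \<longlonglongrightarrow> 0"
proof -
  have *: "heat_vanishing (\<lambda>x. complex_of_real (u x))"
    if [measurable]: "u \<in> borel_measurable borel" and u: "\<And>x. 0 \<le> u x" "\<And>x. u x \<le> cmod (f x)" for u :: "'a \<Rightarrow> real"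
  proof (rule heat_vanishing_nonneg)
    have "(\<integral>\<^sup>+x. ennreal ((u x)\<^sup>2) \<partial>lborel) \<le> (\<integral>\<^sup>+x. ennreal ((cmod (f x))\<^sup>2) \<partial>lborel)"
      using u by (intro nn_integral_mono ennreal_leI power_mono) auto
    thus "(\<integral>\<^sup>+x. ennreal ((u x)\<^sup>2) \<partial>lborel) < \<infinity>" using fin by simp
  qed (use u in auto)
  define r1 r2 i1 i2 where "r1 x = complex_of_real (max 0 (Re (f x)))" and "r2 x = complex_of_real (max 0 (- Re (f x)))"
    and "i1 x = complex_of_real (max 0 (Im (f x)))" and "i2 x = complex_of_real (max 0 (- Im (f x)))" for x
  have [measurable]: "r1 \<in> borel_measurable borel" "r2 \<in> borel_measurable borel" "i1 \<in> borel_measurable borel" "i2 \<in> borel_measurable borel"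
    unfolding r1_def[abs_def] r2_def[abs_def] i1_def[abs_def] i2_def[abs_def] by measurable
  have b: "- Re z \<le> cmod z" "- Im z \<le> cmod z" "Im z \<le> cmod z" for z
    using abs_Re_le_cmod[of z] abs_Im_le_cmod[of z] by (auto simp: abs_le_iff)
  have "heat_vanishing r1"
    unfolding r1_def[abs_def] by (rule *) (measurable, auto simp: complex_Re_le_cmod b)
  moreover have "heat_vanishing r2"
    unfolding r2_def[abs_def] by (rule *) (measurable, auto simp: complex_Re_le_cmod b)
  moreover have "heat_vanishing i1"
    unfolding i1_def[abs_def] by (rule *) (measurable, auto simp: complex_Re_le_cmod b)
  moreover have "heat_vanishing i2"
    unfolding i2_def[abs_def] by (rule *) (measurable, auto simp: complex_Re_le_cmod b)
  ultimately have "heat_vanishing (\<lambda>x. (r1 x + (- 1) * r2 x) + (\<i> * i1 x + (- \<i>) * i2 x))"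
    by (intro heat_vanishing_add heat_vanishing_cmult) measurable
  also have "(\<lambda>x. (r1 x + (- 1) * r2 x) + (\<i> * i1 x + (- \<i>) * i2 x)) = f"
    by (auto simp: fun_eq_iff complex_eq_iff r1_def r2_def i1_def i2_def)
  finally show ?thesis unfolding heat_vanishing_def .
qed

text \<open>In the weighted identity at t = 1 / (n + 1) the Gaussian weights increase to 1, so
  monotone convergence applies although square integrability of the transform is not known
  beforehand.\<close>

lemma plancherel_L1_L2:
  fixes f :: "'a::euclidean_space \<Rightarrow> complex"
  assumes f: "integrable lborel f" and f2: "integrable lborel (\<lambda>x. (cmod (f x))\<^sup>2)"
  shows "(\<integral>\<^sup>+\<xi>. ennreal ((cmod (fourier_integral f \<xi>))\<^sup>2) \<partial>lborel) = (\<integral>\<^sup>+x. ennreal ((cmod (f x))\<^sup>2) \<partial>lborel)"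
proof -
  have fm[measurable]: "f \<in> borel_measurable borel" using f by auto
  have [measurable]: "fourier_integral f \<in> borel_measurable borel" by (rule fourier_integral_measurable[OF fm])
  let ?t = "\<lambda>n. 1 / real (Suc n)"
  let ?g = "\<lambda>n \<xi>. ennreal (exp (- pi * ?t n * (norm \<xi>)\<^sup>2) * (cmod (fourier_integral f \<xi>))\<^sup>2)"
  have fin: "(\<integral>\<^sup>+x. ennreal ((cmod (f x))\<^sup>2) \<partial>lborel) < \<infinity>"
    using f2 by (simp add: integrable_iff_bounded)
  have l1: "(\<lambda>n. \<integral>\<^sup>+\<xi>. ?g n \<xi> \<partial>lborel) \<longlonglongrightarrow> (\<integral>\<^sup>+\<xi>. ennreal ((cmod (fourier_integral f \<xi>))\<^sup>2) \<partial>lborel)"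
  proof (rule nn_integral_LIMSEQ)
    show "incseq ?g"
    proof (intro incseq_SucI le_funI ennreal_leI mult_right_mono)
      fix n and \<xi> :: 'a
      have "?t (Suc n) * (norm \<xi>)\<^sup>2 \<le> ?t n * (norm \<xi>)\<^sup>2"
        by (intro mult_right_mono) (auto simp: field_simps)
      thus "exp (- pi * ?t n * (norm \<xi>)\<^sup>2) \<le> exp (- pi * ?t (Suc n) * (norm \<xi>)\<^sup>2)"
        using mult_left_mono[of "?t (Suc n) * (norm \<xi>)\<^sup>2" "?t n * (norm \<xi>)\<^sup>2" pi] by (simp add: mult.assoc)
    qed auto
    fix \<xi> :: 'a
    have "(\<lambda>n. exp (- pi * ?t n * (norm \<xi>)\<^sup>2) * (cmod (fourier_integral f \<xi>))\<^sup>2) \<longlonglongrightarrow>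
        exp (- pi * 0 * (norm \<xi>)\<^sup>2) * (cmod (fourier_integral f \<xi>))\<^sup>2"
      by (intro tendsto_intros LIMSEQ_Suc lim_1_over_n)
    thus "(\<lambda>n. ?g n \<xi>) \<longlonglongrightarrow> ennreal ((cmod (fourier_integral f \<xi>))\<^sup>2)"
      by (intro tendsto_ennrealI) simp
  qed measurable
  have "(\<lambda>n. 2 * (\<integral>\<^sup>+\<xi>. ?g n \<xi> \<partial>lborel) + heat_energy (?t n) f) \<longlonglongrightarrow>
     2 * (\<integral>\<^sup>+\<xi>. ennreal ((cmod (fourier_integral f \<xi>))\<^sup>2) \<partial>lborel) + 0"
    by (intro tendsto_add ennreal_tendsto_cmult l1 heat_energy_tendsto_0 fm fin) auto
  moreover have "2 * (\<integral>\<^sup>+\<xi>. ?g n \<xi> \<partial>lborel) + heat_energy (?t n) f = 2 * (\<integral>\<^sup>+x. ennreal ((cmod (f x))\<^sup>2) \<partial>lborel)" for n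
    by (rule heat_weighted_plancherel[OF f f2]) simp
  ultimately have "2 * (\<integral>\<^sup>+\<xi>. ennreal ((cmod (fourier_integral f \<xi>))\<^sup>2) \<partial>lborel) = 2 * (\<integral>\<^sup>+x. ennreal ((cmod (f x))\<^sup>2) \<partial>lborel)"
    by (simp add: LIMSEQ_const_iff)
  thus ?thesis by (simp add: ennreal_mult_cancel_left)
qed

text \<open>The difference of Plancherel's identity and the weighted identity. Cancelling 2 A in
  \<open>ennreal\<close> is legitimate because A is at most the finite norm N.\<close>

lemma heat_energy_fourier_integral:
  fixes f :: "'a::euclidean_space \<Rightarrow> complex"
  assumes f: "integrable lborel f" and f2: "integrable lborel (\<lambda>x. (cmod (f x))\<^sup>2)" and t: "0 < t"
  shows "heat_energy t f =
    2 * (\<integral>\<^sup>+\<xi>. ennreal ((1 - exp (- pi * t * (norm \<xi>)\<^sup>2)) * (cmod (fourier_integral f \<xi>))\<^sup>2) \<partial>lborel)"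
proof -
  have fm[measurable]: "f \<in> borel_measurable borel" using f by auto
  have [measurable]: "fourier_integral f \<in> borel_measurable borel" by (rule fourier_integral_measurable[OF fm])
  define A where "A = (\<integral>\<^sup>+\<xi>. ennreal (exp (- pi * t * (norm \<xi>)\<^sup>2) * (cmod (fourier_integral f \<xi>))\<^sup>2) \<partial>lborel)"
  define B where "B = (\<integral>\<^sup>+\<xi>. ennreal ((1 - exp (- pi * t * (norm \<xi>)\<^sup>2)) * (cmod (fourier_integral f \<xi>))\<^sup>2) \<partial>lborel)"
  define N where "N = (\<integral>\<^sup>+x. ennreal ((cmod (f x))\<^sup>2) \<partial>lborel)"
  have N: "N < \<infinity>"
    using f2 by (simp add: N_def integrable_iff_bounded)
  have "N = (\<integral>\<^sup>+\<xi>. ennreal ((cmod (fourier_integral f \<xi>))\<^sup>2) \<partial>lborel)"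
    unfolding N_def by (rule plancherel_L1_L2[OF f f2, symmetric])
  also have "\<dots> = (\<integral>\<^sup>+\<xi>. ennreal (exp (- pi * t * (norm \<xi>)\<^sup>2) * (cmod (fourier_integral f \<xi>))\<^sup>2)
     + ennreal ((1 - exp (- pi * t * (norm \<xi>)\<^sup>2)) * (cmod (fourier_integral f \<xi>))\<^sup>2) \<partial>lborel)"
  proof (intro nn_integral_cong)
    fix \<xi> :: 'a
    have e: "0 \<le> 1 - exp (- pi * t * (norm \<xi>)\<^sup>2)" using t by simp
    show "ennreal ((cmod (fourier_integral f \<xi>))\<^sup>2) = ennreal (exp (- pi * t * (norm \<xi>)\<^sup>2) * (cmod (fourier_integral f \<xi>))\<^sup>2)
     + ennreal ((1 - exp (- pi * t * (norm \<xi>)\<^sup>2)) * (cmod (fourier_integral f \<xi>))\<^sup>2)"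
      using mult_nonneg_nonneg[OF e zero_le_power2[of "cmod (fourier_integral f \<xi>)"]]
      by (subst ennreal_plus[symmetric]) (auto simp: algebra_simps)
  qed
  also have "\<dots> = A + B" unfolding A_def B_def by (rule nn_integral_add) measurable
  finally have AB: "N = A + B" .
  have "2 * A + heat_energy t f = 2 * N"
    unfolding A_def N_def by (rule heat_weighted_plancherel[OF f f2 t])
  hence "2 * A + heat_energy t f = 2 * A + 2 * B" by (simp add: AB distrib_left)
  moreover have "2 * A \<noteq> \<infinity>" using N AB by (auto simp: ennreal_mult_eq_top_iff)
  ultimately show ?thesis unfolding B_def by (simp add: ennreal_add_left_cancel)
qed

subsection \<open>The Fourier transform on square integrable functions\<close>

text \<open>The Riesz-Fischer argument: a fast subsequence converges almost everywhere, and Fatou's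
  lemma shows that its limit is the limit in square mean of the whole sequence.\<close>

lemma L2_complete:
  fixes h :: "nat \<Rightarrow> 'a::euclidean_space \<Rightarrow> complex"
  assumes hm[measurable]: "\<And>n. h n \<in> borel_measurable borel"
    and cau: "\<And>e::real. 0 < e \<Longrightarrow> \<exists>N. \<forall>m\<ge>N. \<forall>n\<ge>N. (\<integral>\<^sup>+x. ennreal ((cmod (h m x - h n x))\<^sup>2) \<partial>lborel) \<le> ennreal e"
  obtains g where "g \<in> borel_measurable borel"
    "(\<lambda>n. \<integral>\<^sup>+x. ennreal ((cmod (h n x - g x))\<^sup>2) \<partial>lborel) \<longlonglongrightarrow> 0"
proof -
  define I where "I m n = (\<integral>\<^sup>+x. ennreal ((cmod (h m x - h n x))\<^sup>2) \<partial>lborel)" for m n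
  have "\<forall>k. \<exists>N. \<forall>m\<ge>N. \<forall>n\<ge>N. I m n \<le> ennreal ((1 / 8) ^ k)"
    using cau unfolding I_def by simp
  then obtain N where N: "\<And>k m n. N k \<le> m \<Longrightarrow> N k \<le> n \<Longrightarrow> I m n \<le> ennreal ((1 / 8) ^ k)"
    by metis
  \<comment> \<open>Summing the thresholds makes r increasing and at least \<open>N k\<close>; the
    summand k makes it tend to infinity.\<close>
  define r where "r k = k + sum N {..k}" for k
  have rN: "N k \<le> r k" for k
    unfolding r_def by (rule trans_le_add2) (auto intro!: member_le_sum)
  have rS: "r k \<le> r (Suc k)" for k unfolding r_def by simp
  have rk: "k \<le> r k" for k unfolding r_def by simp
  define d where "d k x = h (r (Suc k)) x - h (r k) x" for k x
  have [measurable]: "d k \<in> borel_measurable borel" for k unfolding d_def by measurable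
  \<comment> \<open>The weights 4^k against the decay 8^(- k) leave a convergent series, while
    boundedness of 4^k |d k x|^2 forces |d k x| \<le> 2^(- k). Thus absolute summability almost
    everywhere follows without a triangle inequality for norms.\<close>
  have "(\<integral>\<^sup>+x. (\<Sum>k. ennreal (4 ^ k * (cmod (d k x))\<^sup>2)) \<partial>lborel) = (\<Sum>k. \<integral>\<^sup>+x. ennreal (4 ^ k * (cmod (d k x))\<^sup>2) \<partial>lborel)"
    by (rule nn_integral_suminf) measurable
  also have "\<dots> \<le> (\<Sum>k. ennreal ((1 / 2) ^ k))"
  proof (intro suminf_le)
    fix k
    have "(\<integral>\<^sup>+x. ennreal (4 ^ k * (cmod (d k x))\<^sup>2) \<partial>lborel) = ennreal (4 ^ k) * I (r (Suc k)) (r k)"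
      unfolding I_def d_def by (simp add: ennreal_mult nn_integral_cmult)
    also have "\<dots> \<le> ennreal (4 ^ k) * ennreal ((1 / 8) ^ k)"
      using N[of k "r (Suc k)" "r k"] rN[of k] rS[of k] by (intro mult_left_mono) auto
    also have "\<dots> = ennreal ((1 / 2) ^ k)"
      by (simp add: ennreal_mult[symmetric] power_mult_distrib[symmetric])
    finally show "(\<integral>\<^sup>+x. ennreal (4 ^ k * (cmod (d k x))\<^sup>2) \<partial>lborel) \<le> ennreal ((1 / 2) ^ k)" .
  qed auto
  also have "\<dots> = ennreal (\<Sum>k. (1 / 2) ^ k)"
    by (rule suminf_ennreal2) (auto intro: summable_geometric)
  finally have "(\<integral>\<^sup>+x. (\<Sum>k. ennreal (4 ^ k * (cmod (d k x))\<^sup>2)) \<partial>lborel) \<noteq> \<infinity>"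
    by (auto simp: top_unique)
  hence "AE x in lborel. (\<Sum>k. ennreal (4 ^ k * (cmod (d k x))\<^sup>2)) \<noteq> \<infinity>"
    by (intro nn_integral_PInf_AE) measurable
  hence conv: "AE x in lborel. convergent (\<lambda>k. h (r k) x)"
  proof eventually_elim
    case (elim x)
    hence "summable (\<lambda>k. 4 ^ k * (cmod (d k x))\<^sup>2)"
      by (intro summable_suminf_not_top) auto
    hence "(\<lambda>k. 4 ^ k * (cmod (d k x))\<^sup>2) \<longlonglongrightarrow> 0" by (rule summable_LIMSEQ_zero)
    hence "\<forall>\<^sub>F k in sequentially. 4 ^ k * (cmod (d k x))\<^sup>2 < 1" by (rule order_tendstoD) simp
    hence "\<forall>\<^sub>F k in sequentially. norm (d k x) \<le> (1 / 2) ^ k"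
    proof eventually_elim
      case (elim k)
      have "(2 ^ k * cmod (d k x))\<^sup>2 \<le> 1\<^sup>2"
        using elim by (simp add: power_mult_distrib power_mult[symmetric] mult.commute[of k] power_mult)
      hence "2 ^ k * cmod (d k x) \<le> 1" by (rule power2_le_imp_le) simp
      thus ?case by (simp add: field_simps)
    qed
    hence "summable (\<lambda>k. d k x)"
      by (rule summable_comparison_test_ev) (auto intro: summable_geometric)
    hence "convergent (\<lambda>n. \<Sum>k<n. d k x)" by (simp add: summable_iff_convergent)
    hence "convergent (\<lambda>n. (h (r n) x - h (r 0) x) + h (r 0) x)"
      unfolding d_def sum_lessThan_telescope[of "\<lambda>k. h (r k) x"]
      by (intro convergent_add convergent_const)
    thus ?case by simp
  qed
  define g where "g x = lim (\<lambda>k. h (r k) x)" for x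
  have gm[measurable]: "g \<in> borel_measurable borel"
    unfolding g_def by (rule borel_measurable_lim_metric) measurable
  have "(\<lambda>n. \<integral>\<^sup>+x. ennreal ((cmod (h n x - g x))\<^sup>2) \<partial>lborel) \<longlonglongrightarrow> 0"
  proof (rule ennreal_tendsto_0_I)
    fix e :: real assume "0 < e"
    then obtain M where M: "\<And>m n. M \<le> m \<Longrightarrow> M \<le> n \<Longrightarrow> I m n \<le> ennreal e"
      using cau unfolding I_def by metis
    have "(\<integral>\<^sup>+x. ennreal ((cmod (h n x - g x))\<^sup>2) \<partial>lborel) \<le> ennreal e" if n: "M \<le> n" for n
    proof -
      \<comment> \<open>Almost everywhere the integrand is a limit along the subsequence, so Fatou's
        lemma carries the Cauchy bound over to g.\<close>
      have "(\<integral>\<^sup>+x. ennreal ((cmod (h n x - g x))\<^sup>2) \<partial>lborel) =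
          (\<integral>\<^sup>+x. liminf (\<lambda>k. ennreal ((cmod (h n x - h (r k) x))\<^sup>2)) \<partial>lborel)"
      proof (rule nn_integral_cong_AE, use conv in eventually_elim)
        fix x assume "convergent (\<lambda>k. h (r k) x)"
        hence "(\<lambda>k. h (r k) x) \<longlonglongrightarrow> g x" unfolding g_def by (simp add: convergent_LIMSEQ_iff)
        hence "(\<lambda>k. ennreal ((cmod (h n x - h (r k) x))\<^sup>2)) \<longlonglongrightarrow> ennreal ((cmod (h n x - g x))\<^sup>2)"
          by (intro tendsto_intros)
        thus "ennreal ((cmod (h n x - g x))\<^sup>2) = liminf (\<lambda>k. ennreal ((cmod (h n x - h (r k) x))\<^sup>2))"
          by (intro lim_imp_Liminf[symmetric]) auto
      qed
      also have "\<dots> \<le> liminf (\<lambda>k. I n (r k))"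
        unfolding I_def by (rule nn_integral_liminf) measurable
      also have "\<dots> \<le> ennreal e"
      proof (rule Liminf_le)
        show "\<forall>\<^sub>F k in sequentially. I n (r k) \<le> ennreal e"
          using eventually_ge_at_top[of M]
        proof eventually_elim
          case (elim k)
          show ?case by (rule M[OF n]) (use elim rk[of k] in linarith)
        qed
      qed simp
      finally show ?thesis .
    qed
    thus "\<forall>\<^sub>F n in sequentially. (\<integral>\<^sup>+x. ennreal ((cmod (h n x - g x))\<^sup>2) \<partial>lborel) \<le> ennreal e"
      by (auto simp: eventually_sequentially)
  qed
  thus ?thesis using that gm by blast
qed

text \<open>Estimates with the factors \<open>1 + d\<close> and \<open>1 + 1 / d\<close> take the place of Minkowski's inequality, so that
  one argument serves both the norm and the heat energy, without roots or differences in
  \<^typ>\<open>ennreal\<close>.\<close>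

lemma ennreal_le_by_approx:
  fixes X Y :: ennreal
  assumes X: "\<And>n (d::real). 0 < d \<Longrightarrow> X \<le> ennreal (1 + d) * A n + ennreal (1 + 1 / d) * e n"
    and A: "\<And>n (d::real). 0 < d \<Longrightarrow> A n \<le> ennreal (1 + d) * Y + ennreal (1 + 1 / d) * e' n"
    and e: "e \<longlonglongrightarrow> 0" "e' \<longlonglongrightarrow> 0"
  shows "X \<le> Y"
proof (cases "Y = \<infinity>")
  case False
  \<comment> \<open>The order of the limits matters: n goes to infinity with d fixed, since the
    factor 1 + 1 / d of the errors blows up as d tends to 0. The two comparisons leave the factor (1
    + d)^2, and only then is d = 1 / (k + 1) sent to 0.\<close>
  have le: "X \<le> ennreal (1 + d) * (ennreal (1 + d) * Y)" if d: "0 < d" for d :: real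
  proof (rule LIMSEQ_le_const)
    have "(\<lambda>n. ennreal (1 + d) * (ennreal (1 + d) * Y + ennreal (1 + 1 / d) * e' n) + ennreal (1 + 1 / d) * e n)
        \<longlonglongrightarrow> ennreal (1 + d) * (ennreal (1 + d) * Y + ennreal (1 + 1 / d) * 0) + ennreal (1 + 1 / d) * 0"
      by (intro tendsto_add ennreal_tendsto_cmult tendsto_const e) simp_all
    thus "(\<lambda>n. ennreal (1 + d) * (ennreal (1 + d) * Y + ennreal (1 + 1 / d) * e' n) + ennreal (1 + 1 / d) * e n)
        \<longlonglongrightarrow> ennreal (1 + d) * (ennreal (1 + d) * Y)" by simp
    show "\<exists>N. \<forall>n\<ge>N. X \<le> ennreal (1 + d) * (ennreal (1 + d) * Y + ennreal (1 + 1 / d) * e' n) + ennreal (1 + 1 / d) * e n"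
    proof (intro exI allI impI)
      fix n
      show "X \<le> ennreal (1 + d) * (ennreal (1 + d) * Y + ennreal (1 + 1 / d) * e' n) + ennreal (1 + 1 / d) * e n"
        using X[OF d, of n] A[OF d, of n] by (meson add_right_mono mult_left_mono order_trans zero_le)
    qed
  qed
  show ?thesis
  proof (rule LIMSEQ_le_const)
    have "(\<lambda>k. Y * ennreal ((1 + 1 / real (Suc k)) * (1 + 1 / real (Suc k)))) \<longlonglongrightarrow> Y * ennreal ((1 + 0) * (1 + 0))"
      using False by (intro ennreal_tendsto_cmult tendsto_ennrealI tendsto_intros LIMSEQ_Suc lim_1_over_n) (simp add: less_top)
    thus "(\<lambda>k. Y * ennreal ((1 + 1 / real (Suc k)) * (1 + 1 / real (Suc k)))) \<longlonglongrightarrow> Y" by simp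
    show "\<exists>N. \<forall>n\<ge>N. X \<le> Y * ennreal ((1 + 1 / real (Suc n)) * (1 + 1 / real (Suc n)))"
    proof (intro exI allI impI)
      fix n
      show "X \<le> Y * ennreal ((1 + 1 / real (Suc n)) * (1 + 1 / real (Suc n)))"
        using le[of "1 / real (Suc n)"] by (subst ennreal_mult) (auto simp: mult_ac)
    qed
  qed
qed auto

lemma nn_integral_sq_perturb:
  fixes a b :: "'a \<Rightarrow> complex" and m :: "'a \<Rightarrow> real"
  assumes [measurable]: "a \<in> borel_measurable M" "b \<in> borel_measurable M" "m \<in> borel_measurable M"
    and m: "\<And>x. 0 \<le> m x" "\<And>x. m x \<le> 1" and d: "0 < (d::real)"
  shows "(\<integral>\<^sup>+x. ennreal (m x * (cmod (a x))\<^sup>2) \<partial>M) \<le>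
    ennreal (1 + d) * (\<integral>\<^sup>+x. ennreal (m x * (cmod (b x))\<^sup>2) \<partial>M) + ennreal (1 + 1 / d) * (\<integral>\<^sup>+x. ennreal ((cmod (a x - b x))\<^sup>2) \<partial>M)"
proof -
  have "(\<integral>\<^sup>+x. ennreal (m x * (cmod (a x))\<^sup>2) \<partial>M) \<le>
    (\<integral>\<^sup>+x. ennreal (1 + d) * ennreal (m x * (cmod (b x))\<^sup>2) + ennreal (1 + 1 / d) * ennreal ((cmod (a x - b x))\<^sup>2) \<partial>M)"
  proof (intro nn_integral_mono)
    fix x
    have "m x * (cmod (a x))\<^sup>2 \<le> m x * ((1 + d) * (cmod (b x))\<^sup>2 + (1 + 1 / d) * (cmod (a x - b x))\<^sup>2)"
      using cmod_add_sq_le_weighted[OF d, of "b x" "a x - b x"] m by (intro mult_left_mono) auto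
    also have "\<dots> = (1 + d) * (m x * (cmod (b x))\<^sup>2) + m x * ((1 + 1 / d) * (cmod (a x - b x))\<^sup>2)"
      by (simp only: distrib_left mult.left_commute)
    also have "\<dots> \<le> (1 + d) * (m x * (cmod (b x))\<^sup>2) + 1 * ((1 + 1 / d) * (cmod (a x - b x))\<^sup>2)"
      using d m by (intro add_left_mono mult_right_mono) auto
    finally have "ennreal (m x * (cmod (a x))\<^sup>2) \<le> ennreal ((1 + d) * (m x * (cmod (b x))\<^sup>2) + (1 + 1 / d) * (cmod (a x - b x))\<^sup>2)"
      by (intro ennreal_leI) simp
    also have "\<dots> = ennreal (1 + d) * ennreal (m x * (cmod (b x))\<^sup>2) + ennreal (1 + 1 / d) * ennreal ((cmod (a x - b x))\<^sup>2)"
      using d m by (subst ennreal_plus) (simp_all add: ennreal_mult')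
    finally show "ennreal (m x * (cmod (a x))\<^sup>2) \<le> \<dots>" .
  qed
  also have "\<dots> = ennreal (1 + d) * (\<integral>\<^sup>+x. ennreal (m x * (cmod (b x))\<^sup>2) \<partial>M) + ennreal (1 + 1 / d) * (\<integral>\<^sup>+x. ennreal ((cmod (a x - b x))\<^sup>2) \<partial>M)"
    by (simp add: nn_integral_add nn_integral_cmult)
  finally show ?thesis .
qed

section \<open>Fourier integrals of truncations and their limit\<close>

definition truncation :: "('a::euclidean_space \<Rightarrow> complex) \<Rightarrow> real \<Rightarrow> 'a \<Rightarrow> complex" where
  "truncation f R = (\<lambda>x. indicator (cball 0 R) x * f x)"

lemma truncation_measurable [measurable]:
  "f \<in> borel_measurable borel \<Longrightarrow> truncation f R \<in> borel_measurable borel"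
  unfolding truncation_def by (intro borel_measurable_times borel_measurable_indicator) auto

lemma cmod_truncation_le: "cmod (truncation f R x) \<le> cmod (f x)"
  by (simp add: truncation_def indicator_def)

context
  fixes f :: "'a::euclidean_space \<Rightarrow> complex"
  assumes fm[measurable]: "f \<in> borel_measurable borel"
    and f2: "integrable lborel (\<lambda>x. (cmod (f x))\<^sup>2)"
begin

lemma truncation_square_integrable: "integrable lborel (\<lambda>x. (cmod (truncation f R x))\<^sup>2)"
  by (rule Bochner_Integration.integrable_bound[OF f2]) (auto intro!: AE_I2 power_mono cmod_truncation_le)

text \<open>On the ball, which has finite measure, |f| \<le> 1 + |f|^2.\<close>

lemma truncation_integrable: "integrable lborel (truncation f R)"
proof -
  have "emeasure lborel (cball (0::'a) R) < \<infinity>" by (rule emeasure_lborel_cball_finite)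
  hence "integrable lborel (\<lambda>x::'a. indicator (cball 0 R) x + (cmod (f x))\<^sup>2)"
    using f2 by (intro Bochner_Integration.integrable_add) (auto simp: integrable_indicator_iff)
  thus ?thesis
  proof (rule Bochner_Integration.integrable_bound)
    show "AE x in lborel. norm (truncation f R x) \<le> norm (indicator (cball 0 R) x + (cmod (f x))\<^sup>2)"
    proof (intro AE_I2)
      fix x
      have "cmod (f x) \<le> 1 + (cmod (f x))\<^sup>2"
        using sum_squares_bound[of 1 "cmod (f x)"] zero_le_power2[of "cmod (f x)"] norm_ge_zero[of "f x"] unfolding power_one by linarith
      thus "norm (truncation f R x) \<le> norm (indicator (cball 0 R) x + (cmod (f x))\<^sup>2)"
        by (auto simp: truncation_def indicator_def)
    qed
  qed measurable
qed

text \<open>Plancherel's theorem for the difference of two truncations; it makes their Fourier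
  integrals a Cauchy family.\<close>

lemma fourier_truncation_diff:
  "(\<integral>\<^sup>+\<xi>. ennreal ((cmod (fourier_integral (truncation f R) \<xi> - fourier_integral (truncation f R') \<xi>))\<^sup>2) \<partial>lborel)
   = (\<integral>\<^sup>+x. ennreal ((cmod (truncation f R x - truncation f R' x))\<^sup>2) \<partial>lborel)"
proof -
  have i: "integrable lborel (\<lambda>x. truncation f R x - truncation f R' x)"
    by (intro Bochner_Integration.integrable_diff truncation_integrable)
  have "integrable lborel (\<lambda>x. 2 * (cmod (truncation f R x))\<^sup>2 + 2 * (cmod (truncation f R' x))\<^sup>2)"
    by (intro Bochner_Integration.integrable_add integrable_mult_right truncation_square_integrable)
  hence i2: "integrable lborel (\<lambda>x. (cmod (truncation f R x - truncation f R' x))\<^sup>2)"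
    by (rule Bochner_Integration.integrable_bound) (auto intro!: AE_I2 cmod_diff_sq_le)
  have ph: "integrable lborel (\<lambda>x. iexp (- 2 * pi * (x \<bullet> \<xi>)) * truncation f S x)" for S \<xi>
    by (rule Bochner_Integration.integrable_bound[OF truncation_integrable[of S]]) (auto simp: norm_mult)
  have "fourier_integral (truncation f R) \<xi> - fourier_integral (truncation f R') \<xi>
      = fourier_integral (\<lambda>x. truncation f R x - truncation f R' x) \<xi>" for \<xi>
  proof -
    have "fourier_integral (\<lambda>x. truncation f R x - truncation f R' x) \<xi> =
      (LINT x|lborel. iexp (- 2 * pi * (x \<bullet> \<xi>)) * truncation f R x - iexp (- 2 * pi * (x \<bullet> \<xi>)) * truncation f R' x)"
      by (simp add: fourier_integral_eq_lborel right_diff_distrib)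
    also have "\<dots> = (LINT x|lborel. iexp (- 2 * pi * (x \<bullet> \<xi>)) * truncation f R x) - (LINT x|lborel. iexp (- 2 * pi * (x \<bullet> \<xi>)) * truncation f R' x)"
      by (rule Bochner_Integration.integral_diff[OF ph ph])
    finally show ?thesis by (simp add: fourier_integral_eq_lborel)
  qed
  thus ?thesis using plancherel_L1_L2[OF i i2] by simp
qed

lemma truncation_tendsto: "(\<lambda>n. \<integral>\<^sup>+x. ennreal ((cmod (f x - truncation f (real n) x))\<^sup>2) \<partial>lborel) \<longlonglongrightarrow> 0"
proof -
  have "(\<lambda>n. \<integral>\<^sup>+x. ennreal ((cmod (f x - truncation f (real n) x))\<^sup>2) \<partial>lborel) \<longlonglongrightarrow> (\<integral>\<^sup>+x. 0 \<partial>(lborel :: 'a measure))"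
  proof (rule nn_integral_dominated_convergence[where w="\<lambda>x. ennreal ((cmod (f x))\<^sup>2)"])
    show "AE x in lborel. ennreal ((cmod (f x - truncation f (real n) x))\<^sup>2) \<le> ennreal ((cmod (f x))\<^sup>2)" for n
      by (intro AE_I2 ennreal_leI power_mono) (auto simp: truncation_def indicator_def)
    show "AE x in lborel. (\<lambda>n. ennreal ((cmod (f x - truncation f (real n) x))\<^sup>2)) \<longlonglongrightarrow> 0"
    proof (intro AE_I2 tendsto_eventually)
      fix x :: 'a
      show "\<forall>\<^sub>F n in sequentially. ennreal ((cmod (f x - truncation f (real n) x))\<^sup>2) = 0"
        using eventually_ge_at_top[of "nat \<lceil>norm x\<rceil>"]
        by eventually_elim (auto simp: truncation_def indicator_def)
    qed
    show "(\<integral>\<^sup>+x. ennreal ((cmod (f x))\<^sup>2) \<partial>lborel) < \<infinity>" using f2 by (simp add: integrable_iff_bounded)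
  qed measurable
  thus ?thesis by simp
qed

lemma truncation_diff_le:
  assumes "R \<le> R'"
  shows "(\<integral>\<^sup>+x. ennreal ((cmod (truncation f R' x - truncation f R x))\<^sup>2) \<partial>lborel) \<le>
    (\<integral>\<^sup>+x. ennreal ((cmod (f x - truncation f R x))\<^sup>2) \<partial>lborel)"
  using assms by (intro nn_integral_mono ennreal_leI power_mono) (auto simp: truncation_def indicator_def)

lemma fourier_truncation_measurable [measurable]: "fourier_integral (truncation f R) \<in> borel_measurable borel"
  by (rule fourier_integral_measurable) measurable

text \<open>Completeness gives a limit along integer radii. A real radius R \<ge> n is then compared
  with n: the distance of the two Fourier integrals is at most the part of f outside the ball of
  radius n.\<close>

lemma has_fourier_transform_exists_borel: "\<exists>g. has_fourier_transform f g"
proof -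
  let ?h = "\<lambda>n. fourier_integral (truncation f (real n))"
  let ?T = "\<lambda>n. \<integral>\<^sup>+x. ennreal ((cmod (f x - truncation f (real n) x))\<^sup>2) \<partial>lborel"
  have T: "\<exists>N. \<forall>n\<ge>N. ?T n < ennreal e" if "0 < e" for e :: real
    using order_tendstoD(2)[OF truncation_tendsto, of "ennreal e"] that by (auto simp: eventually_sequentially)
  obtain g where g[measurable]: "g \<in> borel_measurable borel"
    and lim: "(\<lambda>n. \<integral>\<^sup>+\<xi>. ennreal ((cmod (?h n \<xi> - g \<xi>))\<^sup>2) \<partial>lborel) \<longlonglongrightarrow> 0"
  proof (rule L2_complete[of ?h])
    fix e :: real assume "0 < e"
    then obtain N where N: "\<And>n. n \<ge> N \<Longrightarrow> ?T n < ennreal e" using T by blast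
    show "\<exists>N. \<forall>m\<ge>N. \<forall>n\<ge>N. (\<integral>\<^sup>+\<xi>. ennreal ((cmod (?h m \<xi> - ?h n \<xi>))\<^sup>2) \<partial>lborel) \<le> ennreal e"
    proof (intro exI[of _ N] allI impI)
      fix m n assume mn: "N \<le> m" "N \<le> n"
      show "(\<integral>\<^sup>+\<xi>. ennreal ((cmod (?h m \<xi> - ?h n \<xi>))\<^sup>2) \<partial>lborel) \<le> ennreal e"
      proof (cases "n \<le> m")
        case True
        thus ?thesis unfolding fourier_truncation_diff
          using truncation_diff_le[of "real n" "real m"] N[OF mn(2)] by (auto intro: order_trans less_imp_le)
      next
        case False
        thus ?thesis unfolding fourier_truncation_diff norm_minus_commute[of "truncation f (real m) _"]
          using truncation_diff_le[of "real m" "real n"] N[OF mn(1)] by (auto intro: order_trans less_imp_le)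
      qed
    qed
  qed auto
  have G2: "(\<integral>\<^sup>+\<xi>. ennreal ((cmod (g \<xi>))\<^sup>2) \<partial>lborel) < \<infinity>"
  proof -
    obtain n where n: "(\<integral>\<^sup>+\<xi>. ennreal ((cmod (?h n \<xi> - g \<xi>))\<^sup>2) \<partial>lborel) < 1"
      using order_tendstoD(2)[OF lim, of 1] by (auto simp: eventually_sequentially)
    have "(\<integral>\<^sup>+\<xi>. ennreal ((cmod (g \<xi>))\<^sup>2) \<partial>lborel) \<le> ennreal (1 + 1) * (\<integral>\<^sup>+\<xi>. ennreal ((cmod (?h n \<xi>))\<^sup>2) \<partial>lborel)
      + ennreal (1 + 1 / 1) * (\<integral>\<^sup>+\<xi>. ennreal ((cmod (g \<xi> - ?h n \<xi>))\<^sup>2) \<partial>lborel)"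
      using nn_integral_sq_perturb[of g lborel "?h n" "\<lambda>_. 1" 1] by simp
    also have "\<dots> < \<infinity>"
      using n truncation_square_integrable[of "real n"]
      by (auto simp: plancherel_L1_L2[OF truncation_integrable truncation_square_integrable] norm_minus_commute[of "g _"]
          ennreal_mult_less_top ennreal_mult_eq_top_iff integrable_iff_bounded less_top[symmetric])
    finally show ?thesis .
  qed
  have "((\<lambda>R::real. \<integral>\<^sup>+\<xi>. ennreal ((cmod (fourier_integral (truncation f R) \<xi> - g \<xi>))\<^sup>2) \<partial>lborel) \<longlongrightarrow> 0) at_top"
  proof (rule ennreal_tendsto_0_I)
    fix e :: real assume e: "0 < e"
    obtain N where N: "\<And>n. n \<ge> N \<Longrightarrow> ?T n < ennreal (e / 4)" using T[of "e / 4"] e by auto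
    obtain M where M: "\<And>n. n \<ge> M \<Longrightarrow> (\<integral>\<^sup>+\<xi>. ennreal ((cmod (?h n \<xi> - g \<xi>))\<^sup>2) \<partial>lborel) < ennreal (e / 4)"
      using order_tendstoD(2)[OF lim, of "ennreal (e / 4)"] e by (auto simp: eventually_sequentially)
    define n where "n = max N M"
    show "\<forall>\<^sub>F R in at_top. (\<integral>\<^sup>+\<xi>. ennreal ((cmod (fourier_integral (truncation f R) \<xi> - g \<xi>))\<^sup>2) \<partial>lborel) \<le> ennreal e"
      using eventually_ge_at_top[of "real n"]
    proof eventually_elim
      case (elim R)
      have "(\<integral>\<^sup>+\<xi>. ennreal ((cmod (fourier_integral (truncation f R) \<xi> - g \<xi>))\<^sup>2) \<partial>lborel) \<le>
         ennreal (1 + 1) * (\<integral>\<^sup>+\<xi>. ennreal ((cmod (?h n \<xi> - g \<xi>))\<^sup>2) \<partial>lborel) +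
         ennreal (1 + 1 / 1) * (\<integral>\<^sup>+\<xi>. ennreal ((cmod (fourier_integral (truncation f R) \<xi> - ?h n \<xi>))\<^sup>2) \<partial>lborel)"
        using nn_integral_sq_perturb[of "\<lambda>\<xi>. fourier_integral (truncation f R) \<xi> - g \<xi>" lborel "\<lambda>\<xi>. ?h n \<xi> - g \<xi>" "\<lambda>_. 1" 1] by simp
      also have "\<dots> \<le> ennreal (1 + 1) * ennreal (e / 4) + ennreal (1 + 1 / 1) * ennreal (e / 4)"
      proof (intro add_mono mult_left_mono)
        show "(\<integral>\<^sup>+\<xi>. ennreal ((cmod (?h n \<xi> - g \<xi>))\<^sup>2) \<partial>lborel) \<le> ennreal (e / 4)"
          using M[of n] by (simp add: n_def)
        have "(\<integral>\<^sup>+\<xi>. ennreal ((cmod (fourier_integral (truncation f R) \<xi> - ?h n \<xi>))\<^sup>2) \<partial>lborel) \<le> ?T n"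
          unfolding fourier_truncation_diff by (rule truncation_diff_le[OF elim])
        also have "\<dots> \<le> ennreal (e / 4)" using N[of n] by (simp add: n_def)
        finally show "(\<integral>\<^sup>+\<xi>. ennreal ((cmod (fourier_integral (truncation f R) \<xi> - ?h n \<xi>))\<^sup>2) \<partial>lborel) \<le> ennreal (e / 4)" .
      qed auto
      also have "\<dots> = ennreal e"
        using e by (simp add: ennreal_mult[symmetric] ennreal_plus[symmetric] del: ennreal_plus flip: ennreal_numeral)
      finally show ?case .
    qed
  qed
  moreover have "integrable lborel (\<lambda>\<xi>. (cmod (g \<xi>))\<^sup>2)"
    using G2 by (intro integrableI_nonneg) auto
  ultimately have "has_fourier_transform f g"
    using f2 unfolding has_fourier_transform_def square_integrable_def truncation_def
    by (auto simp: nn_integral_completion integrable_completion intro: measurable_completion)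
  thus ?thesis by (rule exI[of "has_fourier_transform f"])
qed

text \<open>Both identities hold for the truncations and pass to the limit, one inequality at a
  time, by \<open>ennreal_le_by_approx\<close>. They are stated for every limit g, because
  \<open>fourier_transform\<close> is some chosen one.\<close>

lemma has_fourier_transform_norm_and_energy:
  assumes "has_fourier_transform f g"
  shows "(\<integral>\<^sup>+\<xi>. ennreal ((cmod (g \<xi>))\<^sup>2) \<partial>lebesgue) = (\<integral>\<^sup>+x. ennreal ((cmod (f x))\<^sup>2) \<partial>lborel)"
    and "0 < t \<Longrightarrow> heat_energy t f =
      2 * (\<integral>\<^sup>+\<xi>. ennreal ((1 - exp (- pi * t * (norm \<xi>)\<^sup>2)) * (cmod (g \<xi>))\<^sup>2) \<partial>lebesgue)"
proof -
  let ?h = "\<lambda>n. fourier_integral (truncation f (real n))"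
  let ?T = "\<lambda>n. \<integral>\<^sup>+x. ennreal ((cmod (f x - truncation f (real n) x))\<^sup>2) \<partial>lborel"
  let ?e = "\<lambda>n. \<integral>\<^sup>+\<xi>. ennreal ((cmod (?h n \<xi> - g \<xi>))\<^sup>2) \<partial>lebesgue"
  have gm[measurable]: "g \<in> borel_measurable lebesgue"
    using assms unfolding has_fourier_transform_def square_integrable_def by auto
  have hm[measurable]: "?h n \<in> borel_measurable lebesgue" for n
    by (intro measurable_completion) simp
  have e0: "?e \<longlonglongrightarrow> 0"
    using assms unfolding has_fourier_transform_def truncation_def[symmetric]
    by (elim conjE) (rule filterlim_compose[OF _ filterlim_real_sequentially])
  have pert: "(\<integral>\<^sup>+\<xi>. ennreal (m \<xi> * (cmod (g \<xi>))\<^sup>2) \<partial>lebesgue) \<le>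
      ennreal (1 + d) * (\<integral>\<^sup>+\<xi>. ennreal (m \<xi> * (cmod (?h n \<xi>))\<^sup>2) \<partial>lborel) + ennreal (1 + 1 / d) * ?e n"
     "(\<integral>\<^sup>+\<xi>. ennreal (m \<xi> * (cmod (?h n \<xi>))\<^sup>2) \<partial>lborel) \<le>
      ennreal (1 + d) * (\<integral>\<^sup>+\<xi>. ennreal (m \<xi> * (cmod (g \<xi>))\<^sup>2) \<partial>lebesgue) + ennreal (1 + 1 / d) * ?e n"
    if m: "m \<in> borel_measurable lebesgue" "\<And>x. 0 \<le> m x" "\<And>x. m x \<le> 1" and d: "0 < d" for m :: "'a \<Rightarrow> real" and d n
    using nn_integral_sq_perturb[OF gm hm[of n] m d] nn_integral_sq_perturb[OF hm[of n] gm m d]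
    unfolding norm_minus_commute[of "g _"] nn_integral_completion by auto
  have one: "(\<lambda>_. 1::real) \<in> borel_measurable lebesgue" by simp
  note p1 = pert[of "\<lambda>_. 1", OF one, simplified]
  have q1: "(\<integral>\<^sup>+\<xi>. ennreal ((cmod (?h n \<xi>))\<^sup>2) \<partial>lborel) = (\<integral>\<^sup>+x. ennreal ((cmod (truncation f (real n) x))\<^sup>2) \<partial>lborel)" for n
    by (rule plancherel_L1_L2[OF truncation_integrable truncation_square_integrable])
  have r1: "(\<integral>\<^sup>+x. ennreal ((cmod (f x))\<^sup>2) \<partial>lborel) \<le>
      ennreal (1 + d) * (\<integral>\<^sup>+\<xi>. ennreal ((cmod (?h n \<xi>))\<^sup>2) \<partial>lborel) + ennreal (1 + 1 / d) * ?T n"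
     "(\<integral>\<^sup>+\<xi>. ennreal ((cmod (?h n \<xi>))\<^sup>2) \<partial>lborel) \<le>
      ennreal (1 + d) * (\<integral>\<^sup>+x. ennreal ((cmod (f x))\<^sup>2) \<partial>lborel) + ennreal (1 + 1 / d) * ?T n"
    if d: "0 < d" for d n
    using nn_integral_sq_perturb[of f lborel "truncation f (real n)" "\<lambda>_. 1" d]
      nn_integral_sq_perturb[of "truncation f (real n)" lborel f "\<lambda>_. 1" d] d
    unfolding q1 norm_minus_commute[of "truncation f (real n) _"] by auto
  show "(\<integral>\<^sup>+\<xi>. ennreal ((cmod (g \<xi>))\<^sup>2) \<partial>lebesgue) = (\<integral>\<^sup>+x. ennreal ((cmod (f x))\<^sup>2) \<partial>lborel)"
  proof (rule antisym)
    show "(\<integral>\<^sup>+\<xi>. ennreal ((cmod (g \<xi>))\<^sup>2) \<partial>lebesgue) \<le> (\<integral>\<^sup>+x. ennreal ((cmod (f x))\<^sup>2) \<partial>lborel)"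
      by (rule ennreal_le_by_approx[OF p1(1) r1(2) e0 truncation_tendsto])
    show "(\<integral>\<^sup>+x. ennreal ((cmod (f x))\<^sup>2) \<partial>lborel) \<le> (\<integral>\<^sup>+\<xi>. ennreal ((cmod (g \<xi>))\<^sup>2) \<partial>lebesgue)"
      by (rule ennreal_le_by_approx[OF r1(1) p1(2) truncation_tendsto e0])
  qed
  assume t: "0 < t"
  define m where "m = (\<lambda>\<xi>::'a. 1 - exp (- pi * t * (norm \<xi>)\<^sup>2))"
  have mm: "m \<in> borel_measurable lebesgue" unfolding m_def by (intro measurable_completion) simp
  have m01: "0 \<le> m \<xi>" "m \<xi> \<le> 1" for \<xi> unfolding m_def using t by auto
  note p2 = pert[of m, OF mm m01]
  have q2: "heat_energy t (truncation f (real n)) = 2 * (\<integral>\<^sup>+\<xi>. ennreal (m \<xi> * (cmod (?h n \<xi>))\<^sup>2) \<partial>lborel)" for n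
    unfolding m_def by (rule heat_energy_fourier_integral[OF truncation_integrable truncation_square_integrable t])
  have p2': "2 * (\<integral>\<^sup>+\<xi>. ennreal (m \<xi> * (cmod (g \<xi>))\<^sup>2) \<partial>lebesgue) \<le>
      ennreal (1 + d) * heat_energy t (truncation f (real n)) + ennreal (1 + 1 / d) * (2 * ?e n)"
     "heat_energy t (truncation f (real n)) \<le>
      ennreal (1 + d) * (2 * (\<integral>\<^sup>+\<xi>. ennreal (m \<xi> * (cmod (g \<xi>))\<^sup>2) \<partial>lebesgue)) + ennreal (1 + 1 / d) * (2 * ?e n)"
    if d: "0 < d" for d n
    using mult_left_mono[OF p2(1)[OF d, of n], of 2] mult_left_mono[OF p2(2)[OF d, of n], of 2]
    unfolding q2 by (simp_all add: distrib_left mult.left_commute)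
  have hb: "heat_energy t (\<lambda>x. f x - truncation f (real n) x) \<le> 4 * ?T n" for n
    by (rule heat_energy_le[OF _ t]) measurable
  have hb': "heat_energy t (\<lambda>x. truncation f (real n) x - f x) \<le> 4 * ?T n" for n
    using hb[of n] heat_energy_cmult[of "\<lambda>x. f x - truncation f (real n) x" t "-1"] by simp
  have r2: "heat_energy t f \<le> ennreal (1 + d) * heat_energy t (truncation f (real n)) + ennreal (1 + 1 / d) * (4 * ?T n)"
    "heat_energy t (truncation f (real n)) \<le> ennreal (1 + d) * heat_energy t f + ennreal (1 + 1 / d) * (4 * ?T n)"
    if d: "0 < d" for d n
  proof -
    have "heat_energy t f \<le> ennreal (1 + d) * heat_energy t (truncation f (real n)) + ennreal (1 + 1 / d) * heat_energy t (\<lambda>x. f x - truncation f (real n) x)"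
      using heat_energy_add_le_weighted[of "truncation f (real n)" "\<lambda>x. f x - truncation f (real n) x" d t] d by simp
    also have "\<dots> \<le> ennreal (1 + d) * heat_energy t (truncation f (real n)) + ennreal (1 + 1 / d) * (4 * ?T n)"
      by (intro add_left_mono mult_left_mono hb) simp
    finally show "heat_energy t f \<le> ennreal (1 + d) * heat_energy t (truncation f (real n)) + ennreal (1 + 1 / d) * (4 * ?T n)" .
    have "heat_energy t (truncation f (real n)) \<le> ennreal (1 + d) * heat_energy t f + ennreal (1 + 1 / d) * heat_energy t (\<lambda>x. truncation f (real n) x - f x)"
      using heat_energy_add_le_weighted[of f "\<lambda>x. truncation f (real n) x - f x" d t] d by simp
    also have "\<dots> \<le> ennreal (1 + d) * heat_energy t f + ennreal (1 + 1 / d) * (4 * ?T n)"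
      by (intro add_left_mono mult_left_mono hb') simp
    finally show "heat_energy t (truncation f (real n)) \<le> ennreal (1 + d) * heat_energy t f + ennreal (1 + 1 / d) * (4 * ?T n)" .
  qed
  have l1: "(\<lambda>n. 4 * ?T n) \<longlonglongrightarrow> 0" using ennreal_tendsto_cmult[OF _ truncation_tendsto, of 4] by simp
  have l2: "(\<lambda>n. 2 * ?e n) \<longlonglongrightarrow> 0" using ennreal_tendsto_cmult[OF _ e0, of 2] by simp
  show "heat_energy t f = 2 * (\<integral>\<^sup>+\<xi>. ennreal ((1 - exp (- pi * t * (norm \<xi>)\<^sup>2)) * (cmod (g \<xi>))\<^sup>2) \<partial>lebesgue)"
    unfolding m_def[symmetric, THEN fun_cong]
  proof (rule antisym)
    show "heat_energy t f \<le> 2 * (\<integral>\<^sup>+\<xi>. ennreal (m \<xi> * (cmod (g \<xi>))\<^sup>2) \<partial>lebesgue)"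
      by (rule ennreal_le_by_approx[OF r2(1) p2'(2) l1 l2])
    show "2 * (\<integral>\<^sup>+\<xi>. ennreal (m \<xi> * (cmod (g \<xi>))\<^sup>2) \<partial>lebesgue) \<le> heat_energy t f"
      by (rule ennreal_le_by_approx[OF p2'(1) r2(2) l2 l1])
  qed
qed

end

text \<open>The definitions use the completed measure \<open>lebesgue\<close>, whereas double
  integrals are treated for Borel functions on \<open>lborel\<close>. Passing to a Borel
  representative connects the two.\<close>

lemma AE_eq_borel_complex:
  fixes f :: "'a::euclidean_space \<Rightarrow> complex"
  assumes f: "f \<in> borel_measurable lebesgue"
  obtains f' where "f' \<in> borel_measurable borel" "AE x in lborel. f x = f' x"
proof -
  have "(\<lambda>x. Re (f x)) \<in> borel_measurable lebesgue" "(\<lambda>x. Im (f x)) \<in> borel_measurable lebesgue"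
    using f by measurable
  then obtain a b where ab: "a \<in> borel_measurable lborel" "AE x in lborel. Re (f x) = a x"
    "b \<in> borel_measurable lborel" "AE x in lborel. Im (f x) = b x"
    using completion_ex_borel_measurable_real by blast
  have "(\<lambda>x. Complex (a x) (b x)) \<in> borel_measurable borel"
    using ab unfolding borel_measurable_complex_iff by simp
  moreover have "AE x in lborel. f x = Complex (a x) (b x)"
    using ab(2,4) by eventually_elim (simp add: complex_eq_iff)
  ultimately show ?thesis using that by blast
qed

lemma square_integrable_cong_AE:
  assumes "f \<in> borel_measurable lebesgue" "f' \<in> borel_measurable lebesgue" "AE x in lebesgue. f x = f' x"
  shows "square_integrable f \<longleftrightarrow> square_integrable f'"
proof -
  have "integrable lebesgue (\<lambda>x. (cmod (f x))\<^sup>2) \<longleftrightarrow> integrable lebesgue (\<lambda>x. (cmod (f' x))\<^sup>2)"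
    by (rule integrable_cong_AE) (use assms in auto)
  thus ?thesis unfolding square_integrable_def using assms by simp
qed

text \<open>An equality of predicates, so that \<open>SOME\<close> selects the same function: the
  transforms of almost everywhere equal functions coincide at every point.\<close>

lemma has_fourier_transform_cong_AE:
  assumes m: "f \<in> borel_measurable lebesgue" "f' \<in> borel_measurable lebesgue" and ae: "AE x in lebesgue. f x = f' x"
  shows "has_fourier_transform f = has_fourier_transform f'"
proof -
  have "fourier_integral (\<lambda>x. indicator (cball 0 R) x * f x) \<xi> = fourier_integral (\<lambda>x. indicator (cball 0 R) x * f' x) \<xi>" for R \<xi>
    unfolding fourier_integral_def
  proof (rule integral_cong_AE)
    have [measurable]: "(\<lambda>x. indicator (cball 0 R) x :: complex) \<in> borel_measurable lebesgue"
       "(\<lambda>x::'a. exp (- 2 * complex_of_real pi * \<i> * complex_of_real (x \<bullet> \<xi>))) \<in> borel_measurable lebesgue"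
      by (auto intro!: measurable_completion borel_measurable_indicator)
    show "(\<lambda>x. exp (- 2 * complex_of_real pi * \<i> * complex_of_real (x \<bullet> \<xi>)) * (indicator (cball 0 R) x * f x)) \<in> borel_measurable lebesgue"
      "(\<lambda>x. exp (- 2 * complex_of_real pi * \<i> * complex_of_real (x \<bullet> \<xi>)) * (indicator (cball 0 R) x * f' x)) \<in> borel_measurable lebesgue"
      using m by measurable
    show "AE x in lebesgue. exp (- 2 * complex_of_real pi * \<i> * complex_of_real (x \<bullet> \<xi>)) * (indicator (cball 0 R) x * f x) =
      exp (- 2 * complex_of_real pi * \<i> * complex_of_real (x \<bullet> \<xi>)) * (indicator (cball 0 R) x * f' x)"
      using ae by eventually_elim simp
  qed
  thus ?thesis
    unfolding has_fourier_transform_def fun_eq_iff using square_integrable_cong_AE[OF m ae] by simp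
qed

lemma fourier_transform_cong_AE:
  assumes "f \<in> borel_measurable lebesgue" "f' \<in> borel_measurable lebesgue" "AE x in lebesgue. f x = f' x"
  shows "fourier_transform f = fourier_transform f'"
  unfolding fourier_transform_def has_fourier_transform_cong_AE[OF assms] ..

lemma square_integrable_borel_iff:
  assumes "f \<in> borel_measurable borel"
  shows "square_integrable f \<longleftrightarrow> integrable lborel (\<lambda>x. (cmod (f x))\<^sup>2)"
  using assms unfolding square_integrable_def
  by (auto simp: integrable_completion intro: measurable_completion)

lemma square_integrableI:
  assumes "f \<in> borel_measurable lebesgue" "(\<integral>\<^sup>+x. ennreal ((cmod (f x))\<^sup>2) \<partial>lebesgue) < \<infinity>"
  shows "square_integrable f"
  using assms unfolding square_integrable_def by (auto intro!: integrableI_nonneg)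

lemma square_integrable_nn_integral:
  "square_integrable f \<Longrightarrow> (\<integral>\<^sup>+x. ennreal ((cmod (f x))\<^sup>2) \<partial>lebesgue) < \<infinity>"
  unfolding square_integrable_def by (auto simp: integrable_iff_bounded)

lemma has_fourier_transform_fourier_transform:
  assumes f: "square_integrable f"
  shows "has_fourier_transform f (fourier_transform f)"
proof -
  have fm: "f \<in> borel_measurable lebesgue" using f by (simp add: square_integrable_def)
  obtain f' where f': "f' \<in> borel_measurable borel" "AE x in lborel. f x = f' x"
    using AE_eq_borel_complex[OF fm] .
  have m': "f' \<in> borel_measurable lebesgue" using f'(1) by (intro measurable_completion) simp
  have ae: "AE x in lebesgue. f x = f' x" using f'(2) by (rule AE_completion)
  have "square_integrable f'" using f square_integrable_cong_AE[OF fm m' ae] by simp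
  hence "\<exists>g. has_fourier_transform f' g"
    using f'(1) by (intro has_fourier_transform_exists_borel) (auto simp: square_integrable_borel_iff)
  hence "\<exists>g. has_fourier_transform f g" unfolding has_fourier_transform_cong_AE[OF fm m' ae] .
  thus ?thesis unfolding fourier_transform_def by (rule someI_ex)
qed

lemma fourier_transform_square_integrable:
  "square_integrable f \<Longrightarrow> square_integrable (fourier_transform f)"
  using has_fourier_transform_fourier_transform unfolding has_fourier_transform_def by blast

theorem plancherel:
  assumes f: "square_integrable f"
  shows "(\<integral>\<^sup>+\<xi>. ennreal ((cmod (fourier_transform f \<xi>))\<^sup>2) \<partial>lebesgue) = (\<integral>\<^sup>+x. ennreal ((cmod (f x))\<^sup>2) \<partial>lebesgue)"
proof -
  have fm: "f \<in> borel_measurable lebesgue" using f by (simp add: square_integrable_def)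
  obtain f' where f': "f' \<in> borel_measurable borel" "AE x in lborel. f x = f' x"
    using AE_eq_borel_complex[OF fm] .
  have m': "f' \<in> borel_measurable lebesgue" using f'(1) by (intro measurable_completion) simp
  have ae: "AE x in lebesgue. f x = f' x" using f'(2) by (rule AE_completion)
  have "square_integrable f'" using f square_integrable_cong_AE[OF fm m' ae] by simp
  hence i: "integrable lborel (\<lambda>x. (cmod (f' x))\<^sup>2)" using f'(1) by (simp add: square_integrable_borel_iff)
  have "has_fourier_transform f' (fourier_transform f)"
    using has_fourier_transform_fourier_transform[OF f] unfolding has_fourier_transform_cong_AE[OF fm m' ae] .
  hence "(\<integral>\<^sup>+\<xi>. ennreal ((cmod (fourier_transform f \<xi>))\<^sup>2) \<partial>lebesgue) = (\<integral>\<^sup>+x. ennreal ((cmod (f' x))\<^sup>2) \<partial>lborel)"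
    by (rule has_fourier_transform_norm_and_energy(1)[OF f'(1) i])
  also have "\<dots> = (\<integral>\<^sup>+x. ennreal ((cmod (f x))\<^sup>2) \<partial>lebesgue)"
    unfolding nn_integral_completion using f'(2) by (intro nn_integral_cong_AE) auto
  finally show ?thesis .
qed

text \<open>Removes the reflection in \<open>inverse_fourier_transform\<close> from
  integrals.\<close>

lemma lebesgue_reflect:
  shows "(uminus :: 'a::euclidean_space \<Rightarrow> 'a) \<in> lebesgue \<rightarrow>\<^sub>M lebesgue"
    and "distr lebesgue lebesgue uminus = (lebesgue :: 'a measure)"
proof -
  have T: "(\<lambda>x::'a. 0 + (\<Sum>j\<in>Basis. (- 1 * (x \<bullet> j)) *\<^sub>R j)) = uminus"
    by (auto simp: sum_negf euclidean_representation)
  show "(uminus :: 'a \<Rightarrow> 'a) \<in> lebesgue \<rightarrow>\<^sub>M lebesgue"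
    using lebesgue_affine_measurable[of "\<lambda>_. -1" "0::'a"] unfolding T by simp
  have "lebesgue = density (distr lebesgue lebesgue (uminus :: 'a \<Rightarrow> 'a)) (\<lambda>_. (\<Prod>j\<in>(Basis::'a set). \<bar>-1::real\<bar>))"
    using lebesgue_affine_euclidean[of "\<lambda>_. -1" "0::'a"] unfolding T by simp
  thus "distr lebesgue lebesgue uminus = (lebesgue :: 'a measure)" by (simp add: density_1)
qed

subsection \<open>Subordination and the fractional energy\<close>

text \<open>Up to a constant, integration against the Levy measure of the s-stable subordinator, for
  0 < s < 1. It sends 1 - exp (- pi t a) to a multiple of a to the power s, and it transports
  estimates valid at each t to the fractional energy.\<close>

definition subordinate :: "real \<Rightarrow> (real \<Rightarrow> ennreal) \<Rightarrow> ennreal" where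
  "subordinate s \<phi> = (\<integral>\<^sup>+t. indicator {0<..} t * (ennreal (t powr (- 1 - s)) * \<phi> t) \<partial>lborel)"

lemma subordinate_mono:
  assumes "\<And>t. 0 < t \<Longrightarrow> \<phi> t \<le> \<psi> t"
  shows "subordinate s \<phi> \<le> subordinate s \<psi>"
  unfolding subordinate_def using assms
  by (intro nn_integral_mono) (auto simp: indicator_def intro!: mult_left_mono)

lemma subordinate_cong:
  assumes "\<And>t. 0 < t \<Longrightarrow> \<phi> t = \<psi> t"
  shows "subordinate s \<phi> = subordinate s \<psi>"
  unfolding subordinate_def using assms
  by (intro nn_integral_cong) (auto simp: indicator_def)

lemma subordinate_cmult:
  assumes [measurable]: "\<phi> \<in> borel_measurable borel"
  shows "subordinate s (\<lambda>t. c * \<phi> t) = c * subordinate s \<phi>"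
  unfolding subordinate_def by (subst nn_integral_cmult[symmetric]) (auto simp: mult_ac)

lemma subordinate_add:
  assumes [measurable]: "\<phi> \<in> borel_measurable borel" "\<psi> \<in> borel_measurable borel"
  shows "subordinate s (\<lambda>t. \<phi> t + \<psi> t) = subordinate s \<phi> + subordinate s \<psi>"
  unfolding subordinate_def by (subst nn_integral_add[symmetric]) (auto simp: distrib_left)

text \<open>Substituting a t, the weight contributes a to the power - 1 - s and the measure
  contributes a. All powers of frequencies, dilation factors and cutoff radii come from
  here.\<close>

lemma subordinate_scale:
  assumes [measurable]: "\<phi> \<in> borel_measurable borel" and a: "0 < a"
  shows "subordinate s (\<lambda>t. \<phi> (a * t)) = ennreal (a powr s) * subordinate s \<phi>"
proof -
  have "subordinate s \<phi> = ennreal \<bar>a\<bar> * (\<integral>\<^sup>+t. indicator {0<..} (0 + a * t) * (ennreal ((0 + a * t) powr (- 1 - s)) * \<phi> (0 + a * t)) \<partial>lborel)"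
    unfolding subordinate_def using a by (intro nn_integral_real_affine) auto
  also have "\<dots> = ennreal a * (\<integral>\<^sup>+t. ennreal (a powr (- 1 - s)) * (indicator {0<..} t * (ennreal (t powr (- 1 - s)) * \<phi> (a * t))) \<partial>lborel)"
  proof (rule arg_cong2[of _ _ _ _ "(*)"])
    show "ennreal \<bar>a\<bar> = ennreal a" using a by simp
  next
    show "(\<integral>\<^sup>+t. indicator {0<..} (0 + a * t) * (ennreal ((0 + a * t) powr (- 1 - s)) * \<phi> (0 + a * t)) \<partial>lborel) =
      (\<integral>\<^sup>+t. ennreal (a powr (- 1 - s)) * (indicator {0<..} t * (ennreal (t powr (- 1 - s)) * \<phi> (a * t))) \<partial>lborel)"
    proof (intro nn_integral_cong)
      fix t :: real
      show "indicator {0<..} (0 + a * t) * (ennreal ((0 + a * t) powr (- 1 - s)) * \<phi> (0 + a * t)) =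
        ennreal (a powr (- 1 - s)) * (indicator {0<..} t * (ennreal (t powr (- 1 - s)) * \<phi> (a * t)))"
        using a by (cases "0 < t") (simp_all add: powr_mult ennreal_mult mult.assoc zero_less_mult_iff)
    qed
  qed
  also have "\<dots> = ennreal a * (ennreal (a powr (- 1 - s)) * subordinate s (\<lambda>t. \<phi> (a * t)))"
    unfolding subordinate_def by (subst nn_integral_cmult) auto
  also have "\<dots> = ennreal (a powr (- s)) * subordinate s (\<lambda>t. \<phi> (a * t))"
    using a by (simp add: mult.assoc[symmetric] ennreal_mult[symmetric] powr_mult_base)
  finally have "ennreal (a powr s) * subordinate s \<phi> = ennreal (a powr s * a powr (- s)) * subordinate s (\<lambda>t. \<phi> (a * t))"
    by (simp add: ennreal_mult mult.assoc)
  thus ?thesis using a by (simp add: powr_add[symmetric])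
qed

text \<open>Near 0 the integrand is t to the power - s, integrable as s < 1; beyond 1 it is t to the
  power - 1 - s, integrable as s > 0.\<close>

lemma subordinate_min_finite:
  assumes s: "0 < s" "s < 1"
  shows "subordinate s (\<lambda>t. ennreal (min 1 t)) < \<infinity>"
proof -
  have 1: "(\<integral>\<^sup>+t. ennreal (t powr (- s)) * indicator {0..1} t \<partial>lborel) = ennreal (1 powr (- s + 1) / (- s + 1))"
    by (rule nn_integral_has_integral_lebesgue'[OF _ has_integral_powr_from_0]) (use s in auto)
  have 2: "(\<integral>\<^sup>+t. ennreal (t powr (- 1 - s)) * indicator {1..} t \<partial>lborel) = ennreal (- (1 powr (- 1 - s + 1)) / (- 1 - s + 1))"
    by (rule nn_integral_has_integral_lebesgue'[OF _ has_integral_powr_to_inf]) (use s in auto)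
  have "subordinate s (\<lambda>t. ennreal (min 1 t)) \<le>
     (\<integral>\<^sup>+t. ennreal (t powr (- s)) * indicator {0..1} t + ennreal (t powr (- 1 - s)) * indicator {1..} t \<partial>lborel)"
    unfolding subordinate_def
  proof (intro nn_integral_mono)
    fix t :: real
    consider "t \<le> 0" | "0 < t" "t < 1" | "1 \<le> t" by linarith
    thus "indicator {0<..} t * (ennreal (t powr (- 1 - s)) * ennreal (min 1 t)) \<le>
      ennreal (t powr (- s)) * indicator {0..1} t + ennreal (t powr (- 1 - s)) * indicator {1..} t"
    proof cases
      case 2
      have "t powr (- 1 - s) * t = t powr (- s)" using 2 by (simp add: powr_mult_base mult.commute)
      thus ?thesis using 2 by (simp add: ennreal_mult[symmetric])
    qed auto
  qed
  also have "\<dots> = ennreal (1 powr (- s + 1) / (- s + 1)) + ennreal (- (1 powr (- 1 - s + 1)) / (- 1 - s + 1))"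
    by (subst nn_integral_add) (auto simp: 1 2)
  also have "\<dots> < \<infinity>" by simp
  finally show ?thesis .
qed

definition subordination_constant :: "real \<Rightarrow> real" where
  "subordination_constant s = enn2real (subordinate s (\<lambda>t. ennreal (1 - exp (- pi * t))))"

text \<open>Finiteness follows from 1 - exp (- pi t) \<le> pi min 1 t; for positivity the interval
  from 1 to 2 already contributes enough.\<close>

lemma subordination_constant:
  assumes s: "0 < s" "s < 1"
  shows "0 < subordination_constant s"
    and "subordinate s (\<lambda>t. ennreal (1 - exp (- pi * t))) = ennreal (subordination_constant s)"
proof -
  let ?c = "subordinate s (\<lambda>t. ennreal (1 - exp (- pi * t)))"
  have "?c \<le> subordinate s (\<lambda>t. ennreal pi * ennreal (min 1 t))"
  proof (rule subordinate_mono)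
    fix t :: real assume t: "0 < t"
    have "1 - exp (- pi * t) \<le> pi * t" using exp_ge_add_one_self[of "- pi * t"] by simp
    moreover have "1 - exp (- pi * t) \<le> pi * 1" using pi_ge_two exp_ge_zero[of "- pi * t"] by linarith
    ultimately have "1 - exp (- pi * t) \<le> pi * min 1 t" by (simp add: min_def)
    thus "ennreal (1 - exp (- pi * t)) \<le> ennreal pi * ennreal (min 1 t)"
      using t by (simp add: ennreal_mult[symmetric] ennreal_leI)
  qed
  also have "\<dots> = ennreal pi * subordinate s (\<lambda>t. ennreal (min 1 t))"
    by (rule subordinate_cmult) measurable
  also have "\<dots> < \<infinity>" using subordinate_min_finite[OF s] by (simp add: ennreal_mult_less_top)
  finally have fin: "?c < \<infinity>" .
  thus eq: "?c = ennreal (subordination_constant s)" unfolding subordination_constant_def by simp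
  \<comment> \<open>On the interval from 1 to 2, of length 1, the first factor of the integrand is
    smallest at t = 2 and the second at t = 1.\<close>
  let ?d = "2 powr (- 1 - s) * (1 - exp (- pi))"
  have d: "0 < ?d" by simp
  have "ennreal ?d = (\<integral>\<^sup>+t. ennreal ?d * indicator {1..2::real} t \<partial>lborel)"
    by (subst nn_integral_cmult_indicator) auto
  also have "\<dots> \<le> ?c" unfolding subordinate_def
  proof (intro nn_integral_mono)
    fix t :: real
    show "ennreal ?d * indicator {1..2} t \<le> indicator {0<..} t * (ennreal (t powr (- 1 - s)) * ennreal (1 - exp (- pi * t)))"
    proof (cases "t \<in> {1..2}")
      case True
      have "2 powr (- 1 - s) \<le> t powr (- 1 - s)" using True s by (intro powr_mono2') auto
      moreover have "1 - exp (- pi) \<le> 1 - exp (- pi * t)" using True by simp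
      ultimately have "?d \<le> t powr (- 1 - s) * (1 - exp (- pi * t))" by (intro mult_mono) auto
      thus ?thesis using True by (simp add: ennreal_mult[symmetric] ennreal_leI)
    qed simp
  qed
  finally have "ennreal ?d \<le> ennreal (subordination_constant s)" unfolding eq .
  hence "0 < ennreal (subordination_constant s)" using d by (metis ennreal_less_zero_iff less_le_trans)
  thus "0 < subordination_constant s" by simp
qed

text \<open>Integrating the kernel over t would give, up to a constant, the Gagliardo form with
  density |x - y| to the power - n - 2 s. Keeping t outermost lets every estimate be proved at fixed
  t.\<close>

definition frac_energy :: "real \<Rightarrow> ('a::euclidean_space \<Rightarrow> complex) \<Rightarrow> ennreal" where
  "frac_energy s f = subordinate s (\<lambda>t. heat_energy t f)"

lemma frac_energy_fourier_transform:
  fixes f :: "'a::euclidean_space \<Rightarrow> complex"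
  assumes fm[measurable]: "f \<in> borel_measurable borel" and f: "square_integrable f" and s: "0 < s" "s < 1"
  shows "frac_energy s f = ennreal (2 * subordination_constant s) *
    (\<integral>\<^sup>+\<xi>. ennreal (norm \<xi> powr (2 * s) * (cmod (fourier_transform f \<xi>))\<^sup>2) \<partial>lebesgue)"
proof -
  have f2: "integrable lborel (\<lambda>x. (cmod (f x))\<^sup>2)" using f by (simp add: square_integrable_borel_iff)
  have hf: "has_fourier_transform f (fourier_transform f)" by (rule has_fourier_transform_fourier_transform[OF f])
  hence "fourier_transform f \<in> borel_measurable lebesgue" by (simp add: has_fourier_transform_def square_integrable_def)
  then obtain g where [measurable]: "g \<in> borel_measurable borel" and g: "AE \<xi> in lborel. fourier_transform f \<xi> = g \<xi>"
    using AE_eq_borel_complex by blast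
  have energy: "heat_energy t f = 2 * (\<integral>\<^sup>+\<xi>. ennreal ((1 - exp (- pi * t * (norm \<xi>)\<^sup>2)) * (cmod (g \<xi>))\<^sup>2) \<partial>lborel)" if t: "0 < t" for t
    unfolding has_fourier_transform_norm_and_energy(2)[OF fm f2 hf t] nn_integral_completion
    using g by (intro arg_cong2[of _ _ _ _ "(*)"] nn_integral_cong_AE refl) auto
  let ?\<phi> = "\<lambda>t. ennreal (1 - exp (- pi * t))"
  have inner: "(\<integral>\<^sup>+t. indicator {0<..} t * (ennreal (t powr (- 1 - s)) * ennreal ((1 - exp (- pi * t * (norm \<xi>)\<^sup>2)) * (cmod (g \<xi>))\<^sup>2)) \<partial>lborel)
      = ennreal (subordination_constant s) * ennreal (norm \<xi> powr (2 * s) * (cmod (g \<xi>))\<^sup>2)" (is "?L = _") for \<xi>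
  proof (cases "\<xi> = 0")
    case False
    have "?L = subordinate s (\<lambda>t. ennreal ((cmod (g \<xi>))\<^sup>2) * ?\<phi> ((norm \<xi>)\<^sup>2 * t))"
      unfolding subordinate_def[symmetric]
      by (rule subordinate_cong) (simp add: ennreal_mult[symmetric] mult_ac)
    also have "\<dots> = ennreal ((cmod (g \<xi>))\<^sup>2) * subordinate s (\<lambda>t. ?\<phi> ((norm \<xi>)\<^sup>2 * t))"
      by (rule subordinate_cmult) measurable
    also have "subordinate s (\<lambda>t. ?\<phi> ((norm \<xi>)\<^sup>2 * t)) = ennreal (((norm \<xi>)\<^sup>2) powr s) * subordinate s ?\<phi>"
      using False by (intro subordinate_scale) auto
    also have "((norm \<xi>)\<^sup>2) powr s = norm \<xi> powr (2 * s)"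
      using False by (simp add: powr_powr flip: powr_numeral)
    finally show ?thesis
      unfolding subordination_constant(2)[OF s] by (simp add: ennreal_mult mult_ac)
  qed simp
  have "frac_energy s f = subordinate s (\<lambda>t. 2 * (\<integral>\<^sup>+\<xi>. ennreal ((1 - exp (- pi * t * (norm \<xi>)\<^sup>2)) * (cmod (g \<xi>))\<^sup>2) \<partial>lborel))"
    unfolding frac_energy_def by (rule subordinate_cong[OF energy])
  also have "\<dots> = 2 * subordinate s (\<lambda>t. (\<integral>\<^sup>+\<xi>. ennreal ((1 - exp (- pi * t * (norm \<xi>)\<^sup>2)) * (cmod (g \<xi>))\<^sup>2) \<partial>lborel))"
    by (rule subordinate_cmult) measurable
  also have "subordinate s (\<lambda>t. (\<integral>\<^sup>+\<xi>. ennreal ((1 - exp (- pi * t * (norm \<xi>)\<^sup>2)) * (cmod (g \<xi>))\<^sup>2) \<partial>lborel)) =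
    (\<integral>\<^sup>+t. \<integral>\<^sup>+\<xi>. indicator {0<..} t * (ennreal (t powr (- 1 - s)) * ennreal ((1 - exp (- pi * t * (norm \<xi>)\<^sup>2)) * (cmod (g \<xi>))\<^sup>2)) \<partial>lborel \<partial>lborel)"
    unfolding subordinate_def by (simp add: nn_integral_cmult)
  also have "\<dots> = (\<integral>\<^sup>+\<xi>. \<integral>\<^sup>+t. indicator {0<..} t * (ennreal (t powr (- 1 - s)) * ennreal ((1 - exp (- pi * t * (norm \<xi>)\<^sup>2)) * (cmod (g \<xi>))\<^sup>2)) \<partial>lborel \<partial>lborel)"
    by (rule lborel_pair.Fubini'[symmetric]) measurable
  also have "\<dots> = ennreal (subordination_constant s) * (\<integral>\<^sup>+\<xi>. ennreal (norm \<xi> powr (2 * s) * (cmod (g \<xi>))\<^sup>2) \<partial>lborel)"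
    unfolding inner by (rule nn_integral_cmult) measurable
  also have "(\<integral>\<^sup>+\<xi>. ennreal (norm \<xi> powr (2 * s) * (cmod (g \<xi>))\<^sup>2) \<partial>lborel) =
     (\<integral>\<^sup>+\<xi>. ennreal (norm \<xi> powr (2 * s) * (cmod (fourier_transform f \<xi>))\<^sup>2) \<partial>lebesgue)"
    unfolding nn_integral_completion using g by (intro nn_integral_cong_AE) auto
  finally show ?thesis
    using subordination_constant(1)[OF s] by (simp add: ennreal_mult mult.assoc)
qed

lemma one_add_powr_le:
  fixes x s :: real
  assumes "0 \<le> x" "0 < s" "s < 1"
  shows "(1 + x) powr s \<le> 2 * (1 + x powr s)"
proof -
  have "(1 + x) powr s \<le> (2 * max 1 x) powr s" using assms by (intro powr_mono2) auto
  also have "\<dots> = 2 powr s * (max 1 x) powr s" by (simp add: powr_mult)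
  also have "\<dots> \<le> 2 powr 1 * (1 + x powr s)"
    using assms by (intro mult_mono powr_mono) (auto simp: max_def)
  finally show ?thesis by simp
qed

text \<open>The weight (1 + |xi|^2) to the power s is comparable to 1 + |xi| to the power 2 s: the
  first summand is controlled by Plancherel, the second by the fractional energy. Membership can
  thus be tested without the transform.\<close>

lemma sobolev_space_iff:
  fixes f :: "'a::euclidean_space \<Rightarrow> complex"
  assumes fm: "f \<in> borel_measurable borel" and s: "0 < s" "s < 1"
  shows "f \<in> sobolev_space s \<longleftrightarrow> square_integrable f \<and> frac_energy s f < \<infinity>"
proof (cases "square_integrable f")
  case True
  define F where "F = fourier_transform f"
  have F: "square_integrable F" unfolding F_def by (rule fourier_transform_square_integrable[OF True])
  hence Fm[measurable]: "F \<in> borel_measurable lebesgue" by (simp add: square_integrable_def)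
  let ?w = "\<lambda>\<xi>. complex_of_real ((1 + (norm \<xi>)\<^sup>2) powr (s / 2)) * F \<xi>"
  have bm: "(\<lambda>\<xi>::'a. complex_of_real ((1 + (norm \<xi>)\<^sup>2) powr (s / 2))) \<in> borel_measurable lebesgue"
    "(\<lambda>\<xi>::'a. norm \<xi> powr (2 * s)) \<in> borel_measurable lebesgue"
    by (intro measurable_completion; simp)+
  have wm: "?w \<in> borel_measurable lebesgue" using bm(1) by measurable
  have weq: "(cmod (?w \<xi>))\<^sup>2 = (1 + (norm \<xi>)\<^sup>2) powr s * (cmod (F \<xi>))\<^sup>2" for \<xi>
    by (simp add: norm_mult power_mult_distrib power2_eq_square[of "_ powr _"] powr_add[symmetric])
  have n2: "((norm \<xi>)\<^sup>2) powr s = norm \<xi> powr (2 * s)" for \<xi> :: 'a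
    by (cases "\<xi> = 0") (simp_all add: powr_powr flip: powr_numeral)
  have fe: "frac_energy s f < \<infinity> \<longleftrightarrow> (\<integral>\<^sup>+\<xi>. ennreal (norm \<xi> powr (2 * s) * (cmod (F \<xi>))\<^sup>2) \<partial>lebesgue) < \<infinity>"
    unfolding frac_energy_fourier_transform[OF fm True s] F_def[symmetric]
    using subordination_constant(1)[OF s] by (auto simp: ennreal_mult_less_top ennreal_mult_eq_top_iff less_top)
  have "square_integrable ?w \<longleftrightarrow> (\<integral>\<^sup>+\<xi>. ennreal (norm \<xi> powr (2 * s) * (cmod (F \<xi>))\<^sup>2) \<partial>lebesgue) < \<infinity>"
  proof
    assume "square_integrable ?w"
    hence "(\<integral>\<^sup>+\<xi>. ennreal ((1 + (norm \<xi>)\<^sup>2) powr s * (cmod (F \<xi>))\<^sup>2) \<partial>lebesgue) < \<infinity>"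
      using square_integrable_nn_integral unfolding weq[symmetric] by blast
    moreover have "(\<integral>\<^sup>+\<xi>. ennreal (norm \<xi> powr (2 * s) * (cmod (F \<xi>))\<^sup>2) \<partial>lebesgue) \<le>
      (\<integral>\<^sup>+\<xi>. ennreal ((1 + (norm \<xi>)\<^sup>2) powr s * (cmod (F \<xi>))\<^sup>2) \<partial>lebesgue)"
      unfolding n2[symmetric] using s by (intro nn_integral_mono ennreal_leI mult_right_mono powr_mono2) auto
    ultimately show "(\<integral>\<^sup>+\<xi>. ennreal (norm \<xi> powr (2 * s) * (cmod (F \<xi>))\<^sup>2) \<partial>lebesgue) < \<infinity>" by simp
  next
    assume A: "(\<integral>\<^sup>+\<xi>. ennreal (norm \<xi> powr (2 * s) * (cmod (F \<xi>))\<^sup>2) \<partial>lebesgue) < \<infinity>"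
    have "(\<integral>\<^sup>+\<xi>. ennreal ((cmod (?w \<xi>))\<^sup>2) \<partial>lebesgue) \<le>
      (\<integral>\<^sup>+\<xi>. ennreal 2 * ennreal ((cmod (F \<xi>))\<^sup>2) + ennreal 2 * ennreal (norm \<xi> powr (2 * s) * (cmod (F \<xi>))\<^sup>2) \<partial>lebesgue)"
    proof (intro nn_integral_mono)
      fix \<xi> :: 'a
      have "(1 + (norm \<xi>)\<^sup>2) powr s * (cmod (F \<xi>))\<^sup>2 \<le> 2 * (1 + ((norm \<xi>)\<^sup>2) powr s) * (cmod (F \<xi>))\<^sup>2"
        using s by (intro mult_right_mono one_add_powr_le) auto
      also have "\<dots> = 2 * (cmod (F \<xi>))\<^sup>2 + 2 * (norm \<xi> powr (2 * s) * (cmod (F \<xi>))\<^sup>2)"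
        unfolding n2 by (simp add: algebra_simps)
      finally show "ennreal ((cmod (?w \<xi>))\<^sup>2) \<le> ennreal 2 * ennreal ((cmod (F \<xi>))\<^sup>2) + ennreal 2 * ennreal (norm \<xi> powr (2 * s) * (cmod (F \<xi>))\<^sup>2)"
        unfolding weq by (simp only: ennreal_mult[symmetric] ennreal_plus[symmetric] mult_nonneg_nonneg zero_le_power2 powr_ge_zero zero_le_numeral ennreal_leI)
    qed
    also have "\<dots> = ennreal 2 * (\<integral>\<^sup>+\<xi>. ennreal ((cmod (F \<xi>))\<^sup>2) \<partial>lebesgue) + ennreal 2 * (\<integral>\<^sup>+\<xi>. ennreal (norm \<xi> powr (2 * s) * (cmod (F \<xi>))\<^sup>2) \<partial>lebesgue)"
      using bm(2) by (subst nn_integral_add) (auto simp: nn_integral_cmult)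
    also have "\<dots> < \<infinity>"
      using A square_integrable_nn_integral[OF F] by (auto simp: ennreal_mult_less_top ennreal_mult_eq_top_iff less_top[symmetric])
    finally show "square_integrable ?w" by (rule square_integrableI[OF wm])
  qed
  thus ?thesis using True fe unfolding sobolev_space_def F_def by simp
qed (simp add: sobolev_space_def)

text \<open>The factor (2 pi) to the power 2 s of the squared symbol, divided by the factor in
  \<open>frac_energy_fourier_transform\<close>.\<close>

definition energy_constant :: "real \<Rightarrow> real" where
  "energy_constant s = (2 * pi) powr (2 * s) / (2 * subordination_constant s)"

lemma energy_constant_pos: "0 < s \<Longrightarrow> s < 1 \<Longrightarrow> 0 < energy_constant s"
  unfolding energy_constant_def using subordination_constant(1)[of s] by simp

text \<open>Plancherel applied to the multiplied transform G. Membership in the Sobolev space makes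
  the energy finite, so \<open>enn2real\<close> loses nothing.\<close>

lemma half_laplacian_energy:
  fixes f :: "'a::euclidean_space \<Rightarrow> complex"
  assumes fm: "f \<in> borel_measurable borel" and s: "0 < s" "s < 1" and f: "f \<in> sobolev_space s"
  shows "(LINT x|lebesgue. (cmod (half_laplacian s f x))\<^sup>2) = energy_constant s * enn2real (frac_energy s f)"
proof -
  have f2: "square_integrable f" and fin: "frac_energy s f < \<infinity>" using f sobolev_space_iff[OF fm s] by auto
  define F where "F = fourier_transform f"
  have F: "square_integrable F" unfolding F_def by (rule fourier_transform_square_integrable[OF f2])
  hence Fm[measurable]: "F \<in> borel_measurable lebesgue" by (simp add: square_integrable_def)
  define G where "G \<xi> = complex_of_real ((2 * pi * norm \<xi>) powr s) * F \<xi>" for \<xi> :: 'a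
  have bm: "(\<lambda>\<xi>::'a. complex_of_real ((2 * pi * norm \<xi>) powr s)) \<in> borel_measurable lebesgue"
    "(\<lambda>\<xi>::'a. norm \<xi> powr (2 * s)) \<in> borel_measurable lebesgue"
    by (intro measurable_completion; simp)+
  have Gm: "G \<in> borel_measurable lebesgue" unfolding G_def using bm(1) by measurable
  have Geq: "(cmod (G \<xi>))\<^sup>2 = (2 * pi) powr (2 * s) * (norm \<xi> powr (2 * s) * (cmod (F \<xi>))\<^sup>2)" for \<xi>
    by (cases "\<xi> = 0") (simp_all add: G_def norm_mult power_mult_distrib powr_power powr_mult mult_ac)
  let ?I = "\<integral>\<^sup>+\<xi>. ennreal (norm \<xi> powr (2 * s) * (cmod (F \<xi>))\<^sup>2) \<partial>lebesgue"
  have GI: "(\<integral>\<^sup>+\<xi>. ennreal ((cmod (G \<xi>))\<^sup>2) \<partial>lebesgue) = ennreal ((2 * pi) powr (2 * s)) * ?I"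
    unfolding Geq using bm(2) by (simp add: ennreal_mult nn_integral_cmult)
  have fe: "frac_energy s f = ennreal (2 * subordination_constant s) * ?I"
    unfolding F_def by (rule frac_energy_fourier_transform[OF fm f2 s])
  have Ifin: "?I < \<infinity>"
    using fin subordination_constant(1)[OF s] unfolding fe by (auto simp: ennreal_mult_less_top)
  hence G2: "square_integrable G"
    by (intro square_integrableI Gm) (simp add: GI ennreal_mult_less_top)
  have hG: "half_laplacian s f x = fourier_transform G (- x)" for x
    unfolding half_laplacian_def fourier_multiplier_def inverse_fourier_transform_def G_def F_def ..
  have Hm[measurable]: "fourier_transform G \<in> borel_measurable lebesgue"
    using fourier_transform_square_integrable[OF G2] by (simp add: square_integrable_def)
  have hm: "half_laplacian s f \<in> borel_measurable lebesgue"
    unfolding hG[abs_def] by (rule measurable_compose[OF lebesgue_reflect(1) Hm])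
  have "(\<integral>\<^sup>+x. ennreal ((cmod (half_laplacian s f x))\<^sup>2) \<partial>lebesgue) =
     (\<integral>\<^sup>+x. ennreal ((cmod (fourier_transform G x))\<^sup>2) \<partial>distr lebesgue lebesgue uminus)"
    unfolding hG by (subst nn_integral_distr) (auto intro: lebesgue_reflect(1))
  also have "\<dots> = (\<integral>\<^sup>+x. ennreal ((cmod (G x))\<^sup>2) \<partial>lebesgue)"
    unfolding lebesgue_reflect(2) by (rule plancherel[OF G2])
  finally have H: "(\<integral>\<^sup>+x. ennreal ((cmod (half_laplacian s f x))\<^sup>2) \<partial>lebesgue) = ennreal ((2 * pi) powr (2 * s)) * ?I"
    unfolding GI .
  have "(LINT x|lebesgue. (cmod (half_laplacian s f x))\<^sup>2) = enn2real (\<integral>\<^sup>+x. ennreal ((cmod (half_laplacian s f x))\<^sup>2) \<partial>lebesgue)"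
    by (rule integral_eq_nn_integral) (use hm in auto)
  also have "\<dots> = (2 * pi) powr (2 * s) * enn2real ?I" unfolding H by (simp add: enn2real_mult)
  also have "\<dots> = energy_constant s * enn2real (frac_energy s f)"
    unfolding fe energy_constant_def using subordination_constant(1)[OF s] by (simp add: enn2real_mult)
  finally show ?thesis .
qed

subsection \<open>Cutoffs and dilations\<close>

text \<open>The increment of the product is eta x (f x - f y) + (eta x - eta y) f y. In the second
  part x is integrated first, where the kernel mass gives the bound 1 and the second moment a
  multiple of t / R^2. Their minimum is kept because each alone would make the subordination
  integral diverge, the first at 0 and the second at infinity.\<close>

lemma heat_energy_mult_lipschitz:
  fixes f :: "'a::euclidean_space \<Rightarrow> complex" and \<eta> :: "'a \<Rightarrow> real"
  assumes [measurable]: "f \<in> borel_measurable borel" "\<eta> \<in> borel_measurable borel"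
    and \<eta>: "\<And>x. 0 \<le> \<eta> x" "\<And>x. \<eta> x \<le> 1" and lip: "\<And>x y. \<bar>\<eta> x - \<eta> y\<bar> \<le> norm (x - y) / R"
    and R: "0 < R" and t: "0 < t" and d: "0 < (d::real)"
  shows "heat_energy t (\<lambda>x. complex_of_real (\<eta> x) * f x) \<le> ennreal (1 + d) * heat_energy t f +
    ennreal (1 + 1 / d) * ((\<integral>\<^sup>+x. ennreal ((cmod (f x))\<^sup>2) \<partial>lborel) *
      ennreal (min 1 (2 * 2 powr (real DIM('a) / 2) / pi / R\<^sup>2 * t)))"
proof -
  let ?k = "\<lambda>x y::'a. heat_kernel t (x - y)"
  let ?M = "2 * 2 powr (real DIM('a) / 2) / pi / R\<^sup>2 * t"
  have inner: "(\<integral>\<^sup>+x. ennreal (?k x y * (\<eta> x - \<eta> y)\<^sup>2) \<partial>lborel) \<le> ennreal (min 1 ?M)" for y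
  proof -
    have "(\<integral>\<^sup>+x. ennreal (?k x y * (\<eta> x - \<eta> y)\<^sup>2) \<partial>lborel) \<le> (\<integral>\<^sup>+x. ennreal (?k x y) \<partial>lborel)"
    proof (intro nn_integral_mono ennreal_leI)
      fix x
      have "\<bar>\<eta> x - \<eta> y\<bar> \<le> 1" using \<eta>(1)[of x] \<eta>(2)[of x] \<eta>(1)[of y] \<eta>(2)[of y] by linarith
      hence "(\<eta> x - \<eta> y)\<^sup>2 \<le> 1" using abs_square_le_1 by blast
      thus "?k x y * (\<eta> x - \<eta> y)\<^sup>2 \<le> ?k x y" using mult_left_mono[of "(\<eta> x - \<eta> y)\<^sup>2" 1 "?k x y"] by simp
    qed
    also have "\<dots> = ennreal 1" using nn_integral_heat_kernel_diff(2)[OF t] by simp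
    finally have 1: "(\<integral>\<^sup>+x. ennreal (?k x y * (\<eta> x - \<eta> y)\<^sup>2) \<partial>lborel) \<le> ennreal 1" .
    have "(\<integral>\<^sup>+x. ennreal (?k x y * (\<eta> x - \<eta> y)\<^sup>2) \<partial>lborel) \<le>
       (\<integral>\<^sup>+x. ennreal (1 / R\<^sup>2) * ennreal (heat_kernel t (y - x) * (norm (y - x))\<^sup>2) \<partial>lborel)"
    proof (intro nn_integral_mono)
      fix x
      have "(\<eta> x - \<eta> y)\<^sup>2 \<le> (norm (x - y) / R)\<^sup>2"
        using power_mono[OF lip[of x y], of 2] by simp
      hence "?k x y * (\<eta> x - \<eta> y)\<^sup>2 \<le> ?k x y * (norm (x - y) / R)\<^sup>2" by (rule mult_left_mono) simp
      also have "\<dots> = 1 / R\<^sup>2 * (heat_kernel t (y - x) * (norm (y - x))\<^sup>2)"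
        by (simp add: power_divide heat_kernel_minus_commute[of t x] norm_minus_commute[of x])
      finally show "ennreal (?k x y * (\<eta> x - \<eta> y)\<^sup>2) \<le> ennreal (1 / R\<^sup>2) * ennreal (heat_kernel t (y - x) * (norm (y - x))\<^sup>2)"
        by (simp add: ennreal_mult[symmetric] ennreal_leI)
    qed
    also have "\<dots> = ennreal (1 / R\<^sup>2) * (\<integral>\<^sup>+x. ennreal (heat_kernel t (y - x) * (norm (y - x))\<^sup>2) \<partial>lborel)"
      by (rule nn_integral_cmult) measurable
    also have "\<dots> \<le> ennreal (1 / R\<^sup>2) * ennreal (2 * 2 powr (real DIM('a) / 2) / pi * t)"
      by (intro mult_left_mono heat_kernel_second_moment[OF t]) simp
    also have "\<dots> = ennreal ?M" using t by (simp add: ennreal_mult[symmetric])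
    finally have 2: "(\<integral>\<^sup>+x. ennreal (?k x y * (\<eta> x - \<eta> y)\<^sup>2) \<partial>lborel) \<le> ennreal ?M" .
    show ?thesis using 1 2 by (auto simp: min_def)
  qed
  have "heat_energy t (\<lambda>x. complex_of_real (\<eta> x) * f x) \<le>
    (\<integral>\<^sup>+x. \<integral>\<^sup>+y. ennreal (1 + d) * ennreal (?k x y * (cmod (f x - f y))\<^sup>2) +
       ennreal (1 + 1 / d) * (ennreal ((cmod (f y))\<^sup>2) * ennreal (?k x y * (\<eta> x - \<eta> y)\<^sup>2)) \<partial>lborel \<partial>lborel)"
    unfolding heat_energy_def
  proof (intro nn_integral_mono)
    fix x y :: 'a
    define A B where "A = (cmod (f x - f y))\<^sup>2" and "B = (\<eta> x - \<eta> y)\<^sup>2 * (cmod (f y))\<^sup>2"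
    have AB: "0 \<le> A" "0 \<le> B" by (auto simp: A_def B_def)
    have eq: "complex_of_real (\<eta> x) * f x - complex_of_real (\<eta> y) * f y =
      complex_of_real (\<eta> x) * (f x - f y) + complex_of_real (\<eta> x - \<eta> y) * f y"
      by (simp add: algebra_simps)
    have "(cmod (complex_of_real (\<eta> x) * f x - complex_of_real (\<eta> y) * f y))\<^sup>2 \<le>
      (1 + d) * (cmod (complex_of_real (\<eta> x) * (f x - f y)))\<^sup>2 + (1 + 1 / d) * (cmod (complex_of_real (\<eta> x - \<eta> y) * f y))\<^sup>2"
      unfolding eq by (rule cmod_add_sq_le_weighted[OF d])
    also have "\<dots> = (1 + d) * ((\<eta> x)\<^sup>2 * A) + (1 + 1 / d) * B"
      unfolding norm_mult power_mult_distrib norm_of_real power2_abs A_def B_def ..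
    also have "\<dots> \<le> (1 + d) * (1 * A) + (1 + 1 / d) * B"
      using d AB \<eta>[of x] by (intro add_right_mono mult_left_mono mult_right_mono) (auto simp: power_le_one)
    finally have "?k x y * (cmod (complex_of_real (\<eta> x) * f x - complex_of_real (\<eta> y) * f y))\<^sup>2 \<le>
      ?k x y * ((1 + d) * (1 * A) + (1 + 1 / d) * B)"
      by (rule mult_left_mono) simp
    also have "\<dots> = (1 + d) * (?k x y * A) + (1 + 1 / d) * (?k x y * B)"
      by (simp only: distrib_left mult.left_commute mult_1)
    finally have "ennreal (?k x y * (cmod (complex_of_real (\<eta> x) * f x - complex_of_real (\<eta> y) * f y))\<^sup>2) \<le> ennreal \<dots>"
      by (rule ennreal_leI)
    also have "\<dots> = ennreal (1 + d) * ennreal (?k x y * A) + ennreal (1 + 1 / d) * ennreal (?k x y * B)"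
      using d AB by (subst ennreal_plus) (simp_all add: ennreal_mult')
    also have "ennreal (?k x y * B) = ennreal ((cmod (f y))\<^sup>2) * ennreal (?k x y * (\<eta> x - \<eta> y)\<^sup>2)"
      unfolding B_def by (simp add: ennreal_mult[symmetric] mult_ac)
    finally show "ennreal (?k x y * (cmod (complex_of_real (\<eta> x) * f x - complex_of_real (\<eta> y) * f y))\<^sup>2) \<le>
      ennreal (1 + d) * ennreal (?k x y * (cmod (f x - f y))\<^sup>2) +
       ennreal (1 + 1 / d) * (ennreal ((cmod (f y))\<^sup>2) * ennreal (?k x y * (\<eta> x - \<eta> y)\<^sup>2))"
      unfolding A_def .
  qed
  also have "\<dots> = ennreal (1 + d) * heat_energy t f + ennreal (1 + 1 / d) *
      (\<integral>\<^sup>+x. \<integral>\<^sup>+y. ennreal ((cmod (f y))\<^sup>2) * ennreal (?k x y * (\<eta> x - \<eta> y)\<^sup>2) \<partial>lborel \<partial>lborel)"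
    by (simp add: heat_energy_def nn_integral_add nn_integral_cmult)
  also have "(\<integral>\<^sup>+x. \<integral>\<^sup>+y. ennreal ((cmod (f y))\<^sup>2) * ennreal (?k x y * (\<eta> x - \<eta> y)\<^sup>2) \<partial>lborel \<partial>lborel) =
    (\<integral>\<^sup>+y. \<integral>\<^sup>+x. ennreal ((cmod (f y))\<^sup>2) * ennreal (?k x y * (\<eta> x - \<eta> y)\<^sup>2) \<partial>lborel \<partial>lborel)"
    by (rule lborel_pair.Fubini'[symmetric]) measurable
  also have "\<dots> = (\<integral>\<^sup>+y. ennreal ((cmod (f y))\<^sup>2) * (\<integral>\<^sup>+x. ennreal (?k x y * (\<eta> x - \<eta> y)\<^sup>2) \<partial>lborel) \<partial>lborel)"
    by (simp add: nn_integral_cmult)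
  finally have main: "heat_energy t (\<lambda>x. complex_of_real (\<eta> x) * f x) \<le> ennreal (1 + d) * heat_energy t f + ennreal (1 + 1 / d) *
     (\<integral>\<^sup>+y. ennreal ((cmod (f y))\<^sup>2) * (\<integral>\<^sup>+x. ennreal (?k x y * (\<eta> x - \<eta> y)\<^sup>2) \<partial>lborel) \<partial>lborel)" .
  have "(\<integral>\<^sup>+y. ennreal ((cmod (f y))\<^sup>2) * (\<integral>\<^sup>+x. ennreal (?k x y * (\<eta> x - \<eta> y)\<^sup>2) \<partial>lborel) \<partial>lborel) \<le>
     (\<integral>\<^sup>+y. ennreal ((cmod (f y))\<^sup>2) * ennreal (min 1 ?M) \<partial>lborel)"
    by (intro nn_integral_mono mult_left_mono inner) simp
  also have "\<dots> = (\<integral>\<^sup>+y. ennreal ((cmod (f y))\<^sup>2) \<partial>lborel) * ennreal (min 1 ?M)"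
    by (rule nn_integral_multc) measurable
  finally show ?thesis
    using main by (meson add_left_mono mult_left_mono order_trans zero_le)
qed

text \<open>Scaling the minimum of 1 and c t with c of order R^(- 2) produces an error of order R to
  the power - 2 s.\<close>

lemma frac_energy_mult_lipschitz:
  fixes f :: "'a::euclidean_space \<Rightarrow> complex" and \<eta> :: "'a \<Rightarrow> real"
  assumes fm[measurable]: "f \<in> borel_measurable borel" and \<eta>m[measurable]: "\<eta> \<in> borel_measurable borel"
    and \<eta>: "\<And>x. 0 \<le> \<eta> x" "\<And>x. \<eta> x \<le> 1" and lip: "\<And>x y. \<bar>\<eta> x - \<eta> y\<bar> \<le> norm (x - y) / R"
    and R: "0 < R" and d: "0 < (d::real)"
  shows "frac_energy s (\<lambda>x. complex_of_real (\<eta> x) * f x) \<le> ennreal (1 + d) * frac_energy s f +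
    ennreal (1 + 1 / d) * ((\<integral>\<^sup>+x. ennreal ((cmod (f x))\<^sup>2) \<partial>lborel) *
      (ennreal ((2 * 2 powr (real DIM('a) / 2) / pi / R\<^sup>2) powr s) * subordinate s (\<lambda>t. ennreal (min 1 t))))"
proof -
  let ?c = "2 * 2 powr (real DIM('a) / 2) / pi / R\<^sup>2" and ?N = "\<integral>\<^sup>+x. ennreal ((cmod (f x))\<^sup>2) \<partial>lborel"
  have "frac_energy s (\<lambda>x. complex_of_real (\<eta> x) * f x) \<le>
    subordinate s (\<lambda>t. ennreal (1 + d) * heat_energy t f + ennreal (1 + 1 / d) * (?N * ennreal (min 1 (?c * t))))"
    unfolding frac_energy_def
    by (intro subordinate_mono heat_energy_mult_lipschitz fm \<eta>m \<eta> lip R d)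
  also have "\<dots> = ennreal (1 + d) * frac_energy s f + ennreal (1 + 1 / d) * (?N * subordinate s (\<lambda>t. ennreal (min 1 (?c * t))))"
    by (simp add: subordinate_add subordinate_cmult frac_energy_def)
  also have "subordinate s (\<lambda>t. ennreal (min 1 (?c * t))) = ennreal (?c powr s) * subordinate s (\<lambda>t. ennreal (min 1 t))"
    using R by (intro subordinate_scale) auto
  finally show ?thesis .
qed

text \<open>Changing both variables gives l to the power 2 n, of which the kernel takes back l to
  the power n.\<close>

lemma heat_energy_scale:
  fixes f :: "'a::euclidean_space \<Rightarrow> complex"
  assumes [measurable]: "f \<in> borel_measurable borel" and l: "0 < l" and t: "0 < t"
  shows "heat_energy (l\<^sup>2 * t) f = ennreal (l ^ DIM('a)) * heat_energy t (\<lambda>x. f (l *\<^sub>R x))"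
proof -
  have k: "heat_kernel (l\<^sup>2 * t) (l *\<^sub>R x - l *\<^sub>R y) = 1 / l ^ DIM('a) * heat_kernel t (x - y)" for x y :: 'a
  proof -
    have "(l\<^sup>2 * t) powr (- real DIM('a) / 2) = (l\<^sup>2) powr (- real DIM('a) / 2) * t powr (- real DIM('a) / 2)"
      using l t by (simp add: powr_mult)
    also have "(l\<^sup>2) powr (- real DIM('a) / 2) = l powr (- real DIM('a))"
      using l by (simp add: powr_powr flip: powr_numeral)
    also have "\<dots> = 1 / l ^ DIM('a)"
      using l by (simp add: powr_minus_divide powr_realpow)
    finally have "(l\<^sup>2 * t) powr (- real DIM('a) / 2) = 1 / l ^ DIM('a) * t powr (- real DIM('a) / 2)" .
    moreover have "(norm (l *\<^sub>R x - l *\<^sub>R y))\<^sup>2 / (l\<^sup>2 * t) = (norm (x - y))\<^sup>2 / t"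
      using l by (simp add: scaleR_diff_right[symmetric] power_mult_distrib)
    moreover have "heat_kernel r z = r powr (- real DIM('a) / 2) * exp (- pi * ((norm z)\<^sup>2 / r))" for r and z :: 'a
      by (simp add: heat_kernel_def)
    ultimately show ?thesis by (simp only: mult.assoc)
  qed
  let ?L = "ennreal (l ^ DIM('a))"
  have aff: "(\<integral>\<^sup>+x. g x \<partial>lborel) = ?L * (\<integral>\<^sup>+x. g (l *\<^sub>R x) \<partial>lborel)" if "g \<in> borel_measurable borel" for g :: "'a \<Rightarrow> ennreal"
    using nn_integral_lborel_affine[OF that, of l 0] l by simp
  have "heat_energy (l\<^sup>2 * t) f = ?L * (\<integral>\<^sup>+x. (\<integral>\<^sup>+y. ennreal (heat_kernel (l\<^sup>2 * t) (l *\<^sub>R x - y) * (cmod (f (l *\<^sub>R x) - f y))\<^sup>2) \<partial>lborel) \<partial>lborel)"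
    unfolding heat_energy_def by (rule aff) measurable
  also have "\<dots> = ?L * (\<integral>\<^sup>+x. ?L * (\<integral>\<^sup>+y. ennreal (heat_kernel (l\<^sup>2 * t) (l *\<^sub>R x - l *\<^sub>R y) * (cmod (f (l *\<^sub>R x) - f (l *\<^sub>R y)))\<^sup>2) \<partial>lborel) \<partial>lborel)"
    by (intro arg_cong2[of _ _ _ _ "(*)"] refl nn_integral_cong aff) measurable
  also have "\<dots> = ?L * (\<integral>\<^sup>+x. (\<integral>\<^sup>+y. ?L * ennreal (heat_kernel (l\<^sup>2 * t) (l *\<^sub>R x - l *\<^sub>R y) * (cmod (f (l *\<^sub>R x) - f (l *\<^sub>R y)))\<^sup>2) \<partial>lborel) \<partial>lborel)"
    by (simp add: nn_integral_cmult)
  also have "\<dots> = ?L * heat_energy t (\<lambda>x. f (l *\<^sub>R x))"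
    unfolding heat_energy_def k using l
    by (simp add: ennreal_mult[symmetric])
  finally show ?thesis .
qed

text \<open>The power of l stays on the left to avoid a division in \<open>ennreal\<close>.\<close>

lemma frac_energy_scale:
  fixes f :: "'a::euclidean_space \<Rightarrow> complex"
  assumes [measurable]: "f \<in> borel_measurable borel" and l: "0 < l"
  shows "ennreal (l ^ DIM('a)) * frac_energy s (\<lambda>x. f (l *\<^sub>R x)) = ennreal (l powr (2 * s)) * frac_energy s f"
proof -
  have "ennreal (l ^ DIM('a)) * frac_energy s (\<lambda>x. f (l *\<^sub>R x)) = subordinate s (\<lambda>t. ennreal (l ^ DIM('a)) * heat_energy t (\<lambda>x. f (l *\<^sub>R x)))"
    unfolding frac_energy_def by (rule subordinate_cmult[symmetric]) measurable
  also have "\<dots> = subordinate s (\<lambda>t. heat_energy (l\<^sup>2 * t) f)"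
    by (rule subordinate_cong) (simp add: heat_energy_scale l)
  also have "\<dots> = ennreal ((l\<^sup>2) powr s) * frac_energy s f"
    unfolding frac_energy_def using l by (intro subordinate_scale) auto
  also have "(l\<^sup>2) powr s = l powr (2 * s)" using l by (simp add: powr_powr flip: powr_numeral)
  finally show ?thesis .
qed

lemma lborel_integral_scale:
  fixes f :: "'a::euclidean_space \<Rightarrow> real"
  assumes [measurable]: "f \<in> borel_measurable borel" and l: "0 < l"
  shows "(LINT x|lborel. f x) = l ^ DIM('a) * (LINT x|lborel. f (l *\<^sub>R x))"
    and "integrable lborel f \<Longrightarrow> integrable lborel (\<lambda>x. f (l *\<^sub>R x))"
proof -
  have eq: "lborel = density (distr lborel borel (\<lambda>x::'a. 0 + l *\<^sub>R x)) (\<lambda>_. ennreal (l ^ DIM('a)))"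
    using lborel_affine[of l "0::'a"] l by simp
  show "(LINT x|lborel. f x) = l ^ DIM('a) * (LINT x|lborel. f (l *\<^sub>R x))"
    using l by (subst eq) (simp add: integral_density integral_distr)
  assume "integrable lborel f"
  hence "integrable (density (distr lborel borel (\<lambda>x::'a. 0 + l *\<^sub>R x)) (\<lambda>_. ennreal (l ^ DIM('a)))) f"
    using eq by simp
  thus "integrable lborel (\<lambda>x. f (l *\<^sub>R x))"
    using l by (simp add: integrable_density integrable_distr_eq)
qed

subsection \<open>Competitors and the infimum\<close>

text \<open>Lets a minimizer be replaced by a Borel representative. The energy term does not change
  because the two transforms are literally equal.\<close>

lemma admissible_cong_AE:
  fixes u u' :: "'a::euclidean_space \<Rightarrow> real"
  assumes u: "u \<in> admissible V p s" and u'm: "u' \<in> borel_measurable borel"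
    and um: "u \<in> borel_measurable lebesgue" and ae: "AE x in lborel. u x = u' x"
    and Vm: "V \<in> borel_measurable lebesgue"
  shows "u' \<in> admissible V p s" and "sobolev_quotient V p s u' = sobolev_quotient V p s u"
proof -
  let ?c = "\<lambda>v x. complex_of_real (v x)"
  have ae': "AE x in lebesgue. u x = u' x" using ae by (rule AE_completion)
  have m': "u' \<in> borel_measurable lebesgue" using u'm by (intro measurable_completion) simp
  have cm: "?c u \<in> borel_measurable lebesgue" "?c u' \<in> borel_measurable lebesgue" using um m' by auto
  have aec: "AE x in lebesgue. ?c u x = ?c u' x" using ae' by eventually_elim simp
  have ft: "fourier_transform (?c u) = fourier_transform (?c u')" by (rule fourier_transform_cong_AE[OF cm aec])
  hence hl: "half_laplacian s (?c u) = half_laplacian s (?c u')"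
    unfolding half_laplacian_def fourier_multiplier_def inverse_fourier_transform_def by simp
  have pm: "(\<lambda>x. \<bar>u x\<bar> powr p) \<in> borel_measurable lebesgue" "(\<lambda>x. \<bar>u' x\<bar> powr p) \<in> borel_measurable lebesgue"
    and vm: "(\<lambda>x. V x * (u x)\<^sup>2) \<in> borel_measurable lebesgue" "(\<lambda>x. V x * (u' x)\<^sup>2) \<in> borel_measurable lebesgue"
    using um m' Vm by measurable
  have pe: "AE x in lebesgue. \<bar>u x\<bar> powr p = \<bar>u' x\<bar> powr p" and ve: "AE x in lebesgue. V x * (u x)\<^sup>2 = V x * (u' x)\<^sup>2"
    using ae' by (eventually_elim, simp)+
  have "?c u' \<in> sobolev_space s"
    using u square_integrable_cong_AE[OF cm aec] unfolding admissible_def sobolev_space_def by (simp add: ft)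
  moreover have "\<not> (AE x in lebesgue. u' x = 0)"
  proof
    assume "AE x in lebesgue. u' x = 0"
    with ae' have "AE x in lebesgue. u x = 0" by eventually_elim simp
    thus False using u by (simp add: admissible_def)
  qed
  ultimately show "u' \<in> admissible V p s"
    using u integrable_cong_AE[OF pm pe] integrable_cong_AE[OF vm ve] unfolding admissible_def by simp
  show "sobolev_quotient V p s u' = sobolev_quotient V p s u"
    unfolding sobolev_quotient_def hl integral_cong_AE[OF pm pe] integral_cong_AE[OF vm ve] ..
qed

lemma sobolev_infimum_le:
  assumes V: "\<And>x. 0 < V x" and w: "w \<in> admissible V p s"
  shows "sobolev_infimum V p s \<le> sobolev_quotient V p s w"
  unfolding sobolev_infimum_def
proof (rule cINF_lower[OF _ w], rule bdd_belowI2)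
  fix u
  have "0 \<le> (LINT x|lebesgue. V x * (u x)\<^sup>2)"
    using V by (intro integral_nonneg_AE AE_I2 mult_nonneg_nonneg) (auto intro: less_imp_le)
  thus "0 \<le> sobolev_quotient V p s u" unfolding sobolev_quotient_def by simp
qed

lemma borel_admissible:
  fixes w :: "'a::euclidean_space \<Rightarrow> real"
  assumes wm[measurable]: "w \<in> borel_measurable borel" and s: "0 < s" "s < 1"
    and w2: "integrable lborel (\<lambda>x. (w x)\<^sup>2)"
    and wE: "frac_energy s (\<lambda>x. complex_of_real (w x)) < \<infinity>"
    and wp: "integrable lborel (\<lambda>x. \<bar>w x\<bar> powr p)" and D: "0 < (LINT x|lborel. \<bar>w x\<bar> powr p)"
    and Vw: "integrable lebesgue (\<lambda>x. V x * (w x)\<^sup>2)"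
  shows "w \<in> admissible V p s"
    and "sobolev_quotient V p s w = (energy_constant s * enn2real (frac_energy s (\<lambda>x. complex_of_real (w x)))
      + (LINT x|lebesgue. V x * (w x)\<^sup>2)) / (LINT x|lborel. \<bar>w x\<bar> powr p) powr (2 / p)"
proof -
  have cm: "(\<lambda>x. complex_of_real (w x)) \<in> borel_measurable borel" by measurable
  have "square_integrable (\<lambda>x. complex_of_real (w x))"
    unfolding square_integrable_borel_iff[OF cm] using w2 by simp
  hence sob: "(\<lambda>x. complex_of_real (w x)) \<in> sobolev_space s"
    using wE by (simp add: sobolev_space_iff[OF cm s])
  have pm: "(\<lambda>x. \<bar>w x\<bar> powr p) \<in> borel_measurable lborel" by measurable
  have "\<not> (AE x in lebesgue. w x = 0)"
  proof
    assume "AE x in lebesgue. w x = 0"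
    hence "AE x in lborel. \<bar>w x\<bar> powr p = 0" unfolding AE_completion_iff by eventually_elim simp
    hence "(LINT x|lborel. \<bar>w x\<bar> powr p) = 0" by (rule integral_eq_zero_AE)
    thus False using D by simp
  qed
  thus "w \<in> admissible V p s"
    using sob wp Vw unfolding admissible_def by (simp add: integrable_completion[OF pm])
  show "sobolev_quotient V p s w = (energy_constant s * enn2real (frac_energy s (\<lambda>x. complex_of_real (w x)))
      + (LINT x|lebesgue. V x * (w x)\<^sup>2)) / (LINT x|lborel. \<bar>w x\<bar> powr p) powr (2 / p)"
    unfolding sobolev_quotient_def half_laplacian_energy[OF cm s sob] integral_completion[OF pm] ..
qed

text \<open>For v x = w (l x) the energy carries l to the power 2 s - n, the potential term is at
  most C N l^(- n), and the denominator carries l to the power - 2 n / p. Since n - 2 n / p = 2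
  \<open>s\<^sub>0\<close>, the quotient is bounded by multiples of l to the powers 2 s - 2
  \<open>s\<^sub>0\<close> and - 2 \<open>s\<^sub>0\<close>.\<close>

lemma sobolev_infimum_compact_support:
  fixes V w :: "'a::euclidean_space \<Rightarrow> real"
  assumes wm[measurable]: "w \<in> borel_measurable borel" and s: "0 < s" "s < 1"
    and p: "0 < p" and s0: "s \<le> s\<^sub>0" "s\<^sub>0 = (p - 2) * real DIM('a) / (2 * p)"
    and w2: "integrable lborel (\<lambda>x. (w x)\<^sup>2)"
    and wE: "frac_energy s (\<lambda>x. complex_of_real (w x)) < \<infinity>"
    and wp: "integrable lborel (\<lambda>x. \<bar>w x\<bar> powr p)" and D: "0 < (LINT x|lborel. \<bar>w x\<bar> powr p)"
    and supp: "\<And>x. r < norm x \<Longrightarrow> w x = 0"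
    and V: "\<And>x. 0 < V x" "locally_essentially_bounded V"
  shows "sobolev_infimum V p s * (LINT x|lborel. \<bar>w x\<bar> powr p) powr (2 / p) \<le>
    energy_constant s * enn2real (frac_energy s (\<lambda>x. complex_of_real (w x)))"
proof -
  let ?n = "real DIM('a)"
  define S K a N Dp where "S = sobolev_infimum V p s" and "K = energy_constant s"
    and "a = enn2real (frac_energy s (\<lambda>x. complex_of_real (w x)))"
    and "N = (LINT x|lborel. (w x)\<^sup>2)" and "Dp = (LINT x|lborel. \<bar>w x\<bar> powr p)"
  have Vm[measurable]: "V \<in> borel_measurable lebesgue"
    using V(2) by (simp add: locally_essentially_bounded_def)
  obtain C0 where C0: "AE x in lebesgue. x \<in> cball 0 r \<longrightarrow> \<bar>V x\<bar> \<le> C0"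
    using V(2) compact_cball[of 0 r] unfolding locally_essentially_bounded_def by blast
  \<comment> \<open>The bound \<open>C0\<close> may be negative when r < 0, where the ball is
    empty.\<close>
  define C where "C = max C0 0"
  have C: "AE x in lebesgue. x \<in> cball 0 r \<longrightarrow> \<bar>V x\<bar> \<le> C" "0 \<le> C"
    using C0 by (auto simp: C_def elim!: eventually_mono)
  have K: "0 < K" unfolding K_def by (rule energy_constant_pos[OF s])
  have a: "0 \<le> a" unfolding a_def by simp
  have N: "0 \<le> N" unfolding N_def by simp
  have bound: "S * Dp powr (2 / p) \<le> K * a + C * N * l powr (- (2 * s\<^sub>0))" if l: "1 \<le> l" for l :: real
  proof -
    define L where "L = l ^ DIM('a)"
    have l0: "0 < l" and L0: "0 < L" using l by (auto simp: L_def)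
    define v where "v x = w (l *\<^sub>R x)" for x
    have vm[measurable]: "v \<in> borel_measurable borel" unfolding v_def by measurable
    have v2: "integrable lborel (\<lambda>x. (v x)\<^sup>2)" and vN: "(LINT x|lborel. (v x)\<^sup>2) = N / L"
      using lborel_integral_scale[of "\<lambda>x. (w x)\<^sup>2" l] w2 l0 L0 unfolding v_def N_def L_def by auto
    have vp: "integrable lborel (\<lambda>x. \<bar>v x\<bar> powr p)" and vD: "(LINT x|lborel. \<bar>v x\<bar> powr p) = Dp / L"
      using lborel_integral_scale[of "\<lambda>x. \<bar>w x\<bar> powr p" l] wp l0 L0 unfolding v_def Dp_def L_def by auto
    have fe: "ennreal L * frac_energy s (\<lambda>x. complex_of_real (v x)) = ennreal (l powr (2 * s)) * frac_energy s (\<lambda>x. complex_of_real (w x))"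
      unfolding v_def L_def by (rule frac_energy_scale[OF _ l0]) measurable
    have vE: "frac_energy s (\<lambda>x. complex_of_real (v x)) < \<infinity>"
    proof (rule ccontr)
      assume "\<not> frac_energy s (\<lambda>x. complex_of_real (v x)) < \<infinity>"
      hence "frac_energy s (\<lambda>x. complex_of_real (v x)) = top" by (simp add: less_top[symmetric])
      hence "ennreal (l powr (2 * s)) * frac_energy s (\<lambda>x. complex_of_real (w x)) = top"
        using fe L0 by (simp add: ennreal_mult_top)
      thus False using wE by (simp add: ennreal_mult_eq_top_iff)
    qed
    have ve: "enn2real (frac_energy s (\<lambda>x. complex_of_real (v x))) = l powr (2 * s) * a / L"
      using arg_cong[OF fe, of enn2real] L0 unfolding a_def by (simp add: enn2real_mult field_simps)
    \<comment> \<open>As l \<ge> 1, the support of v stays inside the ball of radius r, so one bound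
      C serves all dilations.\<close>
    have le: "AE x in lebesgue. \<bar>V x * (v x)\<^sup>2\<bar> \<le> C * (v x)\<^sup>2"
      using C(1)
    proof eventually_elim
      case (elim x)
      show ?case
      proof (cases "norm x \<le> r")
        case True
        thus ?thesis using elim by (simp add: abs_mult mult_right_mono)
      next
        case False
        have "norm x \<le> l * norm x" using mult_right_mono[OF l, of "norm x"] by simp
        hence "v x = 0" unfolding v_def using False l0 by (intro supp) simp
        thus ?thesis by simp
      qed
    qed
    have v2m: "(\<lambda>x. (v x)\<^sup>2) \<in> borel_measurable lborel" by measurable
    have v2m': "(\<lambda>x. (v x)\<^sup>2) \<in> borel_measurable lebesgue" using v2m by (rule measurable_completion)
    have Cv: "integrable lebesgue (\<lambda>x. C * (v x)\<^sup>2)"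
      using v2 by (simp add: integrable_completion[OF v2m])
    have Vv: "integrable lebesgue (\<lambda>x. V x * (v x)\<^sup>2)"
    proof (rule Bochner_Integration.integrable_bound[OF Cv])
      show "(\<lambda>x. V x * (v x)\<^sup>2) \<in> borel_measurable lebesgue" using v2m' by measurable
      show "AE x in lebesgue. norm (V x * (v x)\<^sup>2) \<le> norm (C * (v x)\<^sup>2)"
        using le by eventually_elim simp
    qed
    have "(LINT x|lebesgue. V x * (v x)\<^sup>2) \<le> (LINT x|lebesgue. C * (v x)\<^sup>2)"
      by (rule integral_mono_AE[OF Vv Cv]) (use le in eventually_elim, auto)
    also have "\<dots> = C * N / L" by (simp add: integral_completion[OF v2m] vN)
    finally have VN: "(LINT x|lebesgue. V x * (v x)\<^sup>2) \<le> C * N / L" .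
    have Dv: "0 < (LINT x|lborel. \<bar>v x\<bar> powr p)" unfolding vD using D L0 by (simp add: Dp_def)
    note adm = borel_admissible[OF vm s v2 vE vp Dv Vv]
    have "S \<le> (K * (l powr (2 * s) * a / L) + (LINT x|lebesgue. V x * (v x)\<^sup>2)) / (Dp / L) powr (2 / p)"
      using sobolev_infimum_le[OF V(1) adm(1)] unfolding adm(2) vD ve S_def K_def .
    hence "S * (Dp / L) powr (2 / p) \<le> K * (l powr (2 * s) * a / L) + (LINT x|lebesgue. V x * (v x)\<^sup>2)"
      using D L0 by (simp add: pos_le_divide_eq Dp_def)
    also have "\<dots> \<le> K * (l powr (2 * s) * a / L) + C * N / L" using VN by simp
    finally have "S * (Dp / L) powr (2 / p) * L powr (2 / p) \<le> (K * (l powr (2 * s) * a / L) + C * N / L) * L powr (2 / p)"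
      by (rule mult_right_mono) simp
    also have "S * (Dp / L) powr (2 / p) * L powr (2 / p) = S * Dp powr (2 / p)"
      using D L0 by (simp add: Dp_def powr_divide)
    also have "(K * (l powr (2 * s) * a / L) + C * N / L) * L powr (2 / p) = (K * a * l powr (2 * s) + C * N) * (L powr (2 / p) / L)"
      using L0 by (simp add: field_simps)
    also have "L powr (2 / p) / L = l powr (- (2 * s\<^sub>0))"
    proof -
      have L: "L = l powr ?n" using l0 by (simp add: L_def powr_realpow)
      have "?n * (2 / p) - ?n = - (2 * s\<^sub>0)" unfolding s0(2) using p by (simp add: field_simps)
      moreover have "L powr (2 / p) / L = l powr (?n * (2 / p) - ?n)"
        unfolding L powr_powr powr_diff ..
      ultimately show ?thesis by simp
    qed
    also have "(K * a * l powr (2 * s) + C * N) * l powr (- (2 * s\<^sub>0)) = K * a * l powr (2 * s - 2 * s\<^sub>0) + C * N * l powr (- (2 * s\<^sub>0))"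
      by (simp add: distrib_right powr_add[symmetric] mult.assoc)
    also have "\<dots> \<le> K * a * 1 + C * N * l powr (- (2 * s\<^sub>0))"
    proof (intro add_right_mono mult_left_mono)
      show "l powr (2 * s - 2 * s\<^sub>0) \<le> 1"
        using powr_mono[of "2 * s - 2 * s\<^sub>0" 0 l] s0(1) l by simp
    qed (use K a in simp)
    finally show ?thesis by simp
  qed
  \<comment> \<open>The dilation factors are l = n + 1 \<ge> 1; the exponent is negative because
    \<open>s\<^sub>0\<close> is at least s > 0.\<close>
  have "(\<lambda>n. real (Suc n) powr (- (2 * s\<^sub>0))) \<longlonglongrightarrow> 0"
    using s s0 by (intro LIMSEQ_Suc tendsto_neg_powr filterlim_real_sequentially) auto
  hence "(\<lambda>n. K * a + C * N * real (Suc n) powr (- (2 * s\<^sub>0))) \<longlonglongrightarrow> K * a + C * N * 0"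
    by (intro tendsto_intros)
  hence "S * Dp powr (2 / p) \<le> K * a + C * N * 0"
    by (rule LIMSEQ_le_const) (use bound in auto)
  thus ?thesis unfolding S_def K_def a_def Dp_def by simp
qed

section \<open>From compact support to all competitors\<close>

definition cutoff :: "real \<Rightarrow> 'a::euclidean_space \<Rightarrow> real" where
  "cutoff R x = max 0 (min 1 (2 - norm x / R))"

lemma cutoff_measurable [measurable]: "cutoff R \<in> borel_measurable borel"
  unfolding cutoff_def by measurable

lemma cutoff_bounds: "0 \<le> cutoff R x" "cutoff R x \<le> 1"
  by (auto simp: cutoff_def)

lemma cutoff_eq_0: "0 < R \<Longrightarrow> 2 * R < norm x \<Longrightarrow> cutoff R x = 0"
  by (simp add: cutoff_def field_simps)

lemma cutoff_eq_1: "0 < R \<Longrightarrow> norm x \<le> R \<Longrightarrow> cutoff R x = 1"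
  by (simp add: cutoff_def field_simps)

lemma cutoff_lipschitz:
  assumes R: "0 < R"
  shows "\<bar>cutoff R x - cutoff R y\<bar> \<le> norm (x - y) / R"
proof -
  have "\<bar>cutoff R x - cutoff R y\<bar> \<le> \<bar>norm x / R - norm y / R\<bar>"
    unfolding cutoff_def by (simp add: max_def min_def) linarith
  also have "\<dots> = \<bar>norm x - norm y\<bar> / R" using R by (simp add: diff_divide_distrib[symmetric])
  also have "\<dots> \<le> norm (x - y) / R" using R by (intro divide_right_mono norm_triangle_ineq3) simp
  finally show ?thesis .
qed

lemma sobolev_infimum_le_frac_energy:
  fixes V u :: "'a::euclidean_space \<Rightarrow> real"
  assumes um[measurable]: "u \<in> borel_measurable borel" and s: "0 < s" "s < 1"
    and p: "0 < p" and s0: "s \<le> s\<^sub>0" "s\<^sub>0 = (p - 2) * real DIM('a) / (2 * p)"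
    and u2: "integrable lborel (\<lambda>x. (u x)\<^sup>2)"
    and uE: "frac_energy s (\<lambda>x. complex_of_real (u x)) < \<infinity>"
    and up: "integrable lborel (\<lambda>x. \<bar>u x\<bar> powr p)" and D: "0 < (LINT x|lborel. \<bar>u x\<bar> powr p)"
    and V: "\<And>x. 0 < V x" "locally_essentially_bounded V"
  shows "sobolev_infimum V p s * (LINT x|lborel. \<bar>u x\<bar> powr p) powr (2 / p) \<le>
    energy_constant s * enn2real (frac_energy s (\<lambda>x. complex_of_real (u x)))"
proof -
  define S K a N Dp where "S = sobolev_infimum V p s" and "K = energy_constant s"
    and "a = enn2real (frac_energy s (\<lambda>x. complex_of_real (u x)))"
    and "N = (LINT x|lborel. (u x)\<^sup>2)" and "Dp = (LINT x|lborel. \<bar>u x\<bar> powr p)"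
  \<comment> \<open>The constant of \<open>heat_kernel_second_moment\<close>: at cutoff radius n + 1
    the energy error is proportional to M / (n + 1)^2 to the power s.\<close>
  define M where "M = 2 * 2 powr (real DIM('a) / 2) / pi"
  define \<kappa> where "\<kappa> = enn2real (subordinate s (\<lambda>t. ennreal (min 1 t)))"
  have \<kappa>: "subordinate s (\<lambda>t. ennreal (min 1 t)) = ennreal \<kappa>" "0 \<le> \<kappa>"
    unfolding \<kappa>_def using subordinate_min_finite[OF s] by auto
  have K: "0 < K" unfolding K_def by (rule energy_constant_pos[OF s])
  have a: "0 \<le> a" unfolding a_def by simp
  have fa: "frac_energy s (\<lambda>x. complex_of_real (u x)) = ennreal a" using uE unfolding a_def by simp
  have N: "0 \<le> N" unfolding N_def by simp
  have NN: "(\<integral>\<^sup>+x. ennreal ((cmod (complex_of_real (u x)))\<^sup>2) \<partial>lborel) = ennreal N"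
    unfolding N_def using nn_integral_eq_integral[OF u2] by simp
  define w where "w n x = cutoff (real (Suc n)) x * u x" for n x
  have wm[measurable]: "w n \<in> borel_measurable borel" for n unfolding w_def by measurable
  have wle: "\<bar>w n x\<bar> \<le> \<bar>u x\<bar>" for n x
    using cutoff_bounds[of "real (Suc n)" x] mult_right_mono[of "cutoff (real (Suc n)) x" 1 "\<bar>u x\<bar>"]
    unfolding w_def abs_mult by simp
  have wlim: "(\<lambda>n. w n x) \<longlonglongrightarrow> u x" for x
  proof (rule tendsto_eventually)
    show "\<forall>\<^sub>F n in sequentially. w n x = u x"
      using eventually_ge_at_top[of "nat \<lceil>norm x\<rceil>"]
    proof eventually_elim
      case (elim n)
      hence "norm x \<le> real (Suc n)" by linarith
      thus ?case unfolding w_def by (simp add: cutoff_eq_1)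
    qed
  qed
  have w2: "integrable lborel (\<lambda>x. (w n x)\<^sup>2)" for n
    by (rule Bochner_Integration.integrable_bound[OF u2]) (auto intro!: AE_I2 simp: abs_le_square_iff[symmetric] wle)
  have wple: "\<bar>w n x\<bar> powr p \<le> \<bar>u x\<bar> powr p" for n x
    using wle[of n x] p by (intro powr_mono2) auto
  have wp: "integrable lborel (\<lambda>x. \<bar>w n x\<bar> powr p)" for n
    by (rule Bochner_Integration.integrable_bound[OF up]) (auto intro!: AE_I2 wple)
  have Dlim: "(\<lambda>n. LINT x|lborel. \<bar>w n x\<bar> powr p) \<longlonglongrightarrow> Dp"
    unfolding Dp_def
  proof (rule integral_dominated_convergence[OF _ _ up])
    show "AE x in lborel. (\<lambda>n. \<bar>w n x\<bar> powr p) \<longlonglongrightarrow> \<bar>u x\<bar> powr p"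
    proof (intro AE_I2)
      fix x
      show "(\<lambda>n. \<bar>w n x\<bar> powr p) \<longlonglongrightarrow> \<bar>u x\<bar> powr p"
        using p by (intro tendsto_powr2 tendsto_rabs wlim tendsto_const) auto
    qed
  qed (auto intro!: AE_I2 wple)
  have wE: "frac_energy s (\<lambda>x. complex_of_real (w n x)) \<le>
      ennreal ((1 + d) * a + (1 + 1 / d) * N * ((M / (real (Suc n))\<^sup>2) powr s * \<kappa>))" if d: "0 < d" for d n
  proof -
    have "frac_energy s (\<lambda>x. complex_of_real (cutoff (real (Suc n)) x) * complex_of_real (u x)) \<le>
      ennreal (1 + d) * frac_energy s (\<lambda>x. complex_of_real (u x)) +
      ennreal (1 + 1 / d) * ((\<integral>\<^sup>+x. ennreal ((cmod (complex_of_real (u x)))\<^sup>2) \<partial>lborel) *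
      (ennreal ((2 * 2 powr (real DIM('a) / 2) / pi / (real (Suc n))\<^sup>2) powr s) * subordinate s (\<lambda>t. ennreal (min 1 t))))"
      by (rule frac_energy_mult_lipschitz[OF _ _ cutoff_bounds cutoff_lipschitz _ d]) auto
    also have "\<dots> = ennreal (1 + d) * ennreal a + ennreal (1 + 1 / d) * (ennreal N * (ennreal ((M / (real (Suc n))\<^sup>2) powr s) * ennreal \<kappa>))"
      unfolding fa NN \<kappa>(1) M_def ..
    also have "\<dots> = ennreal ((1 + d) * a + (1 + 1 / d) * N * ((M / (real (Suc n))\<^sup>2) powr s * \<kappa>))"
      using d a N \<kappa>(2) by (subst ennreal_plus) (simp_all add: ennreal_mult mult.assoc)
    finally show ?thesis unfolding w_def by simp
  qed
  \<comment> \<open>The radius goes to infinity with d fixed; d tends to 0 only afterwards, because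
    of the factor 1 + 1 / d in the error.\<close>
  have bound: "S * Dp powr (2 / p) \<le> K * ((1 + d) * a)" if d: "0 < d" for d
  proof (rule LIMSEQ_le)
    show "(\<lambda>n. S * (LINT x|lborel. \<bar>w n x\<bar> powr p) powr (2 / p)) \<longlonglongrightarrow> S * Dp powr (2 / p)"
      using D by (intro tendsto_mult tendsto_const tendsto_powr Dlim) (auto simp: Dp_def)
    have "(\<lambda>n. M * (1 / real (Suc n))\<^sup>2) \<longlonglongrightarrow> M * 0\<^sup>2"
      by (intro tendsto_intros LIMSEQ_Suc lim_1_over_n)
    hence "(\<lambda>n. M / (real (Suc n))\<^sup>2) \<longlonglongrightarrow> 0" by (simp add: power_divide)
    hence lim: "(\<lambda>n. (M / (real (Suc n))\<^sup>2) powr s) \<longlonglongrightarrow> 0 powr s"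
      using s by (intro tendsto_powr2 tendsto_const always_eventually) (auto simp: M_def)
    have "(\<lambda>n. K * ((1 + d) * a + (1 + 1 / d) * N * ((M / (real (Suc n))\<^sup>2) powr s * \<kappa>))) \<longlonglongrightarrow>
       K * ((1 + d) * a + (1 + 1 / d) * N * (0 powr s * \<kappa>))"
      by (intro tendsto_mult tendsto_add tendsto_const lim)
    thus "(\<lambda>n. K * ((1 + d) * a + (1 + 1 / d) * N * ((M / (real (Suc n))\<^sup>2) powr s * \<kappa>))) \<longlonglongrightarrow> K * ((1 + d) * a)"
      by simp
    \<comment> \<open>A small cutoff radius may annihilate u; the denominators are positive only
      from some index on.\<close>
    have "\<forall>\<^sub>F n in sequentially. 0 < (LINT x|lborel. \<bar>w n x\<bar> powr p)"
      using Dlim D unfolding Dp_def by (rule order_tendstoD(1))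
    then obtain n0 where n0: "\<And>n. n0 \<le> n \<Longrightarrow> 0 < (LINT x|lborel. \<bar>w n x\<bar> powr p)"
      by (auto simp: eventually_sequentially)
    show "\<exists>m. \<forall>n\<ge>m. S * (LINT x|lborel. \<bar>w n x\<bar> powr p) powr (2 / p) \<le>
      K * ((1 + d) * a + (1 + 1 / d) * N * ((M / (real (Suc n))\<^sup>2) powr s * \<kappa>))"
    proof (intro exI[of _ n0] allI impI)
      fix n assume n: "n0 \<le> n"
      let ?b = "(1 + d) * a + (1 + 1 / d) * N * ((M / (real (Suc n))\<^sup>2) powr s * \<kappa>)"
      have b: "0 \<le> ?b" using d a N \<kappa>(2) by simp
      have fin: "frac_energy s (\<lambda>x. complex_of_real (w n x)) < \<infinity>"
        using wE[OF d, of n] by (simp add: le_less_trans)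
      have "S * (LINT x|lborel. \<bar>w n x\<bar> powr p) powr (2 / p) \<le> K * enn2real (frac_energy s (\<lambda>x. complex_of_real (w n x)))"
        unfolding S_def K_def
      proof (rule sobolev_infimum_compact_support[OF wm s p s0 w2 fin wp n0[OF n] _ V])
        show "w n x = 0" if "2 * real (Suc n) < norm x" for x
          using cutoff_eq_0[of "real (Suc n)" x] that unfolding w_def by simp
      qed
      also have "\<dots> \<le> K * ?b"
        using K enn2real_mono[OF wE[OF d, of n]] b by (intro mult_left_mono) (auto simp: enn2real_ennreal)
      finally show "S * (LINT x|lborel. \<bar>w n x\<bar> powr p) powr (2 / p) \<le> K * ?b" .
    qed
  qed
  have "S * Dp powr (2 / p) \<le> K * ((1 + 0) * a)"
  proof (rule LIMSEQ_le_const)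
    show "(\<lambda>n. K * ((1 + 1 / real (Suc n)) * a)) \<longlonglongrightarrow> K * ((1 + 0) * a)"
      by (intro tendsto_intros LIMSEQ_Suc lim_1_over_n)
  qed (use bound in auto)
  thus ?thesis unfolding S_def K_def a_def Dp_def by simp
qed

theorem lemma8p1:
  fixes V :: "real ^ 'n \<Rightarrow> real" and p s s\<^sub>0 :: real
  assumes "CARD('n) \<ge> 4"
    and "2 < p" and "p < 2 * real CARD('n) / (real CARD('n) - 2)"
    and "s\<^sub>0 = (p - 2) * real CARD('n) / (2 * p)"
    and "0 < s" and "s \<le> s\<^sub>0"
    and "(INF x. ereal (V x)) > 0"
    and "locally_essentially_bounded V"
  shows "\<not> (\<exists>u\<in>admissible V p s. sobolev_quotient V p s u = sobolev_infimum V p s)"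
proof
  assume "\<exists>u\<in>admissible V p s. sobolev_quotient V p s u = sobolev_infimum V p s"
  then obtain u0 where u0: "u0 \<in> admissible V p s" "sobolev_quotient V p s u0 = sobolev_infimum V p s" by blast
  have n: "real CARD('n) - 2 > 0" using assms(1) by linarith
  \<comment> \<open>The subcritical range of p is rewritten as \<open>s\<^sub>0\<close> < 1, which
    brings s into the range of the subordination formula.\<close>
  have "p * (real CARD('n) - 2) < 2 * real CARD('n)" using assms(3) n by (simp add: pos_less_divide_eq)
  hence "(p - 2) * real CARD('n) < 1 * (2 * p)" by (simp add: algebra_simps)
  hence "s\<^sub>0 < 1" unfolding assms(4) using assms(2) by (subst pos_divide_less_eq) auto
  hence s: "0 < s" "s < 1" using assms(5,6) by linarith+
  have p: "0 < p" using assms by simp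
  have s0: "s\<^sub>0 = (p - 2) * real DIM(real^'n) / (2 * p)" using assms(4) by simp
  \<comment> \<open>The infimum is taken in \<open>ereal\<close>, where it bounds every value from
    below without a boundedness condition.\<close>
  have V: "0 < V x" for x
  proof -
    have "0 < ereal (V x)" using assms(7) INF_lower[of x UNIV "\<lambda>x. ereal (V x)"] by (rule less_le_trans) simp
    thus ?thesis by simp
  qed
  have Vm: "V \<in> borel_measurable lebesgue" using assms(8) by (simp add: locally_essentially_bounded_def)
  have "(\<lambda>x. complex_of_real (u0 x)) \<in> borel_measurable lebesgue"
    using u0(1) by (simp add: admissible_def sobolev_space_def square_integrable_def)
  from measurable_compose[OF this borel_measurable_Re] have u0m: "u0 \<in> borel_measurable lebesgue" by simp
  then obtain u where um: "u \<in> borel_measurable lborel" and ae: "AE x in lborel. u0 x = u x"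
    using completion_ex_borel_measurable_real by blast
  have um': "u \<in> borel_measurable borel" using um by simp
  note adm = admissible_cong_AE[OF u0(1) um' u0m ae Vm]
  have cm: "(\<lambda>x. complex_of_real (u x)) \<in> borel_measurable borel" using um' by measurable
  have sob: "(\<lambda>x. complex_of_real (u x)) \<in> sobolev_space s" using adm(1) by (simp add: admissible_def)
  hence E: "frac_energy s (\<lambda>x. complex_of_real (u x)) < \<infinity>" and sq: "square_integrable (\<lambda>x. complex_of_real (u x))"
    using sobolev_space_iff[OF cm s] by auto
  have u2: "integrable lborel (\<lambda>x. (u x)\<^sup>2)" using sq unfolding square_integrable_borel_iff[OF cm] by simp
  have pm: "(\<lambda>x. \<bar>u x\<bar> powr p) \<in> borel_measurable lborel" using um by measurable
  have up: "integrable lborel (\<lambda>x. \<bar>u x\<bar> powr p)"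
    using adm(1) by (simp add: admissible_def integrable_completion[OF pm])
  have nz: "\<not> (AE x in lborel. u x = 0)" using adm(1) by (simp add: admissible_def AE_completion_iff)
  have D: "0 < (LINT x|lborel. \<bar>u x\<bar> powr p)"
  proof (rule ccontr)
    assume "\<not> 0 < (LINT x|lborel. \<bar>u x\<bar> powr p)"
    hence "(LINT x|lborel. \<bar>u x\<bar> powr p) = 0" by (simp add: antisym not_less)
    hence "AE x in lborel. \<bar>u x\<bar> powr p = 0"
      using integral_nonneg_eq_0_iff_AE[OF up] by simp
    hence "AE x in lborel. u x = 0" by eventually_elim simp
    thus False using nz by simp
  qed
  have Vu: "integrable lebesgue (\<lambda>x. V x * (u x)\<^sup>2)" using adm(1) by (simp add: admissible_def)
  \<comment> \<open>A vanishing integral would force V u^2, hence u, to vanish almost everywhere.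
    This strict positivity is the gap that excludes a minimizer.\<close>
  have Vpos: "0 < (LINT x|lebesgue. V x * (u x)\<^sup>2)"
  proof (rule ccontr)
    assume "\<not> 0 < (LINT x|lebesgue. V x * (u x)\<^sup>2)"
    moreover have nn: "0 \<le> V x * (u x)\<^sup>2" for x using V[of x] by simp
    ultimately have "(LINT x|lebesgue. V x * (u x)\<^sup>2) = 0"
      by (intro antisym) (auto simp: not_less intro: integral_nonneg_AE)
    hence "AE x in lebesgue. V x * (u x)\<^sup>2 = 0"
      using integral_nonneg_eq_0_iff_AE[OF Vu] nn by simp
    hence "AE x in lebesgue. u x = 0"
      by eventually_elim (use V in \<open>auto simp: less_le\<close>)
    thus False using nz by (simp add: AE_completion_iff)
  qed
  let ?Dp = "(LINT x|lborel. \<bar>u x\<bar> powr p) powr (2 / p)"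
  have "sobolev_infimum V p s = (energy_constant s * enn2real (frac_energy s (\<lambda>x. complex_of_real (u x)))
      + (LINT x|lebesgue. V x * (u x)\<^sup>2)) / ?Dp"
    using borel_admissible(2)[OF um' s u2 E up D Vu] adm(2) u0(2) by simp
  hence "sobolev_infimum V p s * ?Dp = energy_constant s * enn2real (frac_energy s (\<lambda>x. complex_of_real (u x)))
      + (LINT x|lebesgue. V x * (u x)\<^sup>2)"
    using D by simp
  \<comment> \<open>Minimality expresses the left side as energy plus potential term; the cutoff and
    dilation argument bounds it by the energy alone.\<close>
  moreover have "sobolev_infimum V p s * ?Dp \<le> energy_constant s * enn2real (frac_energy s (\<lambda>x. complex_of_real (u x)))"
    by (rule sobolev_infimum_le_frac_energy[OF um' s p assms(6) s0 u2 E up D V assms(8)])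
  ultimately show False using Vpos by linarith
qed

end
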